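(* In the setting of the context (in particular with $\sigma$ and $g$ Lipschitz in $x$ and $m$, and with $\hat\gamma,\hat\mu,V,\chi,\Theta$ fixed as there), there exist positive constants $\hat C_1,\hat C_2,\hat C_3$ (independent of $N$, of $\mathbf{x}$ and of $j$) such that for every $N$, every $\mathbf{x}=(x_{N,0}^1,\dots,x_{N,0}^N)\in (G_0)^N$, every player $j\in\{1,\dots,N\}$ and every $\varrho_N^j\in\mathcal{P}(\mathcal{U})$ $$\bar J_N^j(\hat\varrho_N)\ge\bar J_N^j(\hat\varrho_N|\varrho_N^j)-\hat C_1W(m_0,\delta_{\mathbf{x}}^N)-\hat C_2N\max_{i=1,\dots,N}\int_{G}\|x-x_{N,0}^i\|\,m_N^i(dx)-\hat C_3\frac1N .$$ In particular, if (for a choice of $\mathbf{x}$ for each $N$) $W(m_0,\delta^N_{\mathbf{x}})\to0$ and $N\max_{i=1,\dots,N}\int_G\|x-x_{N,0}^i\|\,m_N^i(dx)\to0$ as $N\to\infty$, then for every $\varepsilon>0$ there is $N_0$ such that for all $N>N_0$ the profile $\hat\varrho_N$ is an $\varepsilon$-Nash equilibrium of the $N$-player game, i.e. $\bar J_N^j(\hat\varrho_N)\ge\bar J_N^j(\hat\varrho_N|\varrho_N^j)-\varepsilon$ for all $j$ and all $\varrho_N^j\in\mathcal{P}(\mathcal{U})$.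
   Context: Spaces of measures. $\mathcal{P}(S)$ is the set of Borel probability measures on $S$; $\mathcal{P}(\mathbb{R}^n)$ is the set of Borel probability measures on $\mathbb{R}^n$ with finite first moment, metrized by $W(m',m'')=\sup\{\int\phi\,d(m'-m''):\phi\ \text{1-Lipschitz}\}$. $\mathcal{M}$ is the set of continuous maps $\mu:[0,T]\to\mathcal{P}(\mathbb{R}^n)$. $h\#m$ is push-forward. Data and standing assumptions. $T>0$; $P$ is a nonempty compact metric space; $f:[0,T]\times\mathbb{R}^n\times\mathcal{P}(\mathbb{R}^n)\times P\to\mathbb{R}^n$, $g:[0,T]\times\mathbb{R}^n\times\mathcal{P}(\mathbb{R}^n)\times P\to\mathbb{R}$ and $\sigma:\mathbb{R}^n\times\mathcal{P}(\mathbb{R}^n)\to\mathbb{R}$ are continuous; $\|f(t,x',m,u)-f(t,x'',m,u)\|\le L_{f,x}\|x'-x''\|$, $\|f(t,x,m',u)-f(t,x,m'',u)\|\le L_{f,m}W(m',m'')$; $m_0\in\mathcal{P}(\mathbb{R}^n)$ has compact support $G_0$. There is a compact set $G\subset\mathbb{R}^n$ such that for every $\mu\in\mathcal{M}$, measurable $u:[0,T]\to P$ and solution of $\dot x=f(t,x,\mu[t],u(t))$ with $x(0)\in G_0$, $x(t)\in G$ on $[0,T]$. Additionally, for all $t\in[0,T]$, $x',x''\in G$, $m',m''\in\mathcal{P}(G)$, $u\in P$: $|\sigma(x',m')-\sigma(x'',m'')|\le L_{\sigma,x}\|x'-x''\|+L_{\sigma,m}W(m',m'')$ and $|g(t,x',m',u)-g(t,x'',m'',u)|\le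 L_{g,x}\|x'-x''\|+L_{g,m}W(m',m'')$. Control measures. $\mathcal{U}$ is the set of nonnegative Borel measures $\alpha$ on $[0,T]\times P$ whose marginal on $[0,T]$ is Lebesgue measure, with the weak topology. For $\mu\in\mathcal{M}$, $\alpha\in\mathcal{U}$, $x(\cdot,t_*,x_*,\alpha,\mu)$ solves $x(t)=x_*+\int_{[t_*,t]\times P}f(\tau,x(\tau),\mu[\tau],u)\alpha(d(\tau,u))$, and $w(t,t_*,x_*,\alpha,\mu)=-\int_{[t_*,t]\times P}g(\tau,x(\tau,t_*,x_*,\alpha,\mu),\mu[\tau],u)\alpha(d(\tau,u))$. Infinite-player equilibrium. Let $\Omega=G_0\times[0,1]$, $\eta=m_0\times\lambda$ ($\lambda$ Lebesgue), $x_0(\omega',\omega'')=\omega'$, and let $\mathcal{D}$ be the set of Borel probability measures on $\Omega\times\mathcal{U}$ with $\Omega$-marginal $\eta$. For $\gamma\in\mathcal{D}$ there is a unique $\mu\in\mathcal{M}$ such that $\mu[t]$ is, for all $t$, the push-forward of $\gamma$ under $(\omega,\alpha)\mapsto x(t,0,x_0(\omega),\alpha,\mu)$. Put $J[\omega,\alpha,\mu]=\sigma(x(T,0,x_0(\omega),\alpha,\mu),\mu[T])+w(T,0,x_0(\omega),\alpha,\mu)$. $\hat\gamma\in\mathcal{D}$ is a Nash equilibrium if, for the corresponding $\hat\mu$, for $\eta$-a.e. $\omega$ and all $\varrho\in\mathcal{P}(\mathcal{U})$, $\int J[\omega,\alpha,\hat\mu]\varrho(d\alpha)\le\int J[\omega,\alpha,\hat\mu]\frac{\partial\hat\gamma}{\partial\eta}(\omega,d\alpha)$,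 where $\frac{\partial\hat\gamma}{\partial\eta}$ is the disintegration of $\hat\gamma$ along $\eta$. Fix a Nash equilibrium $\hat\gamma$ and its $\hat\mu$. Write $\hat x(\cdot,t_*,x_*,\alpha)=x(\cdot,t_*,x_*,\alpha,\hat\mu)$, $\hat w(\cdot,t_*,x_*,\alpha)=w(\cdot,t_*,x_*,\alpha,\hat\mu)$, $\hat y[t,\omega,\alpha]=\hat x(t,0,x_0(\omega),\alpha)$, and $$V(t_*,x_* )=\max_{\alpha\in\mathcal{U}}\{\sigma(\hat x(T,t_*,x_*,\alpha),\hat\mu[T])+\hat w(T,t_*,x_*,\alpha)\}.$$ Let $E^-(t,x,m)=\mathrm{co}\{(f(t,x,m,u),g(t,x,m,u)):u\in P\}$ and let $\mathcal{S}[V,\hat\mu]$ be the set of absolutely continuous $(x(\cdot),z(\cdot)):[0,T]\to\mathbb{R}^{n+1}$ with $(\dot x,\dot z)\in E^-(t,x,\hat\mu[t])$ a.e. and $z(t)=V(t,x(t))$; $\mathcal{S}[V,0,x_*,\hat\mu]$ is its subset with $x(0)=x_*$. Let $\chi$ be the push-forward of $\hat\gamma$ under $(\omega,\alpha)\mapsto(\hat y[\cdot,\omega,\alpha],V(\cdot,\hat y[\cdot,\omega,\alpha]))$; it is concentrated on $\mathcal{S}[V,\hat\mu]$. Let $(\chi_{0,x_*})_{x_*\in G_0}$ be its disintegration with respect to $x(0)$: $\chi_{0,x_*}$ is a probability measure on $\mathcal{S}[V,0,x_*,\hat\mu]$ and $\chi=\int_{G_0}\chi_{0,x_*}m_0(dx_*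 )$. Let $\Theta:\mathcal{S}[V,\hat\mu]\to\mathcal{U}$ be a measurable map such that $\beta=\Theta[x(\cdot),z(\cdot)]$ satisfies $x(t)=\hat x(t,0,x(0),\beta)$ and $z(t)=V(0,x(0))-\hat w(t,0,x(0),\beta)$ for all $t\in[0,T]$. $N$-player game. For $\mathbf{x}=(x_{N,0}^1,\dots,x_{N,0}^N)\in(G_0)^N$ put $\delta_{\mathbf{x}}^N=\frac1N\sum_i\delta_{x_{N,0}^i}$. Let $m_N^1,\dots,m_N^N$ be (existing) nonnegative Borel measures with $m_0=\sum_im_N^i$, $m_N^i(G_0)=1/N$, $W(m_0,\delta_{\mathbf{x}}^N)=\sum_i\int_{G_0}\|x-x_{N,0}^i\|m_N^i(dx)$. Player $i$ starts at $x_{N,0}^i$ and chooses a random open-loop strategy $\varrho_N^i\in\mathcal{P}(\mathcal{U})$. For a profile $\varrho_N=(\varrho_N^1,\dots,\varrho_N^N)$, $\nu_N(\cdot,\varrho_N)\in\mathcal{M}$ is the unique external field $\nu$ with $\int\phi\,d\nu[t]=\frac1N\sum_{i=1}^N\int_{\mathcal{U}}\phi(x(t,0,x_{N,0}^i,\alpha,\nu))\varrho_N^i(d\alpha)$ for all $\phi\in C_b(\mathbb{R}^n)$, $t\in[0,T]$. The outcome of player $i$ is $\bar J_N^i(\varrho_N)=\int_{\mathcal{U}}[\sigma(x(T,0,x_{N,0}^i,\alpha,\nu),\nu[T])+w(T,0,x_{N,0}^i,\alpha,\nu)]\varrho_N^i(d\alpha)$ with $\nu=\nu_N(\cdot,\varrho_N)$.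 $\varrho_N|\varrho^j$ denotes the profile $\varrho_N$ with the $j$-th strategy replaced by $\varrho^j$. Define $\chi_N^i=\int_{G_0}\chi_{0,x_*}m_N^i(dx_* )$ and $\hat\varrho_N=(\hat\varrho_N^1,\dots,\hat\varrho_N^N)$ with $\hat\varrho_N^i=N\cdot\Theta\#\chi_N^i$. *)

theory Defs
  imports "HOL-Probability.Probability"
begin

section \<open>Borel measures on topologies and the Kantorovich distance\<close>

definition borel_of :: "'a topology \<Rightarrow> 'a measure" where
  "borel_of X = sigma (topspace X) {U. openin X U}"

definition prob_measures1 :: "'x::euclidean_space measure set" where
  "prob_measures1 = {m. prob_space m \<and> sets m = sets borel \<and> integrable m (\<lambda>x. norm x)}"

definition kantorovich :: "'x::euclidean_space measure \<Rightarrow> 'x measure \<Rightarrow> real" where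
  "kantorovich m m' =
     (SUP \<phi>\<in>{\<phi> :: 'x \<Rightarrow> real. 1-lipschitz_on UNIV \<phi>}. (\<integral>x. \<phi> x \<partial>m) - (\<integral>x. \<phi> x \<partial>m'))"

text \<open>The type of metrics demands nonnegativity and symmetry for all arguments, also outside the
  carrier; the truncation takes care of this and is invisible on the carrier.\<close>

definition kantorovich_metric :: "'x::euclidean_space measure metric" where
  "kantorovich_metric = metric (prob_measures1,
     \<lambda>m m'. if m \<in> prob_measures1 \<and> m' \<in> prob_measures1 then kantorovich m m' else 0)"

definition msupport :: "'x::topological_space measure \<Rightarrow> 'x set" where
  "msupport m = {x. \<forall>U. open U \<and> x \<in> U \<longrightarrow> emeasure m U > 0}"

definition prob_measures_on :: "'x::euclidean_space set \<Rightarrow> 'x measure set" where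
  "prob_measures_on G = {m \<in> prob_measures1. emeasure m G = 1}"

lemma lipschitz_integrable:
  fixes \<phi> :: "'x::euclidean_space \<Rightarrow> real"
  assumes m: "m \<in> prob_measures1" and \<phi>: "L-lipschitz_on UNIV \<phi>"
  shows "integrable m \<phi>"
proof -
  from m interpret prob_space m by (simp add: prob_measures1_def)
  have int: "integrable m (\<lambda>x. \<bar>\<phi> 0\<bar> + L * norm x)" and sets: "sets m = sets borel"
    using m by (auto simp: prob_measures1_def)
  have "continuous_on UNIV \<phi>"
    using \<phi> by (rule lipschitz_on_continuous_on)
  then have meas: "\<phi> \<in> borel_measurable m"
    using sets by (simp add: borel_measurable_continuous_onI cong: measurable_cong_sets)
  have "\<bar>\<phi> x\<bar> \<le> \<bar>\<phi> 0\<bar> + L * norm x" for x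
    using lipschitz_onD[OF \<phi>, of x 0] by (auto simp: dist_real_def)
  then have "AE x in m. norm (\<phi> x) \<le> norm (\<bar>\<phi> 0\<bar> + L * norm x)"
    by (intro AE_I2) (metis abs_ge_self order_trans real_norm_def)
  then show ?thesis
    by (rule Bochner_Integration.integrable_bound[OF int meas])
qed

lemma kantorovich_bdd:
  assumes "m \<in> prob_measures1" "m' \<in> prob_measures1"
  shows "bdd_above ((\<lambda>\<phi>. (\<integral>x. \<phi> x \<partial>m) - (\<integral>x. \<phi> x \<partial>m')) `
    {\<phi> :: 'x::euclidean_space \<Rightarrow> real. 1-lipschitz_on UNIV \<phi>})"
proof (rule bdd_aboveI2)
  fix \<phi> :: "'x \<Rightarrow> real" assume "\<phi> \<in> {\<phi>. 1-lipschitz_on UNIV \<phi>}"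
  then have \<phi>: "1-lipschitz_on UNIV \<phi>" by simp
  interpret m: prob_space m using assms by (simp add: prob_measures1_def)
  interpret m': prob_space m' using assms by (simp add: prob_measures1_def)
  have n: "integrable m (\<lambda>x. norm x)" "integrable m' (\<lambda>x. norm x)"
    using assms by (auto simp: prob_measures1_def)
  note i = lipschitz_integrable[OF assms(1) \<phi>] lipschitz_integrable[OF assms(2) \<phi>]
  have b: "\<phi> x \<le> \<phi> 0 + norm x" "\<phi> 0 - norm x \<le> \<phi> x" for x
    using lipschitz_onD[OF \<phi>, of x 0] by (auto simp: dist_real_def)
  have "(\<integral>x. \<phi> x \<partial>m) \<le> (\<integral>x. \<phi> 0 + norm x \<partial>m)"
    using n i b by (intro integral_mono) auto
  moreover have "(\<integral>x. \<phi> 0 - norm x \<partial>m') \<le> (\<integral>x. \<phi> x \<partial>m')"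
    using n i b by (intro integral_mono) auto
  ultimately show "(\<integral>x. \<phi> x \<partial>m) - (\<integral>x. \<phi> x \<partial>m') \<le> (\<integral>x. norm x \<partial>m) + (\<integral>x. norm x \<partial>m')"
    using n by (simp add: m.prob_space m'.prob_space)
qed

lemma kantorovich_upper:
  assumes "m \<in> prob_measures1" "m' \<in> prob_measures1" "1-lipschitz_on UNIV \<phi>"
  shows "(\<integral>x. \<phi> x \<partial>m) - (\<integral>x. \<phi> x \<partial>m') \<le> kantorovich m m'"
  unfolding kantorovich_def
  using assms(3) by (intro cSUP_upper kantorovich_bdd assms(1,2)) auto

lemma kantorovich_least:
  assumes "\<And>\<phi>. 1-lipschitz_on UNIV \<phi> \<Longrightarrow> (\<integral>x. \<phi> x \<partial>m) - (\<integral>x. \<phi> x \<partial>m') \<le> c"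
  shows "kantorovich m m' \<le> c"
proof -
  have "1-lipschitz_on UNIV (\<lambda>_::'a. 0 :: real)" by (intro lipschitz_onI) auto
  then show ?thesis
    unfolding kantorovich_def using assms by (intro cSUP_least) auto
qed

lemma kantorovich_le_commute:
  assumes "m \<in> prob_measures1" "m' \<in> prob_measures1"
  shows "kantorovich m m' \<le> kantorovich m' m"
proof (rule kantorovich_least)
  fix \<phi> :: "'a \<Rightarrow> real" assume "1-lipschitz_on UNIV \<phi>"
  then have "1-lipschitz_on UNIV (\<lambda>x. - \<phi> x)" by (simp add: lipschitz_on_def dist_minus)
  from kantorovich_upper[OF assms(2,1) this]
  show "(\<integral>x. \<phi> x \<partial>m) - (\<integral>x. \<phi> x \<partial>m') \<le> kantorovich m' m" by simp
qed

lemma kantorovich_eq_0_imp_eq: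
  assumes m: "m \<in> prob_measures1" "m' \<in> prob_measures1" and 0: "kantorovich m m' = 0"
  shows "m = (m' :: 'x::euclidean_space measure)"
proof -
  interpret m: prob_space m using m by (simp add: prob_measures1_def)
  interpret m': prob_space m' using m by (simp add: prob_measures1_def)
  have sets: "sets m = sets borel" "sets m' = sets borel"
    using m by (auto simp: prob_measures1_def)
  have "kantorovich m' m \<le> 0" using kantorovich_le_commute[OF m(2,1)] 0 by simp
  then have eq1: "(\<integral>x. \<phi> x \<partial>m) = (\<integral>x. \<phi> x \<partial>m')" if "1-lipschitz_on UNIV \<phi>" for \<phi> :: "'x \<Rightarrow> real"
    using kantorovich_upper[OF m that] kantorovich_upper[OF m(2,1) that] 0 by linarith
  have meq: "measure m C = measure m' C" if C: "closed C" for C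
  proof (cases "C = {}")
    case False
    define \<phi> where "\<phi> k x = max 0 (1 - real k * infdist x C)" for k x
    have lip: "1-lipschitz_on UNIV (\<lambda>x. \<phi> k x / real k)" if "k > 0" for k
    proof (rule lipschitz_onI)
      fix x y :: 'x
      have "\<bar>infdist x C - infdist y C\<bar> \<le> dist x y"
        using infdist_triangle[of x C y] infdist_triangle[of y C x] by (auto simp: dist_commute)
      then have "\<bar>real k * infdist x C - real k * infdist y C\<bar> \<le> real k * dist x y"
        by (simp add: abs_mult mult_left_mono flip: right_diff_distrib)
      then have "\<bar>\<phi> k x - \<phi> k y\<bar> \<le> real k * dist x y"
        unfolding \<phi>_def by linarith
      then show "dist (\<phi> k x / real k) (\<phi> k y / real k) \<le> 1 * dist x y"
        using that by (simp add: dist_real_def field_simps flip: diff_divide_distrib)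
    qed auto
    have eqk: "(\<integral>x. \<phi> k x \<partial>m) = (\<integral>x. \<phi> k x \<partial>m')" if "k > 0" for k
      using eq1[OF lip[OF that]] that by simp
    have lim: "(\<lambda>k. \<phi> k x) \<longlonglongrightarrow> indicator C x" for x
    proof (cases "x \<in> C")
      case True
      then show ?thesis using False C by (simp add: \<phi>_def)
    next
      case x: False
      then have pos: "infdist x C > 0"
        using False C in_closed_iff_infdist_zero[of C x] infdist_nonneg[of x C] by force
      obtain k0 :: nat where k0: "1 / infdist x C < real k0" using reals_Archimedean2 by blast
      have "\<phi> k x = 0" if "k \<ge> k0" for k
      proof -
        have "1 / infdist x C < real k" using k0 that by linarith
        then show ?thesis using pos by (simp add: \<phi>_def field_simps)
      qed
      then show ?thesis using x by (intro tendsto_eventually eventually_sequentiallyI[of k0]) simp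
    qed
    have cont: "continuous_on UNIV (\<phi> k)" for k
      unfolding \<phi>_def by (intro continuous_intros)
    have meas: "\<phi> k \<in> borel_measurable M" if "sets M = sets borel" for k and M :: "'x measure"
      using that cont[of k] by (simp add: borel_measurable_continuous_onI cong: measurable_cong_sets)
    have b: "\<bar>\<phi> k x\<bar> \<le> 1" for k x
      unfolding \<phi>_def by (simp add: infdist_nonneg)
    have conv: "(\<lambda>k. \<integral>x. \<phi> k x \<partial>M) \<longlonglongrightarrow> measure M C"
      if M: "prob_space M" "sets M = sets borel" for M :: "'x measure"
    proof -
      interpret M: prob_space M by fact
      have [measurable]: "C \<in> sets M" using C M(2) by auto
      have "(\<lambda>k. \<integral>x. \<phi> k x \<partial>M) \<longlonglongrightarrow> (\<integral>x. indicator C x \<partial>M)"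
        by (rule integral_dominated_convergence[where w = "\<lambda>_. 1"])
          (use meas[OF M(2)] lim in \<open>auto simp: b\<close>)
      moreover have "C \<inter> space M = C" using M(2) sets_eq_imp_space_eq[of M borel] by auto
      ultimately show ?thesis by simp
    qed
    have "\<forall>\<^sub>F k in sequentially. (\<integral>x. \<phi> k x \<partial>m) = (\<integral>x. \<phi> k x \<partial>m')"
      using eqk by (intro eventually_sequentiallyI[of 1]) auto
    from tendsto_cong[OF this] conv[OF m.prob_space_axioms sets(1)]
    have "(\<lambda>k. \<integral>x. \<phi> k x \<partial>m') \<longlonglongrightarrow> measure m C" by simp
    with conv[OF m'.prob_space_axioms sets(2)] show ?thesis
      using LIMSEQ_unique by blast
  qed simp
  show ?thesis
  proof (rule measure_eqI_generator_eq[where E = "{C. closed C}" and \<Omega> = UNIV and A = "\<lambda>_. UNIV"])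
    show "Int_stable {C :: 'x set. closed C}" by (auto simp: Int_stable_def)
    show "sets m = sigma_sets UNIV {C. closed C}" "sets m' = sigma_sets UNIV {C. closed C}"
      using sets by (simp_all add: borel_eq_closed)
    show "emeasure m C = emeasure m' C" if "C \<in> {C. closed C}" for C
      using meq[of C] that by (simp add: m.emeasure_eq_measure m'.emeasure_eq_measure)
  qed (auto simp: m.emeasure_eq_measure)
qed

lemma Metric_space_kantorovich:
  "Metric_space (prob_measures1 :: 'x::euclidean_space measure set)
     (\<lambda>m m'. if m \<in> prob_measures1 \<and> m' \<in> prob_measures1 then kantorovich m m' else 0)"
  (is "Metric_space ?M ?d")
proof
  show "0 \<le> ?d m m'" for m m'
    using kantorovich_upper[of m m' "\<lambda>_. 0"] by (auto simp: lipschitz_on_def)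
  show "?d m m' = ?d m' m" for m m'
    by (auto intro: antisym kantorovich_le_commute)
  have "kantorovich m m = 0" if "m \<in> ?M" for m :: "'x measure"
    using kantorovich_upper[OF that that, of "\<lambda>_. 0"] kantorovich_least[of m m 0]
    by (auto simp: lipschitz_on_def)
  then show "?d m m' = 0 \<longleftrightarrow> m = m'" if "m \<in> ?M" "m' \<in> ?M" for m m'
    using that kantorovich_eq_0_imp_eq[OF that] by auto
  show "?d m m'' \<le> ?d m m' + ?d m' m''" if M: "m \<in> ?M" "m' \<in> ?M" "m'' \<in> ?M" for m m' m''
  proof -
    have "kantorovich m m'' \<le> kantorovich m m' + kantorovich m' m''"
    proof (rule kantorovich_least)
      fix \<phi> :: "'x \<Rightarrow> real" assume \<phi>: "1-lipschitz_on UNIV \<phi>"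
      show "(\<integral>x. \<phi> x \<partial>m) - (\<integral>x. \<phi> x \<partial>m'') \<le> kantorovich m m' + kantorovich m' m''"
        using kantorovich_upper[OF M(1,2) \<phi>] kantorovich_upper[OF M(2,3) \<phi>] by linarith
    qed
    then show ?thesis using M by simp
  qed
qed

lemma mspace_kantorovich_metric [simp]: "mspace kantorovich_metric = prob_measures1"
  unfolding kantorovich_metric_def by (rule Metric_space.mspace_metric[OF Metric_space_kantorovich])

lemma mdist_kantorovich_metric:
  "m \<in> prob_measures1 \<Longrightarrow> m' \<in> prob_measures1 \<Longrightarrow> mdist kantorovich_metric m m' = kantorovich m m'"
  unfolding kantorovich_metric_def
  by (simp add: Metric_space.mdist_metric[OF Metric_space_kantorovich])


section \<open>Data of the game\<close>

record ('x, 'p) mfg =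
  horizon :: real                                                  (* T *)
  controls :: "'p set"                                             (* P *)
  dynam :: "real \<Rightarrow> 'x \<Rightarrow> 'x measure \<Rightarrow> 'p \<Rightarrow> 'x"        (* f *)
  running :: "real \<Rightarrow> 'x \<Rightarrow> 'x measure \<Rightarrow> 'p \<Rightarrow> real"    (* g *)
  terminal :: "'x \<Rightarrow> 'x measure \<Rightarrow> real"                        (* \<sigma> *)
  initial :: "'x measure"                                          (* m0 *)

abbreviation time :: "('x, 'p) mfg \<Rightarrow> real set" where
  "time D \<equiv> {0..horizon D}"

abbreviation initial_set :: "('x::euclidean_space, 'p) mfg \<Rightarrow> 'x set" where  (* G0 *)
  "initial_set D \<equiv> msupport (initial D)"

text \<open>Flows are extensional, i.e. equal to undefined outside of the time interval, so that they are determined by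
  their values on it.\<close>

definition flows :: "('x::euclidean_space, 'p) mfg \<Rightarrow> (real \<Rightarrow> 'x measure) set" where
  "flows D = {\<mu> \<in> extensional (time D).
     continuous_map (top_of_set (time D)) (mtopology_of kantorovich_metric) \<mu>}"

definition abs_cont_on :: "real \<Rightarrow> real \<Rightarrow> (real \<Rightarrow> 'a::metric_space) \<Rightarrow> bool" where
  "abs_cont_on a b x \<longleftrightarrow> (\<forall>\<epsilon>>0. \<exists>\<delta>>0. \<forall>(n::nat) s t.
     (\<forall>i<n. a \<le> s i \<and> s i \<le> t i \<and> t i \<le> b) \<and>
     (\<forall>i<n. \<forall>k<n. i \<noteq> k \<longrightarrow> {s i<..<t i} \<inter> {s k<..<t k} = {}) \<and>
     (\<Sum>i<n. t i - s i) < \<delta> \<longrightarrow> (\<Sum>i<n. dist (x (s i)) (x (t i))) < \<epsilon>)"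

definition controlled_solution ::
  "('x::euclidean_space, 'p) mfg \<Rightarrow> (real \<Rightarrow> 'x measure) \<Rightarrow> (real \<Rightarrow> 'p) \<Rightarrow> (real \<Rightarrow> 'x) \<Rightarrow> bool" where
  "controlled_solution D \<mu> u x \<longleftrightarrow> abs_cont_on 0 (horizon D) x \<and>
     (AE t in lebesgue_on (time D).
        (x has_vector_derivative dynam D t (x t) (\<mu> t) (u t)) (at t within time D))"

definition mfg_setting :: "('x::euclidean_space, 'p::metric_space) mfg \<Rightarrow> 'x set \<Rightarrow> bool" where
  "mfg_setting D G \<longleftrightarrow>
     horizon D > 0 \<and>
     compact (controls D) \<and> controls D \<noteq> {} \<and>
     continuous_map
       (prod_topology (top_of_set (time D)) (prod_topology euclidean
         (prod_topology (mtopology_of kantorovich_metric) (top_of_set (controls D)))))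
       euclidean (\<lambda>(t, x, m, u). dynam D t x m u) \<and>
     continuous_map
       (prod_topology (top_of_set (time D)) (prod_topology euclidean
         (prod_topology (mtopology_of kantorovich_metric) (top_of_set (controls D)))))
       euclidean (\<lambda>(t, x, m, u). running D t x m u) \<and>
     continuous_map (prod_topology euclidean (mtopology_of kantorovich_metric))
       euclidean (\<lambda>(x, m). terminal D x m) \<and>
     (\<exists>L. \<forall>t\<in>time D. \<forall>x' x''. \<forall>m\<in>prob_measures1. \<forall>u\<in>controls D.
        norm (dynam D t x' m u - dynam D t x'' m u) \<le> L * norm (x' - x'')) \<and>
     (\<exists>L. \<forall>t\<in>time D. \<forall>x. \<forall>m'\<in>prob_measures1. \<forall>m''\<in>prob_measures1. \<forall>u\<in>controls D.
        norm (dynam D t x m' u - dynam D t x m'' u) \<le> L * kantorovich m' m'') \<and>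
     initial D \<in> prob_measures1 \<and> compact (initial_set D) \<and>
     compact G \<and>
     (\<forall>\<mu>\<in>flows D. \<forall>u \<in> lebesgue_on (time D) \<rightarrow>\<^sub>M restrict_space borel (controls D). \<forall>x.
        controlled_solution D \<mu> u x \<and> x 0 \<in> initial_set D \<longrightarrow> (\<forall>t\<in>time D. x t \<in> G)) \<and>
     (\<exists>Lx Lm. \<forall>x'\<in>G. \<forall>x''\<in>G. \<forall>m'\<in>prob_measures_on G. \<forall>m''\<in>prob_measures_on G.
        \<bar>terminal D x' m' - terminal D x'' m''\<bar> \<le> Lx * norm (x' - x'') + Lm * kantorovich m' m'') \<and>
     (\<exists>Lx Lm. \<forall>t\<in>time D. \<forall>x'\<in>G. \<forall>x''\<in>G.
        \<forall>m'\<in>prob_measures_on G. \<forall>m''\<in>prob_measures_on G. \<forall>u\<in>controls D.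
        \<bar>running D t x' m' u - running D t x'' m'' u\<bar>
          \<le> Lx * norm (x' - x'') + Lm * kantorovich m' m'')"


section \<open>Control measures, trajectories and payoffs\<close>

definition control_measures :: "('x, 'p::metric_space) mfg \<Rightarrow> (real \<times> 'p) measure set" where
  "control_measures D = {\<alpha>. sets \<alpha> = sets (restrict_space borel (time D \<times> controls D)) \<and>
     distr \<alpha> (restrict_space borel (time D)) fst = restrict_space lborel (time D)}"

definition control_topology :: "('x, 'p::metric_space) mfg \<Rightarrow> (real \<times> 'p) measure topology" where
  "control_topology D = topology_generated_by
     {{\<alpha> \<in> control_measures D. (\<integral>z. \<phi> z \<partial>\<alpha>) \<in> A} | (\<phi> :: real \<times> 'p \<Rightarrow> real) A.
        continuous_on (time D \<times> controls D) \<phi> \<and> open A}"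

abbreviation strategies :: "('x, 'p::metric_space) mfg \<Rightarrow> (real \<times> 'p) measure measure set" where
  "strategies D \<equiv> space (prob_algebra (borel_of (control_topology D)))"  (* \<P>(\<U>) *)

definition traj :: "('x::euclidean_space, 'p::metric_space) mfg \<Rightarrow> (real \<Rightarrow> 'x measure) \<Rightarrow>
    real \<Rightarrow> 'x \<Rightarrow> (real \<times> 'p) measure \<Rightarrow> real \<Rightarrow> 'x" where
  "traj D \<mu> t0 x0 \<alpha> = (THE x. x \<in> extensional {t0..horizon D} \<and> continuous_on {t0..horizon D} x \<and>
     (\<forall>t\<in>{t0..horizon D}.
        x t = x0 + (LINT (\<tau>, u) : {t0..t} \<times> controls D | \<alpha>. dynam D \<tau> (x \<tau>) (\<mu> \<tau>) u)))"

definition cost :: "('x::euclidean_space, 'p::metric_space) mfg \<Rightarrow> (real \<Rightarrow> 'x measure) \<Rightarrow>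
    real \<Rightarrow> 'x \<Rightarrow> (real \<times> 'p) measure \<Rightarrow> real \<Rightarrow> real" where  (* w *)
  "cost D \<mu> t0 x0 \<alpha> t =
     - (LINT (\<tau>, u) : {t0..t} \<times> controls D | \<alpha>. running D \<tau> (traj D \<mu> t0 x0 \<alpha> \<tau>) (\<mu> \<tau>) u)"

definition payoff :: "('x::euclidean_space, 'p::metric_space) mfg \<Rightarrow> (real \<Rightarrow> 'x measure) \<Rightarrow>
    real \<Rightarrow> 'x \<Rightarrow> (real \<times> 'p) measure \<Rightarrow> real" where
  "payoff D \<mu> t0 x0 \<alpha> =
     terminal D (traj D \<mu> t0 x0 \<alpha> (horizon D)) (\<mu> (horizon D)) + cost D \<mu> t0 x0 \<alpha> (horizon D)"

definition val :: "('x::euclidean_space, 'p::metric_space) mfg \<Rightarrow> (real \<Rightarrow> 'x measure) \<Rightarrow>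
    real \<Rightarrow> 'x \<Rightarrow> real" where  (* V *)
  "val D \<mu> t0 x0 = (GREATEST v. \<exists>\<alpha>\<in>control_measures D. v = payoff D \<mu> t0 x0 \<alpha>)"


section \<open>Nash equilibria of the infinite-player game\<close>

definition players :: "('x::euclidean_space, 'p) mfg \<Rightarrow> ('x \<times> real) measure" where  (* \<eta> *)
  "players D = restrict_space (initial D \<Otimes>\<^sub>M lborel) (initial_set D \<times> {0..1})"

definition control_distributions ::
  "('x::euclidean_space, 'p::metric_space) mfg \<Rightarrow> (('x \<times> real) \<times> (real \<times> 'p) measure) measure set" where
  "control_distributions D = {\<gamma>. prob_space \<gamma> \<and>
     sets \<gamma> = sets (borel_of (prod_topology (top_of_set (initial_set D \<times> {0..1})) (control_topology D))) \<and>
     distr \<gamma> (restrict_space borel (initial_set D \<times> {0..1})) fst = players D}"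

definition corresponding_flow :: "('x::euclidean_space, 'p::metric_space) mfg \<Rightarrow>
    (('x \<times> real) \<times> (real \<times> 'p) measure) measure \<Rightarrow> (real \<Rightarrow> 'x measure) \<Rightarrow> bool" where
  "corresponding_flow D \<gamma> \<mu> \<longleftrightarrow> \<mu> \<in> flows D \<and>
     (\<forall>t\<in>time D. \<mu> t = distr \<gamma> borel (\<lambda>(\<omega>, \<alpha>). traj D \<mu> 0 (fst \<omega>) \<alpha> t))"

definition player_disintegration :: "('x::euclidean_space, 'p::metric_space) mfg \<Rightarrow>
    (('x \<times> real) \<times> (real \<times> 'p) measure) measure \<Rightarrow> ('x \<times> real \<Rightarrow> (real \<times> 'p) measure measure) \<Rightarrow> bool" where
  "player_disintegration D \<gamma> \<kappa> \<longleftrightarrow>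
     \<kappa> \<in> players D \<rightarrow>\<^sub>M prob_algebra (borel_of (control_topology D)) \<and>
     (\<forall>A\<in>sets \<gamma>. emeasure \<gamma> A = (\<integral>\<^sup>+\<omega>. emeasure (\<kappa> \<omega>) (Pair \<omega> -` A) \<partial>players D))"

text \<open>The equilibrium condition does not depend on the version of the disintegration, which is
  unique up to null sets.\<close>

definition nash_equilibrium :: "('x::euclidean_space, 'p::metric_space) mfg \<Rightarrow>
    (('x \<times> real) \<times> (real \<times> 'p) measure) measure \<Rightarrow> (real \<Rightarrow> 'x measure) \<Rightarrow> bool" where
  "nash_equilibrium D \<gamma> \<mu> \<longleftrightarrow>
     \<gamma> \<in> control_distributions D \<and> corresponding_flow D \<gamma> \<mu> \<and>
     (\<exists>\<kappa>. player_disintegration D \<gamma> \<kappa> \<and>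
       (AE \<omega> in players D. \<forall>\<rho>\<in>strategies D.
          (\<integral>\<alpha>. payoff D \<mu> 0 (fst \<omega>) \<alpha> \<partial>\<rho>) \<le> (\<integral>\<alpha>. payoff D \<mu> 0 (fst \<omega>) \<alpha> \<partial>\<kappa> \<omega>)))"


section \<open>Distribution on extended trajectories\<close>

definition path_topology :: "('x::euclidean_space, 'p) mfg \<Rightarrow> (real \<Rightarrow> 'x \<times> real) topology" where
  "path_topology D = mtopology_of (cfunspace (top_of_set (time D)) euclidean_metric)"

definition velocities :: "('x::euclidean_space, 'p) mfg \<Rightarrow> real \<Rightarrow> 'x \<Rightarrow> 'x measure \<Rightarrow> ('x \<times> real) set" where
  "velocities D t x m = convex hull ((\<lambda>u. (dynam D t x m u, running D t x m u)) ` controls D)"  (* E^- *)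

definition ext_trajs :: "('x::euclidean_space, 'p) mfg \<Rightarrow> (real \<Rightarrow> 'x \<Rightarrow> real) \<Rightarrow>
    (real \<Rightarrow> 'x measure) \<Rightarrow> (real \<Rightarrow> 'x \<times> real) set" where  (* \<S>[V,\<mu>] *)
  "ext_trajs D V \<mu> = {p \<in> extensional (time D). abs_cont_on 0 (horizon D) p \<and>
     (AE t in lebesgue_on (time D). \<exists>d \<in> velocities D t (fst (p t)) (\<mu> t).
        (p has_vector_derivative d) (at t within time D)) \<and>
     (\<forall>t\<in>time D. snd (p t) = V t (fst (p t)))}"

definition ext_trajs_from :: "('x::euclidean_space, 'p) mfg \<Rightarrow> (real \<Rightarrow> 'x \<Rightarrow> real) \<Rightarrow>
    'x \<Rightarrow> (real \<Rightarrow> 'x measure) \<Rightarrow> (real \<Rightarrow> 'x \<times> real) set" where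
  "ext_trajs_from D V x0 \<mu> = {p \<in> ext_trajs D V \<mu>. fst (p 0) = x0}"

abbreviation borel_ext_trajs :: "('x::euclidean_space, 'p) mfg \<Rightarrow> (real \<Rightarrow> 'x \<Rightarrow> real) \<Rightarrow>
    (real \<Rightarrow> 'x measure) \<Rightarrow> (real \<Rightarrow> 'x \<times> real) measure" where
  "borel_ext_trajs D V \<mu> \<equiv> borel_of (subtopology (path_topology D) (ext_trajs D V \<mu>))"

definition path_distribution :: "('x::euclidean_space, 'p::metric_space) mfg \<Rightarrow>
    (('x \<times> real) \<times> (real \<times> 'p) measure) measure \<Rightarrow> (real \<Rightarrow> 'x measure) \<Rightarrow> (real \<Rightarrow> 'x \<times> real) measure" where  (* \<chi> *)
  "path_distribution D \<gamma> \<mu> = distr \<gamma> (borel_of (path_topology D))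
     (\<lambda>(\<omega>, \<alpha>). \<lambda>t\<in>time D. (traj D \<mu> 0 (fst \<omega>) \<alpha> t, val D \<mu> t (traj D \<mu> 0 (fst \<omega>) \<alpha> t)))"

text \<open>\<^term>\<open>path_distribution D \<gamma> \<mu>\<close> lives on all continuous paths and the kernel on the extended
  trajectories, hence the intersection; the identity contains that the former is concentrated on
  the latter.\<close>

definition path_disintegration :: "('x::euclidean_space, 'p::metric_space) mfg \<Rightarrow>
    (('x \<times> real) \<times> (real \<times> 'p) measure) measure \<Rightarrow> (real \<Rightarrow> 'x measure) \<Rightarrow>
    ('x \<Rightarrow> (real \<Rightarrow> 'x \<times> real) measure) \<Rightarrow> bool" where
  "path_disintegration D \<gamma> \<mu> \<kappa> \<longleftrightarrow>
     \<kappa> \<in> restrict_space borel (initial_set D) \<rightarrow>\<^sub>M prob_algebra (borel_ext_trajs D (val D \<mu>) \<mu>) \<and>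
     (\<forall>x\<in>initial_set D. emeasure (\<kappa> x) (ext_trajs_from D (val D \<mu>) x \<mu>) = 1) \<and>
     (\<forall>A\<in>sets (borel_of (path_topology D)). emeasure (path_distribution D \<gamma> \<mu>) A =
        (\<integral>\<^sup>+x\<in>initial_set D. emeasure (\<kappa> x) (A \<inter> ext_trajs D (val D \<mu>) \<mu>) \<partial>initial D))"

definition control_selector :: "('x::euclidean_space, 'p::metric_space) mfg \<Rightarrow> (real \<Rightarrow> 'x measure) \<Rightarrow>
    ((real \<Rightarrow> 'x \<times> real) \<Rightarrow> (real \<times> 'p) measure) \<Rightarrow> bool" where
  "control_selector D \<mu> \<Theta> \<longleftrightarrow>
     \<Theta> \<in> borel_ext_trajs D (val D \<mu>) \<mu> \<rightarrow>\<^sub>M borel_of (control_topology D) \<and>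
     (\<forall>p\<in>ext_trajs D (val D \<mu>) \<mu>. \<forall>t\<in>time D.
        fst (p t) = traj D \<mu> 0 (fst (p 0)) (\<Theta> p) t \<and>
        snd (p t) = val D \<mu> 0 (fst (p 0)) - cost D \<mu> 0 (fst (p 0)) (\<Theta> p) t)"


section \<open>The game with N players\<close>

text \<open>Players are numbered from 1 to N.\<close>

definition empirical :: "nat \<Rightarrow> (nat \<Rightarrow> 'x::euclidean_space) \<Rightarrow> 'x measure" where
  "empirical N x = distr (uniform_count_measure {1..N}) borel x"

definition optimal_splitting :: "('x::euclidean_space, 'p) mfg \<Rightarrow> nat \<Rightarrow> (nat \<Rightarrow> 'x) \<Rightarrow> (nat \<Rightarrow> 'x measure) \<Rightarrow> bool" where
  "optimal_splitting D N x m \<longleftrightarrow>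
     (\<forall>i\<in>{1..N}. sets (m i) = sets borel \<and> emeasure (m i) (initial_set D) = ennreal (1 / N)) \<and>
     (\<forall>A\<in>sets borel. emeasure (initial D) A = (\<Sum>i=1..N. emeasure (m i) A)) \<and>
     kantorovich (initial D) (empirical N x) = (\<Sum>i=1..N. LINT y:initial_set D|m i. norm (y - x i))"

definition external_field :: "('x::euclidean_space, 'p::metric_space) mfg \<Rightarrow> nat \<Rightarrow> (nat \<Rightarrow> 'x) \<Rightarrow>
    (nat \<Rightarrow> (real \<times> 'p) measure measure) \<Rightarrow> real \<Rightarrow> 'x measure" where  (* \<nu>_N *)
  "external_field D N x \<rho> = (THE \<nu>. \<nu> \<in> flows D \<and>
     (\<forall>t\<in>time D. \<forall>\<phi> :: 'x \<Rightarrow> real. continuous_on UNIV \<phi> \<and> bounded (range \<phi>) \<longrightarrow>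
        (\<integral>y. \<phi> y \<partial>\<nu> t) = 1 / N * (\<Sum>i=1..N. \<integral>\<alpha>. \<phi> (traj D \<nu> 0 (x i) \<alpha> t) \<partial>\<rho> i)))"

definition outcome :: "('x::euclidean_space, 'p::metric_space) mfg \<Rightarrow> nat \<Rightarrow> (nat \<Rightarrow> 'x) \<Rightarrow>
    nat \<Rightarrow> (nat \<Rightarrow> (real \<times> 'p) measure measure) \<Rightarrow> real" where
  "outcome D N x i \<rho> = (\<integral>\<alpha>. payoff D (external_field D N x \<rho>) 0 (x i) \<alpha> \<partial>\<rho> i)"

definition eps_nash :: "('x::euclidean_space, 'p::metric_space) mfg \<Rightarrow> nat \<Rightarrow> (nat \<Rightarrow> 'x) \<Rightarrow>
    real \<Rightarrow> (nat \<Rightarrow> (real \<times> 'p) measure measure) \<Rightarrow> bool" where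
  "eps_nash D N x \<epsilon> \<rho> \<longleftrightarrow>
     (\<forall>j\<in>{1..N}. \<forall>\<rho>'\<in>strategies D. outcome D N x j \<rho> \<ge> outcome D N x j (\<rho>(j := \<rho>')) - \<epsilon>)"

text \<open>The Giry-monadic \<^const>\<open>bind\<close> is the mixture of the measures \<open>\<chi>\<^sub>0 y\<close> with respect to \<open>m i\<close>,
  a measure of mass \<open>1 / N\<close>.\<close>

definition induced_profile :: "('x::euclidean_space, 'p::metric_space) mfg \<Rightarrow>
    ('x \<Rightarrow> (real \<Rightarrow> 'x \<times> real) measure) \<Rightarrow> ((real \<Rightarrow> 'x \<times> real) \<Rightarrow> (real \<times> 'p) measure) \<Rightarrow>
    nat \<Rightarrow> (nat \<Rightarrow> 'x measure) \<Rightarrow> nat \<Rightarrow> (real \<times> 'p) measure measure" where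
  "induced_profile D \<chi>\<^sub>0 \<Theta> N m i = scale_measure (of_nat N)
     (distr (bind (restrict_space (m i) (initial_set D)) \<chi>\<^sub>0) (borel_of (control_topology D)) \<Theta>)"

end

theory Submission
  imports Defs
begin

text \<open>The induced profile is compared with the mean field. Let \<open>\<mu>\<close> be the equilibrium flow and \<open>\<nu>\<close>
  the external field of the induced profile, in which player \<open>j\<close> may have switched to another
  strategy. Flows and trajectories are measured with the weight \<open>exp (4 * L * t)\<close>. If two flows are at
  distance at most \<open>c\<close> in this weight, then the trajectories from \<open>y\<close> and \<open>y'\<close> under one control
  measure are at distance at most \<open>2 * norm (y - y') + c / 2\<close> (\<open>traj_stability\<close>). The weight turns
  Gronwall's argument into the gain of a factor 1/2 (\<open>halving_bound\<close>); the same gain makes Picard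
  iteration contract, for single trajectories and for the coupled dynamics of the players
  (\<open>mean_field_solution_exists\<close>).

  The distribution of the equilibrium on paths is cut along the optimal splitting of \<open>m\<^sub>0\<close>: \<open>\<mu> t\<close> is
  the sum over the players \<open>i\<close> of the laws of \<open>fst (p t)\<close> under measures \<open>\<pi> i\<close> on paths \<open>p\<close>, each of
  mass \<open>1 / N\<close> (\<open>\<mu>_as_sum\<close>), and the strategy of player \<open>i\<close> is \<open>N\<close> times the image of \<open>\<pi> i\<close> under
  \<open>\<Theta>\<close>. So every path \<open>p\<close> of the mean field is coupled with the trajectory of player \<open>i\<close> under the
  same control measure \<open>\<Theta> p\<close>; the two differ in the initial point, \<open>fst (p 0)\<close> against \<open>x i\<close>, and in the
  flow, \<open>\<mu>\<close> against \<open>\<nu>\<close>. With \<open>traj_stability\<close>, a bound \<open>c\<close> on the distance of \<open>\<nu>\<close> and \<open>\<mu>\<close> improves to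
  \<open>2 * W + 4 * B / N + c / 2\<close>, where \<open>W\<close> is the distance of \<open>m\<^sub>0\<close> from the empirical measure and the term
  with \<open>N\<close> is due to the deviating player (\<open>field_contraction\<close>). Hence the distance is at most twice
  \<open>2 * W + 4 * B / N\<close> (\<open>field_estimate\<close>).

  For almost every \<open>y\<close> the equilibrium condition, tested with Dirac measures, says that the maximum
  \<open>V (0, y)\<close> is attained (\<open>value_attained_AE\<close>). Since \<open>V (T, x)\<close> is the terminal payoff and \<open>p\<close> runs on the
  graph of \<open>V\<close>, the control measure \<open>\<Theta> p\<close> attains it (\<open>selected_control_payoff\<close>). Payoffs are Lipschitz
  in the initial point and the flow (\<open>payoff_stability\<close>); so no strategy of player \<open>j\<close> in the perturbed
  field beats \<open>\<Theta> p\<close> by more than a multiple of \<open>norm (fst (p 0) - x j)\<close> and of the distance of the fields.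
  The average over \<open>\<pi> j\<close> is the claim (\<open>deviation_bound\<close>).

  The payoffs are Lipschitz on \<open>G\<close> only, and \<open>G\<close> is known to contain the trajectories of ordinary controls.
  A control measure is the limit of fast switching step controls, so its trajectories stay in the closed
  set \<open>G\<close> as well (\<open>traj_in_G\<close>).\<close>

section \<open>Weighted Gronwall and Picard arguments\<close>

text \<open>Iterating \<open>c \<mapsto> a + c / 2\<close> leads to \<open>2 * a\<close>. This replaces Gronwall's inequality: with an exponential
  weight \<open>w\<close>, an integral inequality for \<open>h\<close> becomes such a step. As it is pointwise in \<open>h\<close>, it
  applies to the Kantorovich distance of two flows as to the distance of two curves.\<close>

lemma halving_bound:
  fixes h w :: "'k \<Rightarrow> real"
  assumes start: "\<And>k. k \<in> K \<Longrightarrow> h k \<le> c0 * w k"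
    and w: "\<And>k. k \<in> K \<Longrightarrow> 0 \<le> w k" and a: "0 \<le> a"
    and step: "\<And>c k. 0 \<le> c \<Longrightarrow> (\<And>k. k \<in> K \<Longrightarrow> h k \<le> c * w k) \<Longrightarrow> k \<in> K \<Longrightarrow> h k \<le> (a + c / 2) * w k"
    and k: "k \<in> K"
  shows "h k \<le> 2 * a * w k"
proof -
  define b where "b = max 0 c0"
  have "\<forall>k\<in>K. h k \<le> (2 * a + b / 2 ^ n) * w k" for n
  proof (induction n)
    case 0
    show ?case
    proof
      fix k assume k: "k \<in> K"
      have "c0 * w k \<le> (2 * a + b) * w k"
        using w[OF k] a by (intro mult_right_mono) (auto simp: b_def)
      then show "h k \<le> (2 * a + b / 2 ^ 0) * w k" using start[OF k] by simp
    qed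
  next
    case (Suc n)
    have "0 \<le> 2 * a + b / 2 ^ n" using a by (simp add: b_def)
    from step[OF this] Suc have "h k \<le> (a + (2 * a + b / 2 ^ n) / 2) * w k" if "k \<in> K" for k
      using that by blast
    then show ?case by (simp add: field_simps)
  qed
  then have le: "h k \<le> (2 * a + b / 2 ^ n) * w k" for n using k by blast
  have "(\<lambda>n. b / 2 ^ n) \<longlonglongrightarrow> 0" by (rule LIMSEQ_divide_realpow_zero) simp
  then have "(\<lambda>n. (2 * a + b / 2 ^ n) * w k) \<longlonglongrightarrow> (2 * a + 0) * w k" by (intro tendsto_intros)
  then have "h k \<le> (2 * a + 0) * w k"
    by (rule LIMSEQ_le_const) (use le in blast)
  then show ?thesis by simp
qed

text \<open>Picard iteration in a weighted supremum norm. The index set is time for a single trajectory, and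
  players together with time for trajectories coupled through their law; side conditions like
  continuity and measurability go into \<open>S\<close>.\<close>

lemma weighted_contraction_fixed_point:
  fixes \<Psi> :: "('k \<Rightarrow> 'x::banach) \<Rightarrow> 'k \<Rightarrow> 'x"
  assumes h0: "h0 \<in> S" and maps: "\<And>h. h \<in> S \<Longrightarrow> \<Psi> h \<in> S"
    and closed: "\<And>H h. (\<And>n. H n \<in> S) \<Longrightarrow> uniform_limit K H h sequentially \<Longrightarrow> h \<in> S"
    and w: "\<And>k. k \<in> K \<Longrightarrow> 1 \<le> w k" "\<And>k. k \<in> K \<Longrightarrow> w k \<le> (B :: real)"
    and contr: "\<And>h h' c k. h \<in> S \<Longrightarrow> h' \<in> S \<Longrightarrow> 0 \<le> c \<Longrightarrow> (\<And>k. k \<in> K \<Longrightarrow> norm (h k - h' k) \<le> c * w k)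
      \<Longrightarrow> k \<in> K \<Longrightarrow> norm (\<Psi> h k - \<Psi> h' k) \<le> c / 2 * w k"
    and start: "\<And>k. k \<in> K \<Longrightarrow> norm (\<Psi> h0 k - h0 k) \<le> c0 * w k"
  obtains h where "h \<in> S" "\<And>k. k \<in> K \<Longrightarrow> \<Psi> h k = h k"
proof -
  define H where "H n = (\<Psi> ^^ n) h0" for n
  have HS: "H n \<in> S" for n by (induction n) (auto simp: H_def h0 maps)
  have H_Suc: "H (Suc n) = \<Psi> (H n)" for n by (simp add: H_def)
  define b where "b = max 0 c0"
  have diff: "norm (H (Suc n) k - H n k) \<le> b / 2 ^ n * w k" if "k \<in> K" for n k
    using that
  proof (induction n arbitrary: k)
    case 0
    have "c0 * w k \<le> b * w k"
      using w(1)[OF 0] by (intro mult_right_mono) (auto simp: b_def)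
    with start[OF 0] show ?case by (simp add: H_def)
  next
    case (Suc n)
    have "norm (\<Psi> (H (Suc n)) k - \<Psi> (H n) k) \<le> b / 2 ^ n / 2 * w k"
      by (rule contr) (use Suc HS in \<open>auto simp: b_def\<close>)
    then show ?case by (simp add: H_Suc field_simps)
  qed
  have H_sum: "H n k = h0 k + (\<Sum>i<n. H (Suc i) k - H i k)" for n k
    by (induction n) (auto simp: H_def)
  define d where "d k = (\<Sum>i. H (Suc i) k - H i k)" for k
  have "uniform_limit K (\<lambda>n k. \<Sum>i<n. H (Suc i) k - H i k) d sequentially"
    unfolding d_def
  proof (rule Weierstrass_m_test)
    show "norm (H (Suc n) k - H n k) \<le> b * max 1 B * (1 / 2) ^ n" if "k \<in> K" for n k
    proof -
      have "b / 2 ^ n * w k \<le> b / 2 ^ n * max 1 B"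
        using w(2)[OF that] by (intro mult_left_mono) (auto simp: b_def)
      then show ?thesis using diff[OF that, of n] by (simp add: power_divide field_simps)
    qed
    show "summable (\<lambda>n. b * max 1 B * (1 / 2) ^ n)" by (intro summable_mult summable_geometric) simp
  qed
  then have "uniform_limit K (\<lambda>n k. h0 k + (\<Sum>i<n. H (Suc i) k - H i k)) (\<lambda>k. h0 k + d k) sequentially"
    by (intro uniform_limit_intros)
  then have lim: "uniform_limit K H (\<lambda>k. h0 k + d k) sequentially"
    by (simp add: H_sum[symmetric])
  define h where "h k = h0 k + d k" for k
  have lim: "uniform_limit K H h sequentially" using lim unfolding h_def .
  have hS: "h \<in> S" by (rule closed[OF HS lim])
  moreover have "\<Psi> h k = h k" if k: "k \<in> K" for k
  proof -
    have "(\<lambda>n. H n k) \<longlonglongrightarrow> h k" by (rule tendsto_uniform_limitI[OF lim k])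
    then have 1: "(\<lambda>n. H (Suc n) k) \<longlonglongrightarrow> h k" by (rule LIMSEQ_Suc)
    have 2: "(\<lambda>n. H (Suc n) k) \<longlonglongrightarrow> \<Psi> h k"
      unfolding tendsto_iff
    proof (intro allI impI)
      fix e :: real assume e: "e > 0"
      define e' where "e' = e / (max 1 B)"
      have e': "e' > 0" using e by (simp add: e'_def)
      from uniform_limitD[OF lim e']
      show "\<forall>\<^sub>F n in sequentially. dist (H (Suc n) k) (\<Psi> h k) < e"
      proof (rule eventually_mono)
        fix n assume n: "\<forall>x\<in>K. dist (H n x) (h x) < e'"
        have "norm (\<Psi> (H n) k - \<Psi> h k) \<le> e' / 2 * w k"
        proof (rule contr[OF HS hS _ _ k])
          show "norm (H n k - h k) \<le> e' * w k" if "k \<in> K" for k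
          proof -
            have "norm (H n k - h k) \<le> e' * 1" using n that by (auto simp: dist_norm less_imp_le)
            also have "\<dots> \<le> e' * w k" using w(1)[OF that] e' by (intro mult_left_mono) auto
            finally show ?thesis .
          qed
        qed (use e' in auto)
        also have "\<dots> \<le> e' / 2 * max 1 B" using w(2)[OF k] e' by (intro mult_left_mono) auto
        also have "\<dots> = e / 2" by (simp add: e'_def)
        also have "\<dots> < e" using e by simp
        finally show "dist (H (Suc n) k) (\<Psi> h k) < e" by (simp add: H_Suc dist_norm)
      qed
    qed
    show ?thesis using LIMSEQ_unique[OF 1 2] by simp
  qed
  ultimately show thesis by (rule that)
qed

section \<open>Integral bounds and push-forwards\<close>

lemma set_integral_norm_le:
  fixes F :: "'a \<Rightarrow> 'b::{banach, second_countable_topology}"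
  assumes b: "set_integrable M S b" and le: "\<And>z. z \<in> S \<Longrightarrow> norm (F z) \<le> b z"
  shows "norm (LINT z:S|M. F z) \<le> (LINT z:S|M. b z)"
proof (cases "set_integrable M S F")
  case True
  then have "norm (LINT z:S|M. F z) \<le> (LINT z:S|M. norm (F z))"
    by (rule set_integral_norm_bound)
  also have "\<dots> \<le> (LINT z:S|M. b z)"
    by (rule set_integral_mono[OF set_integrable_norm[OF True] b le])
  finally show ?thesis .
next
  case False
  then have "(LINT z:S|M. F z) = 0"
    unfolding set_integrable_def set_lebesgue_integral_def by (rule not_integrable_integral_eq)
  moreover have "0 \<le> (LINT z:S|M. b z)"
    unfolding set_lebesgue_integral_def
  proof (intro Bochner_Integration.integral_nonneg)
    show "0 \<le> indicator S x *\<^sub>R b x" for x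
      using le[of x] norm_ge_zero[of "F x"] by (auto simp: indicator_def simp del: norm_ge_zero)
  qed
  ultimately show ?thesis by simp
qed

text \<open>The set function \<open>A \<mapsto> emeasure M (f -` A)\<close> behind a push-forward vanishes on sets with a
  non-measurable preimage. The complement of such a set has a non-measurable preimage too, so if the set
  function is a measure its total mass is 0, and if it is not a measure the push-forward is 0 by
  convention. Thus a single nonzero value makes all preimages measurable; this yields the
  measurability of the map from players to paths.\<close>

lemma measurable_of_distr_nonzero:
  assumes nz: "emeasure (distr M N f) (space N) \<noteq> 0" and A: "A \<in> sets N"
  shows "f -` A \<inter> space M \<in> sets M"
    and "emeasure (distr M N f) A = emeasure M (f -` A \<inter> space M)"
proof -
  define v where "v A = emeasure M (f -` A \<inter> space M)" for A
  have ms: "measure_space (space N) (sets N) v"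
  proof (rule ccontr)
    assume "\<not> ?thesis"
    then have "\<not> measure_space (space N) (sigma_sets (space N) (sets N)) v"
      by (simp add: sets.sigma_sets_eq)
    then have "emeasure (distr M N f) (space N) = 0"
      unfolding v_def by (simp add: distr_def emeasure_measure_of_conv)
    with nz show False by simp
  qed
  have em: "emeasure (distr M N f) B = v B" if "B \<in> sets N" for B
    using ms that unfolding distr_def v_def
    by (simp add: emeasure_measure_of_conv sets.sigma_sets_eq)
  from em[OF A] show "emeasure (distr M N f) A = emeasure M (f -` A \<inter> space M)" by (simp add: v_def)
  have "v (space N) \<noteq> 0" using nz em[of "space N"] by simp
  then have top: "f -` space N \<inter> space M \<in> sets M" unfolding v_def using emeasure_notin_sets by blast
  have sub: "A \<subseteq> space N" using A by (rule sets.sets_into_space)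
  show "f -` A \<inter> space M \<in> sets M"
  proof (rule ccontr)
    assume n: "f -` A \<inter> space M \<notin> sets M"
    have "f -` A \<inter> space M = (f -` space N \<inter> space M) - (f -` (space N - A) \<inter> space M)" using sub by auto
    with n top have n': "f -` (space N - A) \<inter> space M \<notin> sets M" by (metis sets.Diff)
    have "emeasure (distr M N f) A + emeasure (distr M N f) (space N - A) = emeasure (distr M N f) (space N)"
      using A sub plus_emeasure[of A "distr M N f" "space N - A"] by (simp add: Un_absorb1)
    moreover have "v A = 0" "v (space N - A) = 0"
      using n n' by (auto simp: v_def emeasure_notin_sets)
    ultimately show False using em A nz by simp
  qed
qed

section \<open>The setting with merged constants\<close>

text \<open>One constant for the dynamics and one for the payoffs; \<open>1 \<le> L\<close> makes the rate of the exponential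
  weight positive.\<close>

locale mean_field_game =
  fixes D :: "('x::euclidean_space, 'p::metric_space) mfg" and G :: "'x set" and L K :: real
  assumes setting: "mfg_setting D G"
    and L_ge_1: "1 \<le> L" and K_nonneg: "0 \<le> K"
    and lipschitz_dynam: "\<And>t x x' m m' u. t \<in> time D \<Longrightarrow> m \<in> prob_measures1 \<Longrightarrow> m' \<in> prob_measures1 \<Longrightarrow>
       u \<in> controls D \<Longrightarrow>
       norm (dynam D t x m u - dynam D t x' m' u) \<le> L * (norm (x - x') + kantorovich m m')"
    and lipschitz_terminal: "\<And>x x' m m'. x \<in> G \<Longrightarrow> x' \<in> G \<Longrightarrow> m \<in> prob_measures_on G \<Longrightarrow>
       m' \<in> prob_measures_on G \<Longrightarrow>
       \<bar>terminal D x m - terminal D x' m'\<bar> \<le> K * (norm (x - x') + kantorovich m m')"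
    and lipschitz_running: "\<And>t x x' m m' u. t \<in> time D \<Longrightarrow> x \<in> G \<Longrightarrow> x' \<in> G \<Longrightarrow>
       m \<in> prob_measures_on G \<Longrightarrow> m' \<in> prob_measures_on G \<Longrightarrow> u \<in> controls D \<Longrightarrow>
       \<bar>running D t x m u - running D t x' m' u\<bar> \<le> K * (norm (x - x') + kantorovich m m')"
begin

abbreviation jointly_continuous :: "(real \<Rightarrow> 'x \<Rightarrow> 'x measure \<Rightarrow> 'p \<Rightarrow> 'b::topological_space) \<Rightarrow> bool" where
  "jointly_continuous h \<equiv> continuous_map
     (prod_topology (top_of_set (time D)) (prod_topology euclidean
       (prod_topology (mtopology_of kantorovich_metric) (top_of_set (controls D)))))
     euclidean (\<lambda>(t, x, m, u). h t x m u)"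

lemma horizon_pos: "horizon D > 0" and compact_controls: "compact (controls D)"
  and controls_nonempty: "controls D \<noteq> {}"
  and continuous_dynam: "jointly_continuous (dynam D)" and continuous_running: "jointly_continuous (running D)"
  and initial_P1: "initial D \<in> prob_measures1" and compact_initial_set: "compact (initial_set D)"
  and compact_G: "compact G"
  using setting by (simp_all only: mfg_setting_def not_False_eq_True)

lemma ordinary_in_G:
  assumes "\<nu> \<in> flows D" "u \<in> lebesgue_on (time D) \<rightarrow>\<^sub>M restrict_space borel (controls D)"
    and "controlled_solution D \<nu> u x" "x 0 \<in> initial_set D" "t \<in> time D"
  shows "x t \<in> G"
proof -
  have "\<forall>\<mu>\<in>flows D. \<forall>u \<in> lebesgue_on (time D) \<rightarrow>\<^sub>M restrict_space borel (controls D). \<forall>x.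
      controlled_solution D \<mu> u x \<and> x 0 \<in> initial_set D \<longrightarrow> (\<forall>t\<in>time D. x t \<in> G)"
    using setting unfolding mfg_setting_def by (elim conjE) assumption
  with assms show ?thesis by blast
qed

abbreviation strip_integral :: "(real \<times> 'p) measure \<Rightarrow> real set \<Rightarrow>
    (real \<times> 'p \<Rightarrow> 'b::{banach, second_countable_topology}) \<Rightarrow> 'b" where
  "strip_integral \<alpha> A F \<equiv> LINT z:A \<times> controls D|\<alpha>. F z"

text \<open>The rate is chosen so that a drift difference of size \<open>L * d * growth \<tau>\<close> integrates to at most
  \<open>d / 4 * growth t\<close>. A quarter for the state and a quarter for the flow leave the factor 1/2 that
  \<open>halving_bound\<close> asks for.\<close>

abbreviation growth :: "real \<Rightarrow> real" where "growth t \<equiv> exp (4 * L * t)"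

text \<open>A coefficient along a curve as an integrand on \<open>[0, T] \<times> P\<close>: with the dynamics it is the
  integrand of the trajectory equation, with the running payoff that of the cost.\<close>

definition along :: "(real \<Rightarrow> 'x \<Rightarrow> 'x measure \<Rightarrow> 'p \<Rightarrow> 'b) \<Rightarrow> (real \<Rightarrow> 'x measure) \<Rightarrow> (real \<Rightarrow> 'x) \<Rightarrow>
    real \<times> 'p \<Rightarrow> 'b" where
  "along h \<nu> x = (\<lambda>(\<tau>, u). h \<tau> (x \<tau>) (\<nu> \<tau>) u)"

lemma flow_P1: "\<nu> \<in> flows D \<Longrightarrow> t \<in> time D \<Longrightarrow> \<nu> t \<in> prob_measures1"
  by (auto simp: flows_def continuous_map_def)

lemma kantorovich_nonneg: "m \<in> prob_measures1 \<Longrightarrow> m' \<in> prob_measures1 \<Longrightarrow> 0 \<le> kantorovich m m'"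
  using kantorovich_upper[of m m' "\<lambda>_. 0"] by (auto simp: lipschitz_on_def)

lemma kantorovich_self: "m \<in> prob_measures1 \<Longrightarrow> kantorovich m m = 0"
  using kantorovich_nonneg[of m m] kantorovich_least[of m m 0] by auto


section \<open>Control measures\<close>

context
  fixes \<alpha> :: "(real \<times> 'p) measure"
  assumes \<alpha>: "\<alpha> \<in> control_measures D"
begin

lemma sets_control: "sets \<alpha> = sets (restrict_space borel (time D \<times> controls D))"
  and control_marginal: "distr \<alpha> (restrict_space borel (time D)) fst = restrict_space lborel (time D)"
  using \<alpha> by (auto simp: control_measures_def)

lemma space_control: "space \<alpha> = time D \<times> controls D"
  using sets_eq_imp_space_eq[OF sets_control] by (simp add: space_restrict_space)

lemma measurable_fst_control: "fst \<in> \<alpha> \<rightarrow>\<^sub>M restrict_space borel (time D)"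
proof -
  have "(fst :: real \<times> 'p \<Rightarrow> real) \<in> borel_measurable borel"
    by (intro borel_measurable_continuous_onI continuous_intros)
  then have "fst \<in> borel_measurable (restrict_space borel (time D \<times> controls D))"
    by (rule measurable_restrict_space1)
  then have "fst \<in> borel_measurable \<alpha>"
    by (simp add: measurable_cong_sets[OF sets_control refl])
  then show ?thesis
    by (rule measurable_restrict_space2[rotated]) (auto simp: space_control)
qed

lemma control_strip_sets: "A \<in> sets borel \<Longrightarrow> A \<subseteq> time D \<Longrightarrow> A \<times> controls D \<in> sets \<alpha>"
proof -
  assume A: "A \<in> sets borel" "A \<subseteq> time D"
  have "fst -` A \<inter> space \<alpha> \<in> sets \<alpha>"
    by (rule measurable_sets[OF measurable_fst_control]) (use A in \<open>auto simp: sets_restrict_space_iff\<close>)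
  moreover have "fst -` A \<inter> space \<alpha> = A \<times> controls D" using A by (auto simp: space_control)
  ultimately show ?thesis by simp
qed

text \<open>Integrands that depend on time alone see only the marginal of \<open>\<alpha>\<close>, which is Lebesgue measure. Via
  \<open>set_integral_norm_le\<close> this gives all the bounds on control integrals below.\<close>

lemma
  fixes h :: "real \<Rightarrow> real"
  assumes A: "A \<in> sets borel" "A \<subseteq> time D" and h: "h \<in> borel_measurable borel"
  shows control_integral_time: "(LINT z:A \<times> controls D|\<alpha>. h (fst z)) = (LINT t:A|lborel. h t)"
    and control_integrable_time: "set_integrable lborel A h \<Longrightarrow> set_integrable \<alpha> (A \<times> controls D) (\<lambda>z. h (fst z))"
proof -
  let ?k = "\<lambda>t. indicator A t *\<^sub>R h t"
  have k: "?k \<in> borel_measurable (restrict_space borel (time D))"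
    using A h by (intro measurable_restrict_space1) auto
  have tk: "indicator (time D) t *\<^sub>R ?k t = ?k t" for t using A(2) by (auto simp: indicator_def)
  have eq: "indicator (A \<times> controls D) z *\<^sub>R h (fst z) = ?k (fst z)" if "z \<in> space \<alpha>" for z
    using that by (auto simp: space_control indicator_def)
  have "(LINT z:A \<times> controls D|\<alpha>. h (fst z)) = (\<integral>z. ?k (fst z) \<partial>\<alpha>)"
    unfolding set_lebesgue_integral_def using eq by (intro Bochner_Integration.integral_cong) auto
  also have "\<dots> = (\<integral>t. ?k t \<partial>restrict_space lborel (time D))"
    using integral_distr[OF measurable_fst_control k] control_marginal by simp
  also have "\<dots> = (LINT t:A|lborel. h t)"
    unfolding set_lebesgue_integral_def by (subst integral_restrict_space) (simp_all only: tk, simp_all)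
  finally show "(LINT z:A \<times> controls D|\<alpha>. h (fst z)) = (LINT t:A|lborel. h t)" .
  assume "set_integrable lborel A h"
  then have "integrable (restrict_space lborel (time D)) ?k"
    unfolding set_integrable_def by (subst integrable_restrict_space) (simp_all only: set_integrable_def tk, simp_all)
  then have "integrable \<alpha> (\<lambda>z. ?k (fst z))"
    using integrable_distr_eq[OF measurable_fst_control k] control_marginal by simp
  then show "set_integrable \<alpha> (A \<times> controls D) (\<lambda>z. h (fst z))"
    unfolding set_integrable_def using eq by (subst Bochner_Integration.integrable_cong[OF refl]) auto
qed

lemma finite_measure_control: "finite_measure \<alpha>"
proof
  have "emeasure \<alpha> (space \<alpha>) = emeasure (distr \<alpha> (restrict_space borel (time D)) fst) (time D)"
    by (subst emeasure_distr[OF measurable_fst_control]) (auto simp: sets_restrict_space_iff space_control intro!: arg_cong[where f="emeasure \<alpha>"])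
  also have "\<dots> = emeasure lborel (time D)"
    by (simp add: control_marginal emeasure_restrict_space)
  finally show "emeasure \<alpha> (space \<alpha>) \<noteq> \<infinity>" using horizon_pos by simp
qed

lemma control_integral_growth_le:
  assumes t: "t \<in> time D"
  shows "(LINT z:{0..t} \<times> controls D|\<alpha>. growth (fst z)) \<le> growth t / (4 * L)"
    and "set_integrable \<alpha> ({0..t} \<times> controls D) (\<lambda>z. growth (fst z))"
proof -
  have sub: "{0..t} \<subseteq> time D" using t by auto
  have "(LINT z:{0..t} \<times> controls D|\<alpha>. growth (fst z)) = (LINT \<tau>:{0..t}|lborel. growth \<tau>)"
    using sub by (intro control_integral_time) auto
  also have "\<dots> = growth t / (4 * L) - growth 0 / (4 * L)"
    unfolding set_lebesgue_integral_def
    by (rule integral_FTC_atLeastAtMost)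
      (use t L_ge_1 in \<open>auto intro!: derivative_eq_intros continuous_intros
         simp flip: has_real_derivative_iff_has_vector_derivative\<close>)
  also have "\<dots> \<le> growth t / (4 * L)" using L_ge_1 by simp
  finally show "(LINT z:{0..t} \<times> controls D|\<alpha>. growth (fst z)) \<le> growth t / (4 * L)" .
  show "set_integrable \<alpha> ({0..t} \<times> controls D) (\<lambda>z. growth (fst z))"
    using sub by (intro control_integrable_time borel_integrable_atLeastAtMost') (auto intro!: continuous_intros)
qed

lemma control_integral_growth_bound:
  fixes F :: "real \<times> 'p \<Rightarrow> 'b::{banach, second_countable_topology}"
  assumes t: "t \<in> time D" and d: "0 \<le> d"
    and F: "\<And>\<tau> u. \<tau> \<in> {0..t} \<Longrightarrow> u \<in> controls D \<Longrightarrow> norm (F (\<tau>, u)) \<le> L * d * growth \<tau>"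
  shows "norm (strip_integral \<alpha> {0..t} F) \<le> d / 4 * growth t"
proof -
  have "norm (strip_integral \<alpha> {0..t} F) \<le> (LINT z:{0..t} \<times> controls D|\<alpha>. (L * d) * growth (fst z))"
    using F by (intro set_integral_norm_le set_integrable_mult_right control_integral_growth_le(2)[OF t]) auto
  also have "\<dots> = L * d * (LINT z:{0..t} \<times> controls D|\<alpha>. growth (fst z))" by simp
  also have "\<dots> \<le> L * d * (growth t / (4 * L))"
    using control_integral_growth_le(1)[OF t] d L_ge_1 by (intro mult_left_mono) auto
  also have "\<dots> = d / 4 * growth t" using L_ge_1 by simp
  finally show ?thesis .
qed

lemma control_integral_strip_bound:
  fixes F :: "real \<times> 'p \<Rightarrow> 'b::{banach, second_countable_topology}"
  assumes A: "A \<in> sets borel" "A \<subseteq> time D"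
    and F: "\<And>\<tau> u. \<tau> \<in> A \<Longrightarrow> u \<in> controls D \<Longrightarrow> norm (F (\<tau>, u)) \<le> M"
  shows "norm (strip_integral \<alpha> A F) \<le> M * measure lborel A"
proof -
  have fin: "emeasure lborel A \<noteq> \<infinity>"
    using emeasure_mono[OF A(2), of lborel] horizon_pos by (auto simp: top_unique)
  have i: "set_integrable lborel A (\<lambda>_. M)" unfolding set_integrable_def
    using A fin by (intro integrable_scaleR_left integrable_real_indicator) (auto simp: less_top)
  have "norm (strip_integral \<alpha> A F) \<le> (LINT z:A \<times> controls D|\<alpha>. M)"
    using F by (intro set_integral_norm_le control_integrable_time[OF A _ i, simplified]) auto
  also have "\<dots> = (LINT z:A|lborel. M)"
    using control_integral_time[OF A, of "\<lambda>_. M"] by simp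
  also have "\<dots> = M * measure lborel A"
    using set_integral_const[of A lborel M] A fin by simp
  finally show ?thesis .
qed

lemma integrable_control:
  fixes F :: "real \<times> 'p \<Rightarrow> 'b::{banach, second_countable_topology}"
  assumes F: "continuous_on (time D \<times> controls D) F"
  shows "integrable \<alpha> F"
proof -
  interpret finite_measure \<alpha> by (rule finite_measure_control)
  obtain B where B: "\<And>z. z \<in> time D \<times> controls D \<Longrightarrow> norm (F z) \<le> B"
    by (rule continuous_on_compact_bound[OF compact_Times[OF compact_Icc compact_controls] F]) blast
  show ?thesis
  proof (rule integrable_const_bound)
    show "AE z in \<alpha>. norm (F z) \<le> B" using B by (intro AE_I2) (auto simp: space_control)
    show "F \<in> borel_measurable \<alpha>"
      using borel_measurable_continuous_on_restrict[OF F] by (simp add: measurable_cong_sets[OF sets_control refl])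
  qed
qed

lemma set_integrable_control:
  fixes F :: "real \<times> 'p \<Rightarrow> 'b::{banach, second_countable_topology}"
  assumes F: "continuous_on (time D \<times> controls D) F" and A: "A \<in> sets borel" "A \<subseteq> time D"
  shows "set_integrable \<alpha> (A \<times> controls D) F"
  unfolding set_integrable_def
  by (intro integrable_mult_indicator control_strip_sets integrable_control A F)

lemma control_integral_split:
  fixes F :: "real \<times> 'p \<Rightarrow> 'b::{banach, second_countable_topology}"
  assumes F: "continuous_on (time D \<times> controls D) F" and st: "0 \<le> s" "s \<le> t" "t \<le> horizon D"
  shows "(strip_integral \<alpha> {0..t} F) =
    (strip_integral \<alpha> {0..s} F) + (strip_integral \<alpha> {s<..t} F)"
proof -
  have "{0..t} \<times> controls D = {0..s} \<times> controls D \<union> {s<..t} \<times> controls D" using st by auto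
  then show ?thesis
    using st by (auto intro!: set_integral_Un set_integrable_control F)
qed

lemma control_integral_increment:
  fixes F :: "real \<times> 'p \<Rightarrow> 'b::{banach, second_countable_topology}"
  assumes F: "continuous_on (time D \<times> controls D) F" and st: "s \<in> time D" "t \<in> time D"
    and M: "\<And>z. z \<in> time D \<times> controls D \<Longrightarrow> norm (F z) \<le> M"
  shows "norm ((strip_integral \<alpha> {0..t} F) - (strip_integral \<alpha> {0..s} F)) \<le> M * \<bar>t - s\<bar>"
proof -
  have *: "norm ((strip_integral \<alpha> {0..t} F) - (strip_integral \<alpha> {0..s} F)) \<le> M * (t - s)"
    if "s \<in> time D" "t \<in> time D" "s \<le> t" for s t
  proof -
    have "norm (strip_integral \<alpha> {s<..t} F) \<le> M * measure lborel {s<..t}"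
      using that M by (intro control_integral_strip_bound) auto
    then show ?thesis using control_integral_split[OF F, of s t] that by simp
  qed
  show ?thesis
    using *[of s t] *[of t s] st by (cases "s \<le> t") (auto simp: norm_minus_commute)
qed

end


section \<open>Trajectories\<close>

lemma continuous_along_flow:
  assumes h: "jointly_continuous h"
    and \<nu>: "\<nu> \<in> flows D"
  shows "continuous_on (time D \<times> UNIV \<times> controls D) (\<lambda>(t, x, u). h t x (\<nu> t) u)"
proof -
  let ?X = "top_of_set (time D \<times> (UNIV :: 'x set) \<times> controls D)"
  have fst: "continuous_map ?X (top_of_set (time D)) (\<lambda>z. fst z)"
    by (auto intro!: continuous_intros)
  have "continuous_map ?X (mtopology_of kantorovich_metric) (\<nu> \<circ> (\<lambda>z. fst z))"
    by (rule continuous_map_compose[OF fst]) (use \<nu> in \<open>simp add: flows_def\<close>)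
  then have "continuous_map ?X (prod_topology (top_of_set (time D)) (prod_topology euclidean
         (prod_topology (mtopology_of kantorovich_metric) (top_of_set (controls D)))))
      (\<lambda>z. (fst z, fst (snd z), \<nu> (fst z), snd (snd z)))"
    by (intro continuous_map_pairedI fst) (auto simp: o_def intro!: continuous_intros)
  from continuous_map_compose[OF this h]
  show ?thesis by (simp add: o_def case_prod_unfold)
qed

lemma continuous_on_along:
  assumes h: "jointly_continuous h"
    and \<nu>: "\<nu> \<in> flows D" and x: "continuous_on (time D) x"
  shows "continuous_on (time D \<times> controls D) (along h \<nu> x)"
proof -
  have "continuous_on (time D \<times> controls D) (\<lambda>z. x (fst z))"
    by (rule continuous_on_compose2[OF x]) (auto intro!: continuous_intros)
  then have "continuous_on (time D \<times> controls D) (\<lambda>z. (fst z, x (fst z), snd z))"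
    by (intro continuous_intros)
  then have "continuous_on (time D \<times> controls D)
      (\<lambda>z. (\<lambda>(t, x, u). h t x (\<nu> t) u) (fst z, x (fst z), snd z))"
    by (rule continuous_on_compose2[OF continuous_along_flow[OF h \<nu>]]) auto
  then show ?thesis by (simp add: along_def case_prod_unfold)
qed

lemma bounded_along_flow:
  fixes h :: "real \<Rightarrow> 'x \<Rightarrow> 'x measure \<Rightarrow> 'p \<Rightarrow> 'b::real_normed_vector"
  assumes h: "jointly_continuous h"
    and \<nu>: "\<nu> \<in> flows D" and C: "compact C"
  obtains M where "0 \<le> M" "\<And>t x u. t \<in> time D \<Longrightarrow> x \<in> C \<Longrightarrow> u \<in> controls D \<Longrightarrow> norm (h t x (\<nu> t) u) \<le> M"
proof -
  have "compact (time D \<times> C \<times> controls D)"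
    by (intro compact_Times compact_controls C) simp
  moreover have "continuous_on (time D \<times> C \<times> controls D) (\<lambda>(t, x, u). h t x (\<nu> t) u)"
    by (rule continuous_on_subset[OF continuous_along_flow[OF h \<nu>]]) auto
  ultimately obtain B where B: "0 \<le> B"
      "\<And>z. z \<in> time D \<times> C \<times> controls D \<Longrightarrow> norm ((\<lambda>(t, x, u). h t x (\<nu> t) u) z) \<le> B"
    by (rule continuous_on_compact_bound) blast
  show ?thesis
  proof (rule that[OF B(1)])
    show "norm (h t x (\<nu> t) u) \<le> B" if "t \<in> time D" "x \<in> C" "u \<in> controls D" for t x u
      using B(2)[of "(t, x, u)"] that by auto
  qed
qed

lemma bounded_on_time:
  fixes x :: "real \<Rightarrow> 'x"
  assumes "continuous_on (time D) x"
  obtains B where "0 \<le> B" "\<And>t. t \<in> time D \<Longrightarrow> norm (x t) \<le> B"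
proof -
  show ?thesis by (rule continuous_on_compact_bound[OF _ assms]) (auto intro: that)
qed

lemma drift_difference:
  assumes "\<nu> \<in> flows D" "\<nu>' \<in> flows D" "\<tau> \<in> time D" "u \<in> controls D"
    and "norm (x \<tau> - x' \<tau>) \<le> d * growth \<tau>" "kantorovich (\<nu> \<tau>) (\<nu>' \<tau>) \<le> c * growth \<tau>"
  shows "norm (along (dynam D) \<nu> x (\<tau>, u) - along (dynam D) \<nu>' x' (\<tau>, u)) \<le> L * (d + c) * growth \<tau>"
proof -
  have "norm (along (dynam D) \<nu> x (\<tau>, u) - along (dynam D) \<nu>' x' (\<tau>, u))
      \<le> L * (norm (x \<tau> - x' \<tau>) + kantorovich (\<nu> \<tau>) (\<nu>' \<tau>))"
    using assms(1-4) by (auto simp: along_def intro!: lipschitz_dynam flow_P1)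
  also have "\<dots> \<le> L * (d * growth \<tau> + c * growth \<tau>)"
    using assms(5,6) L_ge_1 by (intro mult_left_mono add_mono) auto
  finally show ?thesis by (simp add: algebra_simps)
qed

text \<open>The common core of the stability in initial point and flow (where \<open>a\<close> is the distance of the initial
  points) and of the stability in the control measure (where \<open>a\<close> bounds the change of the integrals).\<close>

lemma gronwall_along:
  assumes \<nu>: "\<nu> \<in> flows D" "\<nu>' \<in> flows D" and \<beta>: "\<beta> \<in> control_measures D"
    and x: "continuous_on (time D) x" "continuous_on (time D) x'"
    and a: "0 \<le> a" and c: "0 \<le> c" "\<And>t. t \<in> time D \<Longrightarrow> kantorovich (\<nu> t) (\<nu>' t) \<le> c * growth t"
    and le: "\<And>t. t \<in> time D \<Longrightarrow> norm (x t - x' t) \<le> a +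
        norm (LINT z:{0..t} \<times> controls D|\<beta>. along (dynam D) \<nu> x z - along (dynam D) \<nu>' x' z)"
    and t: "t \<in> time D"
  shows "norm (x t - x' t) \<le> (2 * a + c / 2) * growth t"
proof -
  have g1: "1 \<le> growth t" if "t \<in> time D" for t using that L_ge_1 by simp
  obtain B where B: "0 \<le> B" "\<And>t. t \<in> time D \<Longrightarrow> norm (x t - x' t) \<le> B"
    using bounded_on_time[of "\<lambda>t. x t - x' t"] x by (auto intro: continuous_intros)
  have "norm (x t - x' t) \<le> 2 * (a + c / 4) * growth t"
  proof (rule halving_bound[where K = "time D" and h = "\<lambda>t. norm (x t - x' t)" and ?c0.0 = B])
    fix t assume t: "t \<in> time D"
    have "B * 1 \<le> B * growth t" using B g1[OF t] by (intro mult_left_mono) auto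
    then show "norm (x t - x' t) \<le> B * growth t" using B(2)[OF t] by simp
  next
    fix d t assume d: "0 \<le> d" "\<And>t. t \<in> time D \<Longrightarrow> norm (x t - x' t) \<le> d * growth t" and t: "t \<in> time D"
    have "norm (LINT z:{0..t} \<times> controls D|\<beta>. along (dynam D) \<nu> x z - along (dynam D) \<nu>' x' z)
        \<le> (d + c) / 4 * growth t"
      using c d t by (intro control_integral_growth_bound[OF \<beta> t] drift_difference \<nu>) auto
    moreover have "a \<le> a * growth t" using a g1[OF t] mult_left_mono[of 1 "growth t" a] by simp
    ultimately have "norm (x t - x' t) \<le> a * growth t + (d + c) / 4 * growth t"
      using le[OF t] by linarith
    also have "\<dots> = (a + c / 4 + d / 4) * growth t" by (simp add: field_simps)
    also have "\<dots> \<le> (a + c / 4 + d / 2) * growth t"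
      using d by (intro mult_right_mono) auto
    finally show "norm (x t - x' t) \<le> (a + c / 4 + d / 2) * growth t" .
  qed (use a c t in auto)
  then show ?thesis by (simp add: algebra_simps)
qed

abbreviation solves :: "(real \<Rightarrow> 'x measure) \<Rightarrow> 'x \<Rightarrow> (real \<times> 'p) measure \<Rightarrow> (real \<Rightarrow> 'x) \<Rightarrow> bool" where
  "solves \<nu> y \<alpha> x \<equiv> continuous_on (time D) x \<and>
     (\<forall>t\<in>time D. x t = y + (strip_integral \<alpha> {0..t} (along (dynam D) \<nu> x)))"

lemma solves_stability:
  assumes \<nu>: "\<nu> \<in> flows D" "\<nu>' \<in> flows D" and \<alpha>: "\<alpha> \<in> control_measures D"
    and x: "solves \<nu> y \<alpha> x" "solves \<nu>' y' \<alpha> x'"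
    and c: "0 \<le> c" "\<And>t. t \<in> time D \<Longrightarrow> kantorovich (\<nu> t) (\<nu>' t) \<le> c * growth t"
    and t: "t \<in> time D"
  shows "norm (x t - x' t) \<le> (2 * norm (y - y') + c / 2) * growth t"
proof (rule gronwall_along[OF \<nu> \<alpha> _ _ _ c _ t])
  fix t assume t: "t \<in> time D"
  let ?F = "along (dynam D) \<nu> x" and ?F' = "along (dynam D) \<nu>' x'"
  have "set_integrable \<alpha> ({0..t} \<times> controls D) ?F" "set_integrable \<alpha> ({0..t} \<times> controls D) ?F'"
    using x t by (auto intro!: set_integrable_control[OF \<alpha>] continuous_on_along continuous_dynam \<nu>)
  then have "x t - x' t = (y - y') + (LINT z:{0..t} \<times> controls D|\<alpha>. ?F z - ?F' z)"
    using x t by (auto simp: set_integral_diff(2))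
  then show "norm (x t - x' t) \<le> norm (y - y') + norm (LINT z:{0..t} \<times> controls D|\<alpha>. ?F z - ?F' z)"
    by (simp add: norm_triangle_ineq)
qed (use x in auto)

lemma solves_exists:
  assumes \<nu>: "\<nu> \<in> flows D" and \<alpha>: "\<alpha> \<in> control_measures D"
  obtains x where "x \<in> extensional (time D)" "solves \<nu> y \<alpha> x"
proof -
  define \<Psi> where "\<Psi> x t = y + (strip_integral \<alpha> {0..t} (along (dynam D) \<nu> x))" for x t
  let ?S = "{x :: real \<Rightarrow> 'x. continuous_on (time D) x}"
  have cont: "\<Psi> x \<in> ?S" if x: "x \<in> ?S" for x
  proof -
    let ?F = "along (dynam D) \<nu> x"
    have F: "continuous_on (time D \<times> controls D) ?F"
      using x by (auto intro: continuous_on_along continuous_dynam \<nu>)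
    obtain M where M: "\<And>z. z \<in> time D \<times> controls D \<Longrightarrow> norm (?F z) \<le> M"
      by (rule continuous_on_compact_bound[OF compact_Times[OF compact_Icc compact_controls] F]) blast
    have "(max M 0)-lipschitz_on (time D) (\<Psi> x)"
    proof (rule lipschitz_onI)
      fix s t assume st: "s \<in> time D" "t \<in> time D"
      have "norm (\<Psi> x s - \<Psi> x t) \<le> M * \<bar>s - t\<bar>"
        unfolding \<Psi>_def using control_integral_increment[OF \<alpha> F st(2,1) M] by simp
      also have "\<dots> \<le> max M 0 * \<bar>s - t\<bar>" by (intro mult_right_mono) auto
      finally show "dist (\<Psi> x s) (\<Psi> x t) \<le> max M 0 * dist s t" by (simp add: dist_norm)
    qed simp
    then show ?thesis using lipschitz_on_continuous_on by blast
  qed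
  obtain B where B: "0 \<le> B" "\<And>t. t \<in> time D \<Longrightarrow> norm (\<Psi> (\<lambda>_. 0) t - 0) \<le> B"
    using bounded_on_time[of "\<Psi> (\<lambda>_. 0)"] cont[of "\<lambda>_. 0"] by auto
  have W: "kantorovich (\<nu> t) (\<nu> t) \<le> 0 * growth t" if "t \<in> time D" for t
    using kantorovich_self[OF flow_P1[OF \<nu> that]] by simp
  obtain x where x: "x \<in> ?S" "\<And>t. t \<in> time D \<Longrightarrow> \<Psi> x t = x t"
  proof (rule weighted_contraction_fixed_point[where S = ?S and K = "time D" and w = growth and \<Psi> = \<Psi>
      and B = "growth (horizon D)" and ?c0.0 = B and ?h0.0 = "\<lambda>_. 0"])
    show "h \<in> ?S" if "\<And>n. H n \<in> ?S" "uniform_limit (time D) H h sequentially" for H h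
      using uniform_limit_theorem[OF _ that(2)] that(1) by auto
    show "norm (\<Psi> x t - \<Psi> x' t) \<le> c / 2 * growth t"
      if x: "x \<in> ?S" "x' \<in> ?S" and c: "0 \<le> c" "\<And>t. t \<in> time D \<Longrightarrow> norm (x t - x' t) \<le> c * growth t"
        and t: "t \<in> time D" for x x' c t
    proof -
      let ?F = "along (dynam D) \<nu> x" and ?F' = "along (dynam D) \<nu> x'"
      have "set_integrable \<alpha> ({0..t} \<times> controls D) ?F" "set_integrable \<alpha> ({0..t} \<times> controls D) ?F'"
        using x t by (auto intro!: set_integrable_control[OF \<alpha>] continuous_on_along continuous_dynam \<nu>)
      then have "\<Psi> x t - \<Psi> x' t = (LINT z:{0..t} \<times> controls D|\<alpha>. ?F z - ?F' z)"
        by (simp add: \<Psi>_def set_integral_diff(2))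
      also have "norm \<dots> \<le> (c + 0) / 4 * growth t"
        using c t W by (intro control_integral_growth_bound[OF \<alpha> t] drift_difference \<nu>) auto
      also have "\<dots> \<le> c / 2 * growth t" using c by (intro mult_right_mono) auto
      finally show ?thesis .
    qed
    show "norm (\<Psi> (\<lambda>_. 0) t - 0) \<le> B * growth t" if t: "t \<in> time D" for t
    proof -
      have "B * 1 \<le> B * growth t" using t L_ge_1 B by (intro mult_left_mono) auto
      then show ?thesis using B(2)[OF t] by simp
    qed
  qed (use L_ge_1 cont in auto)
  let ?x = "restrict x (time D)"
  have "along (dynam D) \<nu> ?x z = along (dynam D) \<nu> x z" if "z \<in> {0..t} \<times> controls D" "t \<in> time D" for z t
    using that by (auto simp: along_def)
  then have "(strip_integral \<alpha> {0..t} (along (dynam D) \<nu> ?x)) =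
      (strip_integral \<alpha> {0..t} (along (dynam D) \<nu> x))" if "t \<in> time D" for t
    unfolding set_lebesgue_integral_def using that
    by (intro Bochner_Integration.integral_cong) (auto simp: indicator_def)
  moreover have "continuous_on (time D) ?x"
    by (rule continuous_on_eq[OF x(1)[unfolded mem_Collect_eq]]) auto
  ultimately have "solves \<nu> y \<alpha> ?x" using x(2) by (simp add: \<Psi>_def)
  then show ?thesis by (intro that[of ?x]) auto
qed

lemma traj_as_THE: "traj D \<nu> 0 y \<alpha> = (THE x. x \<in> extensional (time D) \<and> solves \<nu> y \<alpha> x)"
  by (simp only: traj_def along_def)

lemma traj_solves:
  assumes \<nu>: "\<nu> \<in> flows D" and \<alpha>: "\<alpha> \<in> control_measures D"
  shows "solves \<nu> y \<alpha> (traj D \<nu> 0 y \<alpha>)"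
proof -
  have uniq: "x t = x' t" if "solves \<nu> y \<alpha> x" "solves \<nu> y \<alpha> x'" "t \<in> time D" for x x' t
    using solves_stability[OF \<nu> \<nu> \<alpha> that(1,2) order_refl _ that(3)]
    by (simp add: kantorovich_self flow_P1[OF \<nu>])
  obtain x0 where x0: "x0 \<in> extensional (time D)" "solves \<nu> y \<alpha> x0" by (rule solves_exists[OF \<nu> \<alpha>])
  have "traj D \<nu> 0 y \<alpha> = x0"
  proof (subst traj_as_THE, rule the_equality)
    fix x assume x: "x \<in> extensional (time D) \<and> solves \<nu> y \<alpha> x"
    show "x = x0"
      by (rule extensionalityI[of _ "time D"]) (use x x0(1) uniq[OF conjunct2[OF x] x0(2)] in blast)+
  qed (use x0 in auto)
  with x0 show ?thesis by simp
qed

lemma traj_continuous: "\<nu> \<in> flows D \<Longrightarrow> \<alpha> \<in> control_measures D \<Longrightarrow> continuous_on (time D) (traj D \<nu> 0 y \<alpha>)"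
  using traj_solves by blast

lemma traj_eq:
  "\<nu> \<in> flows D \<Longrightarrow> \<alpha> \<in> control_measures D \<Longrightarrow> t \<in> time D \<Longrightarrow>
    traj D \<nu> 0 y \<alpha> t = y + (strip_integral \<alpha> {0..t} (along (dynam D) \<nu> (traj D \<nu> 0 y \<alpha>)))"
  using traj_solves by blast

lemma continuous_on_along_traj:
  assumes "jointly_continuous h"
    and "\<nu> \<in> flows D" "\<alpha> \<in> control_measures D"
  shows "continuous_on (time D \<times> controls D) (along h \<nu> (traj D \<nu> 0 y \<alpha>))"
  using assms by (intro continuous_on_along traj_continuous)

text \<open>The factor 1/2 in front of \<open>c\<close> is what allows the distance of two flows to be bounded in terms of
  itself when the flows are laws of the trajectories.\<close>

lemma traj_stability:
  assumes "\<nu> \<in> flows D" "\<nu>' \<in> flows D" "\<alpha> \<in> control_measures D" "0 \<le> c"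
    and "\<And>t. t \<in> time D \<Longrightarrow> kantorovich (\<nu> t) (\<nu>' t) \<le> c * growth t" "t \<in> time D"
  shows "norm (traj D \<nu> 0 y \<alpha> t - traj D \<nu>' 0 y' \<alpha> t) \<le> (2 * norm (y - y') + c / 2) * growth t"
  by (rule solves_stability[OF assms(1-3) traj_solves traj_solves assms(4-6)]) (use assms in auto)

text \<open>Both integrals in the hypothesis are taken along the trajectory of \<open>\<alpha>\<close>, so when \<open>\<beta>\<close> varies
  they are values of one fixed integrand, as the weak topology and the approximation by step controls require.\<close>

lemma traj_perturbation:
  assumes \<nu>: "\<nu> \<in> flows D" and \<alpha>: "\<alpha> \<in> control_measures D" and \<beta>: "\<beta> \<in> control_measures D"
    and a: "0 \<le> a" "\<And>t. t \<in> time D \<Longrightarrow> norm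
      ((strip_integral \<alpha> {0..t} (along (dynam D) \<nu> (traj D \<nu> 0 y \<alpha>))) -
       (strip_integral \<beta> {0..t} (along (dynam D) \<nu> (traj D \<nu> 0 y \<alpha>)))) \<le> a"
    and t: "t \<in> time D"
  shows "norm (traj D \<nu> 0 y \<alpha> t - traj D \<nu> 0 y \<beta> t) \<le> 2 * a * growth t"
proof -
  let ?x = "traj D \<nu> 0 y \<alpha>" and ?x' = "traj D \<nu> 0 y \<beta>"
  let ?F = "along (dynam D) \<nu> ?x" and ?F' = "along (dynam D) \<nu> ?x'"
  have "norm (?x t - ?x' t) \<le> (2 * a + 0 / 2) * growth t"
  proof (rule gronwall_along[OF \<nu> \<nu> \<beta> traj_continuous[OF \<nu> \<alpha>] traj_continuous[OF \<nu> \<beta>] a(1) order_refl _ _ t])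
    fix t assume t: "t \<in> time D"
    show "kantorovich (\<nu> t) (\<nu> t) \<le> 0 * growth t" using kantorovich_self[OF flow_P1[OF \<nu> t]] by simp
    have "set_integrable \<beta> ({0..t} \<times> controls D) ?F" "set_integrable \<beta> ({0..t} \<times> controls D) ?F'"
      using t by (auto intro!: set_integrable_control[OF \<beta>] continuous_on_along_traj continuous_dynam \<nu> \<alpha> \<beta>)
    then have "?x t - ?x' t = ((strip_integral \<alpha> {0..t} ?F) - (strip_integral \<beta> {0..t} ?F))
        + (LINT z:{0..t} \<times> controls D|\<beta>. ?F z - ?F' z)"
      using traj_eq[OF \<nu> \<alpha> t, of y] traj_eq[OF \<nu> \<beta> t, of y] by (simp add: set_integral_diff(2))
    then show "norm (?x t - ?x' t) \<le> a + norm (LINT z:{0..t} \<times> controls D|\<beta>. ?F z - ?F' z)"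
      using a(2)[OF t] by (simp only:) (rule order_trans[OF norm_triangle_ineq add_right_mono])
  qed
  then show ?thesis by simp
qed

end

lemma norm_diff_intermediate:
  fixes a b :: "'a::real_normed_vector"
  assumes "norm (a - a') \<le> p" "norm (b - b') \<le> q" "norm (a' - b') \<le> r"
  shows "norm (a - b) \<le> p + q + r"
proof -
  have "norm ((a - a') + (a' - b') - (b - b')) \<le> norm (a - a') + norm (a' - b') + norm (b - b')"
    using norm_triangle_ineq4[of "(a - a') + (a' - b')" "b - b'"] norm_triangle_ineq[of "a - a'" "a' - b'"] by linarith
  then show ?thesis using assms by simp
qed

section \<open>Continuity in the control measure\<close>

lemma sets_borel_of: "openin X U \<Longrightarrow> U \<in> sets (borel_of X)"
proof -
  have "{U. openin X U} \<subseteq> Pow (topspace X)" using openin_subset by auto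
  then show "openin X U \<Longrightarrow> ?thesis" by (simp add: borel_of_def sigma_sets.Basic)
qed

lemma space_borel_of: "space (borel_of X) = topspace X"
  by (auto simp: borel_of_def openin_subset space_measure_of_conv)

lemma continuous_map_measurable_borel:
  assumes f: "continuous_map X euclidean f"
  shows "f \<in> borel_measurable (borel_of X)"
proof (rule borel_measurableI)
  fix S :: "'b set" assume "open S"
  then have "openin X {x \<in> topspace X. f x \<in> S}"
    by (intro openin_continuous_map_preimage[OF f]) simp
  moreover have "f -` S \<inter> space (borel_of X) = {x \<in> topspace X. f x \<in> S}"
    by (auto simp: space_borel_of)
  ultimately show "f -` S \<inter> space (borel_of X) \<in> sets (borel_of X)" by (simp add: sets_borel_of)
qed

lemma continuous_map_by_neighbourhoods:
  fixes f :: "'a \<Rightarrow> 'b::metric_space"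
  assumes "\<And>x e. x \<in> topspace X \<Longrightarrow> 0 < e \<Longrightarrow> \<exists>W. openin X W \<and> x \<in> W \<and> (\<forall>y\<in>W. dist (f x) (f y) < e)"
  shows "continuous_map X euclidean f"
  unfolding continuous_map
proof (intro conjI allI impI)
  fix U :: "'b set" assume "openin euclidean U"
  then have U: "open U" by simp
  show "openin X {x \<in> topspace X. f x \<in> U}"
  proof (subst openin_subopen, rule ballI)
    fix x assume "x \<in> {x \<in> topspace X. f x \<in> U}"
    then have x: "x \<in> topspace X" "f x \<in> U" by auto
    obtain e where e: "e > 0" "\<And>z. dist (f x) z < e \<Longrightarrow> z \<in> U"
      using U x(2) by (metis open_dist dist_commute)
    obtain W where W: "openin X W" "x \<in> W" "\<forall>y\<in>W. dist (f x) (f y) < e"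
      using assms[OF x(1) e(1)] by blast
    then have "W \<subseteq> {x \<in> topspace X. f x \<in> U}" using e(2) openin_subset by fastforce
    with W show "\<exists>T. openin X T \<and> x \<in> T \<and> T \<subseteq> {x \<in> topspace X. f x \<in> U}" by blast
  qed
qed auto

context mean_field_game
begin

lemma topspace_control_topology: "topspace (control_topology D) = control_measures D"
proof
  show "topspace (control_topology D) \<subseteq> control_measures D"
    by (auto simp: control_topology_def topology_generated_by_topspace)
  have "control_measures D = {\<alpha> \<in> control_measures D. (\<integral>z. (0::real) \<partial>\<alpha>) \<in> UNIV}" by auto
  then show "control_measures D \<subseteq> topspace (control_topology D)"
    unfolding control_topology_def topology_generated_by_topspace
    by (intro Union_upper) (auto intro!: exI[of _ "\<lambda>_. 0"] exI[of _ UNIV])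
qed

lemma space_borel_control: "space (borel_of (control_topology D)) = control_measures D"
  by (simp add: space_borel_of topspace_control_topology)

text \<open>The topology is generated by real test functions; a vector-valued one is treated by components.\<close>

lemma control_neighbourhood:
  fixes \<phi> :: "'i \<Rightarrow> real \<times> 'p \<Rightarrow> 'b::euclidean_space"
  assumes I: "finite I" and \<phi>: "\<And>i. i \<in> I \<Longrightarrow> continuous_on (time D \<times> controls D) (\<phi> i)"
    and \<alpha>: "\<alpha> \<in> control_measures D" and e: "0 < e"
  obtains W where "openin (control_topology D) W" "\<alpha> \<in> W"
    "\<And>\<beta> i. \<beta> \<in> W \<Longrightarrow> i \<in> I \<Longrightarrow> norm ((\<integral>z. \<phi> i z \<partial>\<alpha>) - (\<integral>z. \<phi> i z \<partial>\<beta>)) < e"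
proof -
  define d where "d = e / DIM('b)"
  have d: "d > 0" using e by (simp add: d_def)
  let ?c = "\<lambda>p \<alpha>. \<integral>z. \<phi> (fst p) z \<bullet> snd p \<partial>\<alpha>"
  define V where "V p = {\<beta> \<in> control_measures D. ?c p \<beta> \<in> ball (?c p \<alpha>) d}" for p :: "'i \<times> 'b"
  have V: "openin (control_topology D) (V p)" if "p \<in> I \<times> Basis" for p
    unfolding V_def control_topology_def
  proof (intro topology_generated_by_Basis CollectI exI conjI)
    show "{\<beta> \<in> control_measures D. ?c p \<beta> \<in> ball (?c p \<alpha>) d} =
        {\<beta> \<in> control_measures D. (\<integral>z. \<phi> (fst p) z \<bullet> snd p \<partial>\<beta>) \<in> ball (?c p \<alpha>) d}" ..
  qed (use that \<phi> in \<open>auto intro!: continuous_intros\<close>)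
  define W where "W = (\<Inter>p\<in>I \<times> Basis. V p) \<inter> topspace (control_topology D)"
  have "openin (control_topology D) W"
    unfolding W_def using I V by (intro openin_INT) auto
  moreover have "\<alpha> \<in> W" using \<alpha> d by (auto simp: W_def V_def topspace_control_topology)
  moreover have "norm ((\<integral>z. \<phi> i z \<partial>\<alpha>) - (\<integral>z. \<phi> i z \<partial>\<beta>)) < e" if \<beta>: "\<beta> \<in> W" and i: "i \<in> I" for \<beta> i
  proof -
    have \<beta>U: "\<beta> \<in> control_measures D" using \<beta> by (auto simp: W_def topspace_control_topology)
    have "norm ((\<integral>z. \<phi> i z \<partial>\<alpha>) - (\<integral>z. \<phi> i z \<partial>\<beta>)) \<le> (\<Sum>b\<in>Basis. \<bar>((\<integral>z. \<phi> i z \<partial>\<alpha>) - (\<integral>z. \<phi> i z \<partial>\<beta>)) \<bullet> b\<bar>)"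
      by (rule norm_le_l1)
    also have "\<dots> < (\<Sum>b\<in>(Basis::'b set). d)"
    proof (rule sum_strict_mono)
      fix b :: 'b assume b: "b \<in> Basis"
      have "\<beta> \<in> V (i, b)" using \<beta> i b by (auto simp: W_def)
      then have "\<bar>(\<integral>z. \<phi> i z \<bullet> b \<partial>\<alpha>) - (\<integral>z. \<phi> i z \<bullet> b \<partial>\<beta>)\<bar> < d"
        by (simp add: V_def dist_real_def)
      then show "\<bar>((\<integral>z. \<phi> i z \<partial>\<alpha>) - (\<integral>z. \<phi> i z \<partial>\<beta>)) \<bullet> b\<bar> < d"
        using integrable_control[OF \<alpha> \<phi>[OF i]] integrable_control[OF \<beta>U \<phi>[OF i]]
        by (simp add: inner_diff_left)
    qed auto
    also have "\<dots> = e" by (simp add: d_def)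
    finally show ?thesis .
  qed
  ultimately show thesis by (rule that)
qed

lemma grid_exists:
  fixes e :: real
  assumes "0 < e"
  obtains n :: nat where "0 < n" "horizon D / n < e"
    "\<And>t. t \<in> time D \<Longrightarrow> \<exists>l\<le>n. l * (horizon D / n) \<le> t \<and> t \<le> (l + 1) * (horizon D / n)"
proof -
  obtain n :: nat where n: "horizon D / e < n" using reals_Archimedean2 by blast
  then have n0: "0 < n" using horizon_pos assms by (metis divide_pos_pos gr0I less_trans of_nat_0 less_irrefl)
  have "\<exists>l\<le>n. l * (horizon D / n) \<le> t \<and> t \<le> (l + 1) * (horizon D / n)" if t: "t \<in> time D" for t
  proof (intro exI[of _ "nat \<lfloor>t / (horizon D / n)\<rfloor>"] conjI)
    let ?h = "horizon D / n"
    have h: "?h > 0" using n0 horizon_pos by simp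
    have q: "0 \<le> t / ?h" "t / ?h \<le> n" using t horizon_pos n0 by (auto simp: field_simps)
    have r: "real (nat \<lfloor>t / ?h\<rfloor>) = of_int \<lfloor>t / ?h\<rfloor>" using q by simp
    show "nat \<lfloor>t / ?h\<rfloor> \<le> n" using q by (simp add: nat_le_iff floor_le_iff)
    show "nat \<lfloor>t / ?h\<rfloor> * ?h \<le> t" unfolding r using of_int_floor_le[of "t / ?h"] h by (simp only: pos_le_divide_eq)
    have "t / ?h \<le> of_int \<lfloor>t / ?h\<rfloor> + 1" using floor_correct[of "t / ?h"] by linarith
    then have "t / ?h \<le> real (nat \<lfloor>t / ?h\<rfloor>) + 1" unfolding r .
    then show "t \<le> (real (nat \<lfloor>t / ?h\<rfloor>) + 1) * ?h" using h by (simp only: pos_divide_le_eq)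
  qed
  then show thesis using n n0 assms by (intro that[of n]) (auto simp: field_simps)
qed

text \<open>Because of the cut-off at time \<open>t\<close>, the integral over \<open>[0, t] \<times> P\<close> is not the integral of a
  continuous test function. The cut-off is replaced by a continuous one that falls from 1 to 0 in a
  grid interval of length \<open>h\<close> around \<open>t\<close>; since strips of width \<open>h\<close> have measure \<open>h\<close> under every control
  measure, the error is \<open>M * h\<close> uniformly, and finitely many test functions serve all times.\<close>

lemma traj_neighbourhood:
  assumes \<nu>: "\<nu> \<in> flows D" and \<alpha>: "\<alpha> \<in> control_measures D" and e: "0 < e"
  obtains W where "openin (control_topology D) W" "\<alpha> \<in> W" "W \<subseteq> control_measures D"
    "\<And>\<beta> t. \<beta> \<in> W \<Longrightarrow> t \<in> time D \<Longrightarrow> norm (traj D \<nu> 0 y \<alpha> t - traj D \<nu> 0 y \<beta> t) \<le> e"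
proof -
  let ?F = "along (dynam D) \<nu> (traj D \<nu> 0 y \<alpha>)"
  have F: "continuous_on (time D \<times> controls D) ?F"
    by (intro continuous_on_along_traj continuous_dynam \<nu> \<alpha>)
  obtain M where M: "0 \<le> M" "\<And>z. z \<in> time D \<times> controls D \<Longrightarrow> norm (?F z) \<le> M"
    by (rule continuous_on_compact_bound[OF compact_Times[OF compact_Icc compact_controls] F]) blast
  define a where "a = e / (2 * growth (horizon D))"
  have a: "a > 0" using e by (simp add: a_def)
  obtain n :: nat where n: "0 < n" "horizon D / n < a / (4 * (M + 1))"
    "\<And>t. t \<in> time D \<Longrightarrow> \<exists>l\<le>n. l * (horizon D / n) \<le> t \<and> t \<le> (l + 1) * (horizon D / n)"
    by (rule grid_exists[of "a / (4 * (M + 1))"]) (use a M in auto)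
  define h where "h = horizon D / n"
  have h: "h > 0" using n horizon_pos by (simp add: h_def)
  have Mh: "2 * (M * h) \<le> a / 2"
  proof -
    have "M * h \<le> (M + 1) * (a / (4 * (M + 1)))"
      using n(2) M h unfolding h_def by (intro mult_mono) auto
    also have "\<dots> = a / 4" using M by (simp add: field_simps)
    finally show ?thesis by simp
  qed
  define \<psi> where "\<psi> l \<tau> = max 0 (min 1 (1 - (\<tau> - real l * h) / h))" for l and \<tau> :: real
  have cut: "continuous_on (time D \<times> controls D) (\<lambda>z. \<psi> l (fst z) *\<^sub>R ?F z)" for l
    unfolding \<psi>_def using h by (intro continuous_intros F) auto
  obtain W where W: "openin (control_topology D) W" "\<alpha> \<in> W"
    "\<And>\<beta> l. \<beta> \<in> W \<Longrightarrow> l \<in> {..n} \<Longrightarrow>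
      norm ((\<integral>z. \<psi> l (fst z) *\<^sub>R ?F z \<partial>\<alpha>) - (\<integral>z. \<psi> l (fst z) *\<^sub>R ?F z \<partial>\<beta>)) < a / 2"
    by (rule control_neighbourhood[of "{..n}" "\<lambda>l z. \<psi> l (fst z) *\<^sub>R ?F z" \<alpha> "a / 2"]) (use cut \<alpha> a in auto)
  have WU: "W \<subseteq> control_measures D" using openin_subset[OF W(1)] by (simp add: topspace_control_topology)
  have approx: "norm ((strip_integral \<beta> {0..t} ?F) - (\<integral>z. \<psi> l (fst z) *\<^sub>R ?F z \<partial>\<beta>)) \<le> M * h"
    if \<beta>: "\<beta> \<in> control_measures D" and t: "t \<in> time D" and l: "l * h \<le> t" "t \<le> (real l + 1) * h" for \<beta> t and l :: nat
  proof -
    let ?A = "{l * h..(real l + 1) * h} \<inter> time D"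
    let ?H = "\<lambda>z. (indicator {0..t} (fst z) - \<psi> l (fst z)) *\<^sub>R ?F z"
    have \<psi>1: "\<psi> l \<tau> = 1" if "\<tau> \<le> l * h" for \<tau> using that h by (simp add: \<psi>_def min_def field_simps)
    have \<psi>0: "\<psi> l \<tau> = 0" if "\<tau> \<ge> (real l + 1) * h" for \<tau> using that h by (simp add: \<psi>_def max_def field_simps)
    have "(strip_integral \<beta> {0..t} ?F) - (\<integral>z. \<psi> l (fst z) *\<^sub>R ?F z \<partial>\<beta>)
        = (\<integral>z. indicator ({0..t} \<times> controls D) z *\<^sub>R ?F z - \<psi> l (fst z) *\<^sub>R ?F z \<partial>\<beta>)"
      unfolding set_lebesgue_integral_def
      using set_integrable_control[OF \<beta> F, of "{0..t}"] t integrable_control[OF \<beta> cut]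
      by (subst Bochner_Integration.integral_diff) (auto simp: set_integrable_def)
    also have "\<dots> = (strip_integral \<beta> ?A ?H)"
      unfolding set_lebesgue_integral_def
    proof (intro Bochner_Integration.integral_cong refl)
      fix z assume z: "z \<in> space \<beta>"
      then have z': "fst z \<in> time D" "snd z \<in> controls D" by (auto simp: space_control[OF \<beta>])
      consider "fst z < l * h" | "fst z \<in> {l * h..(real l + 1) * h}" | "fst z > (real l + 1) * h" by fastforce
      then show "indicator ({0..t} \<times> controls D) z *\<^sub>R ?F z - \<psi> l (fst z) *\<^sub>R ?F z
          = indicator (?A \<times> controls D) z *\<^sub>R ?H z"
      proof cases
        case 1
        then show ?thesis using z' \<psi>1[of "fst z"] l by (simp add: indicator_def mem_Times_iff)
      next
        case 2
        then show ?thesis using z' by (simp add: indicator_def mem_Times_iff scaleR_left_diff_distrib)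
      next
        case 3
        then show ?thesis using z' \<psi>0[of "fst z"] l by (simp add: indicator_def mem_Times_iff)
      qed
    qed
    also have "norm \<dots> \<le> M * measure lborel ?A"
    proof (rule control_integral_strip_bound[OF \<beta>])
      fix \<tau> u assume "\<tau> \<in> ?A" "u \<in> controls D"
      then have "norm (?F (\<tau>, u)) \<le> M" using M(2) by auto
      moreover have "\<bar>indicator {0..t} \<tau> - \<psi> l \<tau>\<bar> \<le> 1" by (auto simp: \<psi>_def indicator_def)
      ultimately have "\<bar>indicator {0..t} \<tau> - \<psi> l \<tau>\<bar> * norm (?F (\<tau>, u)) \<le> 1 * M"
        by (intro mult_mono) auto
      then show "norm (?H (\<tau>, u)) \<le> M" by simp
    qed auto
    also have "\<dots> \<le> M * h"
    proof (intro mult_left_mono M(1))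
      have "measure lborel ?A \<le> measure lborel {l * h..(real l + 1) * h}"
        by (intro measure_mono_fmeasurable) (auto intro: fmeasurable_compact)
      also have "\<dots> = h" using h by (simp add: algebra_simps)
      finally show "measure lborel ?A \<le> h" .
    qed
    finally show ?thesis .
  qed
  show thesis
  proof (rule that[OF W(1,2) WU])
    fix \<beta> t assume \<beta>W: "\<beta> \<in> W" and t: "t \<in> time D"
    then have \<beta>: "\<beta> \<in> control_measures D" using WU by auto
    have "norm (traj D \<nu> 0 y \<alpha> t - traj D \<nu> 0 y \<beta> t) \<le> 2 * a * growth t"
    proof (rule traj_perturbation[OF \<nu> \<alpha> \<beta> _ _ t])
      fix s assume s: "s \<in> time D"
      from n(3)[OF s] obtain l where l: "l \<le> n" "l * h \<le> s" "s \<le> (real l + 1) * h" by (auto simp: h_def)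
      let ?I = "\<lambda>\<beta>. strip_integral \<beta> {0..s} ?F" and ?J = "\<lambda>\<beta>. \<integral>z. \<psi> l (fst z) *\<^sub>R ?F z \<partial>\<beta>"
      have "norm (?I \<alpha> - ?J \<alpha>) \<le> M * h" by (rule approx[OF \<alpha> s l(2,3)])
      moreover have "norm (?I \<beta> - ?J \<beta>) \<le> M * h" by (rule approx[OF \<beta> s l(2,3)])
      moreover have "norm (?J \<alpha> - ?J \<beta>) \<le> a / 2" using W(3)[OF \<beta>W, of l] l by auto
      ultimately have "norm (?I \<alpha> - ?I \<beta>) \<le> M * h + M * h + a / 2" by (rule norm_diff_intermediate)
      then show "norm (?I \<alpha> - ?I \<beta>) \<le> a" using Mh by simp
    qed (use a in simp)
    also have "\<dots> \<le> 2 * a * growth (horizon D)"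
      using t a L_ge_1 by (intro mult_left_mono) auto
    also have "\<dots> = e" by (simp add: a_def)
    finally show "norm (traj D \<nu> 0 y \<alpha> t - traj D \<nu> 0 y \<beta> t) \<le> e" .
  qed
qed

lemma traj_measurable:
  assumes \<nu>: "\<nu> \<in> flows D" and t: "t \<in> time D"
  shows "(\<lambda>\<alpha>. traj D \<nu> 0 y \<alpha> t) \<in> borel_measurable (borel_of (control_topology D))"
proof (rule continuous_map_measurable_borel, rule continuous_map_by_neighbourhoods)
  fix \<alpha> and e :: real assume "\<alpha> \<in> topspace (control_topology D)" and e: "0 < e"
  then have \<alpha>: "\<alpha> \<in> control_measures D" by (simp add: topspace_control_topology)
  obtain W where W: "openin (control_topology D) W" "\<alpha> \<in> W"
    "\<And>\<beta> t. \<beta> \<in> W \<Longrightarrow> t \<in> time D \<Longrightarrow> norm (traj D \<nu> 0 y \<alpha> t - traj D \<nu> 0 y \<beta> t) \<le> e / 2"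
    by (rule traj_neighbourhood[OF \<nu> \<alpha>, of "e / 2" y]) (use e in auto)
  then show "\<exists>W. openin (control_topology D) W \<and> \<alpha> \<in> W \<and>
      (\<forall>\<beta>\<in>W. dist (traj D \<nu> 0 y \<alpha> t) (traj D \<nu> 0 y \<beta> t) < e)"
    using e t by (intro exI[of _ W]) (force simp: dist_norm)
qed

end

section \<open>Step controls\<close>

text \<open>Two integrals with the same cell masses and the same values \<open>R k\<close> are close to each other; so a control
  measure can be compared with a step control that spends the same time in each cell.\<close>

lemma integral_step_approximation:
  fixes f :: "'a \<Rightarrow> 'b::{banach, second_countable_topology}"
    and K :: nat
  assumes I: "I \<in> sets M" "emeasure M I \<noteq> \<infinity>" and Q: "\<And>k. k < K \<Longrightarrow> Q k \<in> sets M"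
    and disj: "\<And>k k' z. k < K \<Longrightarrow> k' < K \<Longrightarrow> z \<in> Q k \<Longrightarrow> z \<in> Q k' \<Longrightarrow> k = k'"
    and cover: "I \<subseteq> (\<Union>k<K. Q k)"
    and f: "set_integrable M I f"
    and R: "\<And>k z. k < K \<Longrightarrow> z \<in> I \<Longrightarrow> z \<in> Q k \<Longrightarrow> norm (f z - R k) \<le> e"
  shows "norm ((LINT z:I|M. f z) - (\<Sum>k<K. measure M (I \<inter> Q k) *\<^sub>R R k)) \<le> e * measure M I"
proof -
  define S where "S z = (\<Sum>k<K. indicator (Q k) z *\<^sub>R R k)" for z
  have S_eq: "S z = R k" if "k < K" "z \<in> Q k" for z k
  proof -
    have "S z = (\<Sum>k'<K. if k' = k then R k' else 0)"
      unfolding S_def using disj that by (intro sum.cong) (auto simp: indicator_def)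
    then show ?thesis using that by simp
  qed
  have fin: "emeasure M (I \<inter> Q k) < \<infinity>" if "k < K" for k
    using emeasure_mono[of "I \<inter> Q k" I M] I by (auto simp: less_top[symmetric] top_unique)
  have hb: "has_bochner_integral M (\<lambda>z. indicator I z *\<^sub>R S z) (\<Sum>k<K. measure M (I \<inter> Q k) *\<^sub>R R k)"
  proof -
    have "has_bochner_integral M (\<lambda>z. indicator (I \<inter> Q k) z *\<^sub>R R k) (measure M (I \<inter> Q k) *\<^sub>R R k)" if "k < K" for k
      using fin[OF that] I Q[OF that] by (intro has_bochner_integral_scaleR_left has_bochner_integral_real_indicator) auto
    then have "has_bochner_integral M (\<lambda>z. \<Sum>k<K. indicator (I \<inter> Q k) z *\<^sub>R R k) (\<Sum>k<K. measure M (I \<inter> Q k) *\<^sub>R R k)"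
      by (intro has_bochner_integral_sum) auto
    then show ?thesis by (simp only: S_def scaleR_sum_right indicator_inter_arith scaleR_scaleR)
  qed
  have S: "set_integrable M I S" and SI: "(LINT z:I|M. S z) = (\<Sum>k<K. measure M (I \<inter> Q k) *\<^sub>R R k)"
    unfolding set_integrable_def set_lebesgue_integral_def
    using hb by (auto simp: has_bochner_integral_iff)
  have "norm (LINT z:I|M. f z - S z) \<le> (LINT z:I|M. e)"
  proof (rule set_integral_norm_le)
    show "set_integrable M I (\<lambda>_. e)"
      unfolding set_integrable_def using I by (intro integrable_scaleR_left integrable_real_indicator) (auto simp: less_top)
    show "norm (f z - S z) \<le> e" if z: "z \<in> I" for z
    proof -
      obtain k where k: "k < K" "z \<in> Q k" using z cover by blast
      show ?thesis using R[OF k(1) z k(2)] by (simp only: S_eq[OF k])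
    qed
  qed
  also have "\<dots> = e * measure M I" using set_integral_const[OF I, of e] by simp
  finally show ?thesis using set_integral_diff(2)[OF f S] SI by simp
qed

text \<open>In the slot \<open>[l * h, (l + 1) * h)\<close> the step function takes the values 0, 1, 2, ... in this order, the
  value \<open>k\<close> on an interval of length \<open>a l k\<close>. Off the finite set of interval ends it is locally
  constant, and there the trajectory of the step control is differentiable.\<close>

lemma step_index_exists:
  fixes a :: "nat \<Rightarrow> nat \<Rightarrow> real" and h :: real
  assumes a: "\<And>l k. l < n \<Longrightarrow> k < K \<Longrightarrow> 0 \<le> a l k" and h: "0 < h"
    and sum: "\<And>l. l < n \<Longrightarrow> (\<Sum>k<K. a l k) = h"
  obtains \<kappa> :: "real \<Rightarrow> nat" and B where "finite B" "\<kappa> \<in> borel \<rightarrow>\<^sub>M count_space UNIV"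
    "\<And>t. t \<notin> B \<Longrightarrow> \<forall>\<^sub>F s in nhds t. \<kappa> s = \<kappa> t"
    "\<And>l t. l < n \<Longrightarrow> t \<in> {l * h..<(real l + 1) * h} \<Longrightarrow> \<kappa> t < K"
    "\<And>l k. l < n \<Longrightarrow> k < K \<Longrightarrow> measure lborel ({l * h..<(real l + 1) * h} \<inter> {t. \<kappa> t = k}) = a l k"
proof -
  define b where "b l k = l * h + (\<Sum>k'<k. a l k')" for l k
  define cell where "cell l k = {b l k..<b l (Suc k)}" for l k
  (* At most one summand is nonzero since the cells are disjoint. *)
  define \<kappa> where "\<kappa> t = (\<Sum>l<n. \<Sum>k<K. if t \<in> cell l k then k else 0)" for t
  define B where "B = (\<lambda>(l, k). b l k) ` ({..<n} \<times> {..K})"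
  have b_mono: "b l k \<le> b l k'" if "l < n" "k \<le> k'" "k' \<le> K" for l k k'
    unfolding b_def using that a by (intro add_left_mono sum_mono2) auto
  have b0: "b l 0 = l * h" for l by (simp add: b_def)
  have bK: "b l K = (real l + 1) * h" if "l < n" for l
    using sum[OF that] by (simp add: b_def algebra_simps)
  have in_slot: "l * h \<le> t" "t < (real l + 1) * h" if "l < n" "k < K" "t \<in> cell l k" for l k t
    using b_mono[of l 0 k] b_mono[of l "Suc k" K] b0 bK[of l] that by (auto simp: cell_def)
  have cell_unique: "l = l' \<and> k = k'"
    if "l < n" "k < K" "t \<in> cell l k" "l' < n" "k' < K" "t \<in> cell l' k'" for l k l' k' t
  proof -
    have "l * h < (real l' + 1) * h" "l' * h < (real l + 1) * h"
      using in_slot[OF that(1-3)] in_slot[OF that(4-6)] by linarith+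
    then have "real l < real l' + 1" "real l' < real l + 1"
      using h by (simp_all add: mult_less_cancel_right)
    then have l: "l = l'" by linarith
    have "\<not> k < k'" "\<not> k' < k"
      using b_mono[of l "Suc k" k'] b_mono[of l "Suc k'" k] that l by (auto simp: cell_def)
    with l show ?thesis by simp
  qed
  have \<kappa>_cell: "\<kappa> t = k" if "l < n" "k < K" "t \<in> cell l k" for l k t
  proof -
    have inner: "(\<Sum>k'<K. if t \<in> cell l' k' then k' else 0) = (if l' = l then k else 0)" if l': "l' < n" for l'
    proof -
      have "(if t \<in> cell l' k' then k' else 0) = (if k' = k then (if l' = l then k else 0) else 0)" if "k' < K" for k'
      proof (cases "t \<in> cell l' k'")
        case True
        have "l = l' \<and> k = k'"
          by (rule cell_unique[OF \<open>l < n\<close> \<open>k < K\<close> \<open>t \<in> cell l k\<close> l' that True])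
        then show ?thesis using True by simp
      next
        case False
        then have "\<not> (k' = k \<and> l' = l)" using \<open>t \<in> cell l k\<close> by blast
        then show ?thesis using False by simp
      qed
      then have "(\<Sum>k'<K. if t \<in> cell l' k' then k' else 0) = (\<Sum>k'<K. if k' = k then (if l' = l then k else 0) else 0)"
        by (intro sum.cong refl) (simp only: lessThan_iff)
      then show ?thesis using \<open>k < K\<close> by simp
    qed
    have "\<kappa> t = (\<Sum>l'<n. if l' = l then k else 0)"
      unfolding \<kappa>_def by (rule sum.cong[OF refl]) (simp only: lessThan_iff inner)
    then show ?thesis using that(1) by simp
  qed
  have cover: "\<exists>k<K. t \<in> cell l k" if "l < n" "t \<in> {l * h..<(real l + 1) * h}" for l t
  proof -
    have "t < b l m \<Longrightarrow> \<exists>k<m. t \<in> cell l k" for m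
    proof (induction m)
      case 0
      then show ?case using that b0 by simp
    next
      case (Suc m)
      then show ?case by (cases "t < b l m") (auto simp: cell_def less_Suc_eq)
    qed
    then show ?thesis using that bK by simp
  qed
  have slot_eq: "{l * h..<(real l + 1) * h} \<inter> {t. \<kappa> t = k} = cell l k" if "l < n" "k < K" for l k
  proof (intro set_eqI iffI)
    fix t assume t: "t \<in> {l * h..<(real l + 1) * h} \<inter> {t. \<kappa> t = k}"
    obtain k' where k': "k' < K" "t \<in> cell l k'" using cover[OF \<open>l < n\<close>] t by blast
    have "\<kappa> t = k'" by (rule \<kappa>_cell[OF that(1) k'])
    then show "t \<in> cell l k" using t k' by simp
  next
    fix t assume t: "t \<in> cell l k"
    show "t \<in> {l * h..<(real l + 1) * h} \<inter> {t. \<kappa> t = k}"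
      using in_slot[OF that t] \<kappa>_cell[OF that t] by simp
  qed
  show thesis
  proof (rule that)
    show "finite B" by (simp add: B_def)
    have real: "(\<lambda>t. real (\<kappa> t)) \<in> borel_measurable borel"
    proof -
      have "(\<lambda>t. real (\<kappa> t)) = (\<lambda>t. \<Sum>l<n. \<Sum>k<K. real k * indicator (cell l k) t)"
        unfolding \<kappa>_def of_nat_sum by (intro ext sum.cong refl) (simp add: indicator_def)
      moreover have "cell l k \<in> sets borel" for l k by (simp add: cell_def)
      ultimately show ?thesis
        by (simp only:) (intro borel_measurable_sum borel_measurable_times borel_measurable_const borel_measurable_indicator)
    qed
    have "\<kappa> -` {k} \<in> sets borel" for k
    proof -
      have "\<kappa> -` {k} = (\<lambda>t. real (\<kappa> t)) -` {real k} \<inter> space borel" by auto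
      also have "\<dots> \<in> sets borel" by (rule measurable_sets[OF real]) simp
      finally show ?thesis .
    qed
    then show "\<kappa> \<in> borel \<rightarrow>\<^sub>M count_space UNIV"
      by (auto simp: measurable_count_space_eq2_countable)
    show "\<forall>\<^sub>F s in nhds t. \<kappa> s = \<kappa> t" if t: "t \<notin> B" for t
    proof -
      have "\<forall>\<^sub>F s in nhds t. \<forall>p\<in>{..<n} \<times> {..K}. (b (fst p) (snd p) \<le> s) = (b (fst p) (snd p) \<le> t)"
      proof (intro eventually_ball_finite ballI)
        fix p assume "p \<in> {..<n} \<times> {..K}"
        then have "b (fst p) (snd p) \<noteq> t" using t by (auto simp: B_def)
        then consider "b (fst p) (snd p) < t" | "t < b (fst p) (snd p)" by linarith
        then show "\<forall>\<^sub>F s in nhds t. (b (fst p) (snd p) \<le> s) = (b (fst p) (snd p) \<le> t)"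
        proof cases
          case 1
          then show ?thesis
            by (intro eventually_mono[OF eventually_nhds_in_open[of "{b (fst p) (snd p)<..}" t]]) auto
        next
          case 2
          then show ?thesis
            by (intro eventually_mono[OF eventually_nhds_in_open[of "{..<b (fst p) (snd p)}" t]]) auto
        qed
      qed auto
      then show ?thesis
      proof (rule eventually_mono)
        fix s assume s: "\<forall>p\<in>{..<n} \<times> {..K}. (b (fst p) (snd p) \<le> s) = (b (fst p) (snd p) \<le> t)"
        have "s \<in> cell l k \<longleftrightarrow> t \<in> cell l k" if "l < n" "k < K" for l k
          using bspec[OF s, of "(l, k)"] bspec[OF s, of "(l, Suc k)"] that
          by (auto simp: cell_def not_le[symmetric])
        then show "\<kappa> s = \<kappa> t" unfolding \<kappa>_def by (intro sum.cong refl) auto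
      qed
    qed
    show "\<kappa> t < K" if t: "l < n" "t \<in> {l * h..<(real l + 1) * h}" for l t
    proof -
      obtain k where k: "k < K" "t \<in> cell l k" using cover[OF t] by blast
      show ?thesis using \<kappa>_cell[OF t(1) k] k(1) by simp
    qed
    show "measure lborel ({l * h..<(real l + 1) * h} \<inter> {t. \<kappa> t = k}) = a l k" if "l < n" "k < K" for l k
      using slot_eq[OF that] b_mono[of l k "Suc k"] that by (simp add: cell_def b_def)
  qed
qed

context mean_field_game
begin

text \<open>The image of Lebesgue measure under the graph of \<open>u\<close> is the control measure of the ordinary
  control \<open>u\<close>.\<close>

definition ordinary_control :: "(real \<Rightarrow> 'p) \<Rightarrow> (real \<times> 'p) measure" where
  "ordinary_control u = distr (restrict_space lborel (time D)) (restrict_space borel (time D \<times> controls D)) (\<lambda>t. (t, u t))"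

context
  fixes \<kappa> :: "real \<Rightarrow> nat" and c :: "nat \<Rightarrow> 'p" and B :: "real set"
  assumes \<kappa>[measurable]: "\<kappa> \<in> borel \<rightarrow>\<^sub>M count_space UNIV" and c: "\<And>k. c k \<in> controls D"
    and B: "finite B" and locally_constant: "\<And>t. t \<notin> B \<Longrightarrow> \<forall>\<^sub>F s in nhds t. \<kappa> s = \<kappa> t"
begin

text \<open>The Borel sets of \<open>real \<times> 'p\<close> can exceed the product of the Borel sets, so measurability of the graph is
  obtained from the countable range of \<open>\<kappa>\<close>.\<close>

lemma step_graph_measurable:
  "(\<lambda>t. (t, c (\<kappa> t))) \<in> restrict_space lborel (time D) \<rightarrow>\<^sub>M restrict_space borel (time D \<times> controls D)"
proof (rule measurable_compose_countable)
  show "\<kappa> \<in> restrict_space lborel (time D) \<rightarrow>\<^sub>M count_space UNIV"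
    by (rule measurable_restrict_space1) simp
  fix k
  have "(\<lambda>t. (t, c k)) \<in> borel_measurable borel"
    by (intro borel_measurable_continuous_onI continuous_intros)
  then have "(\<lambda>t. (t, c k)) \<in> borel_measurable (restrict_space lborel (time D))"
    by (intro measurable_restrict_space1) simp
  then show "(\<lambda>t. (t, c k)) \<in> restrict_space lborel (time D) \<rightarrow>\<^sub>M restrict_space borel (time D \<times> controls D)"
    using c by (intro measurable_restrict_space2) (auto simp: space_restrict_space)
qed

lemma step_control: "ordinary_control (\<lambda>t. c (\<kappa> t)) \<in> control_measures D"
proof -
  have fst: "fst \<in> restrict_space borel (time D \<times> controls D) \<rightarrow>\<^sub>M restrict_space borel (time D)"
  proof (rule measurable_restrict_space2)
    have "(fst :: real \<times> 'p \<Rightarrow> real) \<in> borel_measurable borel"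
      by (intro borel_measurable_continuous_onI continuous_intros)
    then show "(fst :: real \<times> 'p \<Rightarrow> real) \<in> borel_measurable (restrict_space borel (time D \<times> controls D))"
      by (rule measurable_restrict_space1)
  qed (auto simp: space_restrict_space)
  have "distr (ordinary_control (\<lambda>t. c (\<kappa> t))) (restrict_space borel (time D)) fst
      = distr (restrict_space lborel (time D)) (restrict_space borel (time D)) (\<lambda>t. t)"
    unfolding ordinary_control_def by (subst distr_distr[OF fst step_graph_measurable]) (simp add: o_def)
  also have "\<dots> = restrict_space lborel (time D)"
    by (rule distr_id2) (simp add: sets_restrict_space)
  finally show ?thesis by (simp add: control_measures_def ordinary_control_def)
qed

lemma
  fixes F :: "real \<times> 'p \<Rightarrow> 'b::{banach, second_countable_topology}"
  assumes F: "continuous_on (time D \<times> controls D) F" and A: "A \<in> sets borel" "A \<subseteq> time D"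
  shows step_control_integral:
      "(strip_integral (ordinary_control (\<lambda>t. c (\<kappa> t))) A F) = (LINT t:A|lborel. F (t, c (\<kappa> t)))"
    and step_control_integrable: "set_integrable lborel A (\<lambda>t. F (t, c (\<kappa> t)))"
proof -
  let ?\<beta> = "ordinary_control (\<lambda>t. c (\<kappa> t))"
  let ?H = "\<lambda>z. indicator (A \<times> controls D) z *\<^sub>R F z"
  have H: "?H \<in> borel_measurable (restrict_space borel (time D \<times> controls D))"
  proof -
    have "integrable ?\<beta> ?H"
      using set_integrable_control[OF step_control F A] by (simp add: set_integrable_def)
    then have "?H \<in> borel_measurable ?\<beta>" by simp
    then show ?thesis by (simp add: measurable_cong_sets[OF sets_control[OF step_control] refl])
  qed
  have eq: "indicator (time D) t *\<^sub>R ?H (t, c (\<kappa> t)) = indicator A t *\<^sub>R F (t, c (\<kappa> t))" for t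
    using A c by (auto simp: indicator_def)
  have "(strip_integral ?\<beta> A F) = (\<integral>t. ?H (t, c (\<kappa> t)) \<partial>restrict_space lborel (time D))"
    unfolding set_lebesgue_integral_def ordinary_control_def by (rule integral_distr[OF step_graph_measurable H])
  also have "\<dots> = (LINT t:A|lborel. F (t, c (\<kappa> t)))"
    unfolding set_lebesgue_integral_def by (subst integral_restrict_space) (simp_all only: eq, simp_all)
  finally show "(strip_integral ?\<beta> A F) = (LINT t:A|lborel. F (t, c (\<kappa> t)))" .
  have "integrable ?\<beta> ?H" using set_integrable_control[OF step_control F A] by (simp add: set_integrable_def)
  then have "integrable (restrict_space lborel (time D)) (\<lambda>t. ?H (t, c (\<kappa> t)))"
    unfolding ordinary_control_def by (simp only: integrable_distr_eq[OF step_graph_measurable H])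
  then show "set_integrable lborel A (\<lambda>t. F (t, c (\<kappa> t)))"
    unfolding set_integrable_def by (subst (asm) integrable_restrict_space) (simp_all only: eq, simp_all)
qed

text \<open>The trajectory of a step control is a solution in the classical sense: it is Lipschitz, since the drift
  along it is bounded, and it has the right derivative wherever \<open>\<kappa>\<close> is locally constant.\<close>

lemma step_traj_in_G:
  assumes \<nu>: "\<nu> \<in> flows D" and y: "y \<in> initial_set D" and t: "t \<in> time D"
  shows "traj D \<nu> 0 y (ordinary_control (\<lambda>t. c (\<kappa> t))) t \<in> G"
proof -
  let ?\<beta> = "ordinary_control (\<lambda>t. c (\<kappa> t))"
  let ?x = "traj D \<nu> 0 y ?\<beta>"
  let ?F = "along (dynam D) \<nu> ?x" and ?\<Phi> = "\<lambda>t. along (dynam D) \<nu> ?x (t, c (\<kappa> t))"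
  have F: "continuous_on (time D \<times> controls D) ?F"
    by (intro continuous_on_along_traj continuous_dynam \<nu> step_control)
  obtain M where M: "0 \<le> M" "\<And>z. z \<in> time D \<times> controls D \<Longrightarrow> norm (?F z) \<le> M"
    by (rule continuous_on_compact_bound[OF compact_Times[OF compact_Icc compact_controls] F]) blast
  have \<Phi>: "?\<Phi> integrable_on time D"
    using set_borel_integral_eq_integral(1)[OF step_control_integrable[OF F]] by simp
  have x: "?x t = y + integral {0..t} ?\<Phi>" if "t \<in> time D" for t
  proof -
    have t: "{0..t} \<in> sets borel" "{0..t} \<subseteq> time D" using that by auto
    show ?thesis
      using traj_eq[OF \<nu> step_control that, of y] step_control_integral[OF F t]
        set_borel_integral_eq_integral(2)[OF step_control_integrable[OF F t]] by simp
  qed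
  have "controlled_solution D \<nu> (\<lambda>t. c (\<kappa> t)) ?x"
    unfolding controlled_solution_def
  proof
    have lip: "dist (?x s) (?x t) \<le> M * (t - s)" if "0 \<le> s" "s \<le> t" "t \<le> horizon D" for s t
      using control_integral_increment[OF step_control F _ _ M(2), of s t] that
        traj_eq[OF \<nu> step_control, of s y] traj_eq[OF \<nu> step_control, of t y]
      by (simp add: dist_norm norm_minus_commute)
    show "abs_cont_on 0 (horizon D) ?x"
      unfolding abs_cont_on_def
    proof (intro allI impI)
      fix e :: real assume e: "0 < e"
      show "\<exists>d>0. \<forall>(n::nat) s t. (\<forall>i<n. 0 \<le> s i \<and> s i \<le> t i \<and> t i \<le> horizon D) \<and>
          (\<forall>i<n. \<forall>k<n. i \<noteq> k \<longrightarrow> {s i<..<t i} \<inter> {s k<..<t k} = {}) \<and>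
          (\<Sum>i<n. t i - s i) < d \<longrightarrow> (\<Sum>i<n. dist (?x (s i)) (?x (t i))) < e"
      proof (intro exI[of _ "e / (M + 1)"] conjI allI impI)
        show "0 < e / (M + 1)" using e M by simp
        fix n :: nat and s t :: "nat \<Rightarrow> real"
        assume A: "(\<forall>i<n. 0 \<le> s i \<and> s i \<le> t i \<and> t i \<le> horizon D) \<and>
          (\<forall>i<n. \<forall>k<n. i \<noteq> k \<longrightarrow> {s i<..<t i} \<inter> {s k<..<t k} = {}) \<and>
          (\<Sum>i<n. t i - s i) < e / (M + 1)"
        have "(\<Sum>i<n. dist (?x (s i)) (?x (t i))) \<le> (\<Sum>i<n. M * (t i - s i))"
          using A by (intro sum_mono lip) auto
        also have "\<dots> \<le> (M + 1) * (\<Sum>i<n. t i - s i)"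
        proof -
          have "0 \<le> (\<Sum>i<n. t i - s i)" using A by (intro sum_nonneg) auto
          then show ?thesis by (simp add: sum_distrib_left[symmetric] mult_right_mono)
        qed
        also have "\<dots> < (M + 1) * (e / (M + 1))"
          using A M by (intro mult_strict_left_mono) auto
        also have "\<dots> = e" using M by simp
        finally show "(\<Sum>i<n. dist (?x (s i)) (?x (t i))) < e" .
      qed
    qed
    have deriv: "(?x has_vector_derivative dynam D t (?x t) (\<nu> t) (c (\<kappa> t))) (at t within time D)"
      if t: "t \<in> time D" "t \<notin> B" for t
    proof -
      have "continuous (at t within time D) ?\<Phi>"
      proof -
        have "continuous_on (time D) (\<lambda>s. ?F (s, c (\<kappa> t)))"
          using c by (intro continuous_on_compose2[OF F]) (auto intro!: continuous_intros)
        then have "((\<lambda>s. ?F (s, c (\<kappa> t))) \<longlongrightarrow> ?F (t, c (\<kappa> t))) (at t within time D)"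
          using t by (auto simp: continuous_on)
        moreover have "\<forall>\<^sub>F s in at t within time D. ?F (s, c (\<kappa> t)) = ?\<Phi> s"
          using locally_constant[OF t(2)] by (auto simp: eventually_at_filter elim: eventually_mono)
        ultimately show ?thesis
          unfolding continuous_within by (rule Lim_transform_eventually)
      qed
      then have "((\<lambda>s. integral {0..s} ?\<Phi>) has_vector_derivative ?\<Phi> t) (at t within time D)"
        using integral_has_vector_derivative_continuous_at[OF \<Phi>, of t "{}"] t by simp
      then have "((\<lambda>s. y + integral {0..s} ?\<Phi>) has_vector_derivative ?\<Phi> t) (at t within time D)"
        by (auto intro!: derivative_eq_intros)
      then have "(?x has_vector_derivative ?\<Phi> t) (at t within time D)"
        by (rule has_vector_derivative_transform[OF t(1), rotated]) (use x in auto)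
      then show ?thesis by (simp add: along_def)
    qed
    have "AE t in lebesgue. t \<notin> B"
      using finite_imp_null_set_lborel[OF B] by (intro AE_completion AE_not_in)
    then have "AE t in lebesgue_on (time D). t \<notin> B"
      by (subst AE_restrict_space_iff) auto
    then show "AE t in lebesgue_on (time D).
        (?x has_vector_derivative dynam D t (?x t) (\<nu> t) (c (\<kappa> t))) (at t within time D)"
      using AE_space by eventually_elim (auto simp: space_restrict_space intro: deriv)
  qed
  moreover have "(\<lambda>t. c (\<kappa> t)) \<in> lebesgue_on (time D) \<rightarrow>\<^sub>M restrict_space borel (controls D)"
  proof (intro measurable_restrict_space2 measurable_restrict_space1)
    have "(\<lambda>t. c (\<kappa> t)) \<in> borel \<rightarrow>\<^sub>M borel" by (rule measurable_compose[OF \<kappa>]) simp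
    then show "(\<lambda>t. c (\<kappa> t)) \<in> lebesgue \<rightarrow>\<^sub>M borel" by (simp add: measurable_completion)
  qed (use c in auto)
  moreover have "?x 0 = y" using x[of 0] horizon_pos by simp
  ultimately show ?thesis using ordinary_in_G[OF \<nu>, of "\<lambda>t. c (\<kappa> t)" ?x t] y t by simp
qed

end

section \<open>Chattering\<close>

text \<open>The control set is cut into finitely many cells of small diameter with representatives \<open>c k\<close>, and time
  into short slots. In every slot the step control rests at \<open>c k\<close> for exactly the time that \<open>\<alpha>\<close> gives to
  the \<open>k\<close>-th cell. As \<open>F\<close> is uniformly continuous, on each slot both integrals are close to the same
  sum, and the errors add up to a multiple of the horizon.\<close>

lemma chattering:
  fixes F :: "real \<times> 'p \<Rightarrow> 'x"
  assumes F: "continuous_on (time D \<times> controls D) F" and \<alpha>: "\<alpha> \<in> control_measures D" and e: "0 < e"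
  obtains \<kappa> :: "real \<Rightarrow> nat" and c B where "\<kappa> \<in> borel \<rightarrow>\<^sub>M count_space UNIV" "\<And>k. c k \<in> controls D" "finite B"
    "\<And>t. t \<notin> B \<Longrightarrow> \<forall>\<^sub>F s in nhds t. \<kappa> s = \<kappa> t"
    "\<And>t. t \<in> time D \<Longrightarrow> norm ((strip_integral \<alpha> {0..t} F) -
       (strip_integral (ordinary_control (\<lambda>t. c (\<kappa> t))) {0..t} F)) \<le> e"
proof -
  interpret \<alpha>: finite_measure \<alpha> by (rule finite_measure_control[OF \<alpha>])
  have comp: "compact (time D \<times> controls D)" by (intro compact_Times compact_controls) simp
  obtain M where M: "0 \<le> M" "\<And>z. z \<in> time D \<times> controls D \<Longrightarrow> norm (F z) \<le> M"
    by (rule continuous_on_compact_bound[OF comp F]) blast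
  (* Each slot costs 2 * e1 * h, hence e / 2 in total; the incomplete last slot costs 2 * M * h. *)
  define e1 where "e1 = e / (4 * horizon D)"
  have e1: "0 < e1" using e horizon_pos by (simp add: e1_def)
  obtain d where d: "0 < d" "\<And>z z'. z \<in> time D \<times> controls D \<Longrightarrow> z' \<in> time D \<times> controls D \<Longrightarrow>
      dist z' z < d \<Longrightarrow> dist (F z') (F z) < e1"
    using uniformly_continuous_onE[OF compact_uniformly_continuous[OF F comp] e1] by metis
  obtain n :: nat where n: "0 < n" "horizon D / n < min (d / 2) (e / (4 * (M + 1)))"
    "\<And>t. t \<in> time D \<Longrightarrow> \<exists>l\<le>n. l * (horizon D / n) \<le> t \<and> t \<le> (l + 1) * (horizon D / n)"
    by (rule grid_exists[of "min (d / 2) (e / (4 * (M + 1)))"]) (use e d M in auto)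
  define h where "h = horizon D / n"
  have h: "0 < h" "h < d / 2" "h < e / (4 * (M + 1))" and nh: "n * h = horizon D"
    using n horizon_pos by (auto simp: h_def)
  have Mh: "M * h \<le> e / 4"
  proof -
    have "M * h \<le> (M + 1) * (e / (4 * (M + 1)))" using h M by (intro mult_mono) auto
    also have "\<dots> = e / 4" using M by (simp add: field_simps)
    finally show ?thesis .
  qed
  obtain C where C: "finite C" "C \<subseteq> controls D" "controls D \<subseteq> (\<Union>u\<in>C. ball u (d / 2))"
  proof (rule compactE_image[OF compact_controls, of "controls D" "\<lambda>u. ball u (d / 2)"])
    show "controls D \<subseteq> (\<Union>u\<in>controls D. ball u (d / 2))" using d(1) by auto
  qed auto
  obtain K :: nat and c0 where c0: "C = c0 ` {i. i < K}"
    using finite_imp_nat_seg_image_inj_on[OF C(1)] by metis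
  obtain u0 where u0: "u0 \<in> controls D" using controls_nonempty by auto
  define c where "c k = (if k < K then c0 k else u0)" for k
  have cP: "c k \<in> controls D" for k using C c0 u0 by (auto simp: c_def)
  have c_cover: "\<exists>k<K. dist u (c k) < d / 2" if "u \<in> controls D" for u
    using C(3) c0 that by (auto simp: c_def dist_commute subset_eq)
  define Q where "Q k = {z \<in> space \<alpha>. dist (snd z) (c k) < d / 2 \<and> (\<forall>k'<k. \<not> dist (snd z) (c k') < d / 2)}" for k
  have Q_sets: "Q k \<in> sets \<alpha>" for k
  proof -
    have [measurable]: "(\<lambda>z. dist (snd z) (c k)) \<in> borel_measurable \<alpha>" for k
    proof -
      have "(\<lambda>z :: real \<times> 'p. dist (snd z) (c k)) \<in> borel_measurable borel"
        by (intro borel_measurable_continuous_onI continuous_intros)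
      then show ?thesis
        by (simp add: measurable_cong_sets[OF sets_control[OF \<alpha>] refl] measurable_restrict_space1)
    qed
    show ?thesis unfolding Q_def by measurable
  qed
  have Q_disj: "k = k'" if "z \<in> Q k" "z \<in> Q k'" for z k k'
    using that by (cases k k' rule: linorder_cases) (auto simp: Q_def)
  have Q_cover: "\<exists>k<K. z \<in> Q k" if "z \<in> space \<alpha>" for z
  proof -
    have "snd z \<in> controls D" using that by (auto simp: space_control[OF \<alpha>])
    then obtain k where "k < K" "dist (snd z) (c k) < d / 2"
      using c_cover by blast
    then have "(LEAST k. dist (snd z) (c k) < d / 2) < K" "dist (snd z) (c (LEAST k. dist (snd z) (c k) < d / 2)) < d / 2"
      by (auto intro: LeastI Least_le le_less_trans)
    then show ?thesis using that not_less_Least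
      by (intro exI[of _ "LEAST k. dist (snd z) (c k) < d / 2"]) (auto simp: Q_def)
  qed
  have lh0: "0 \<le> real l * h" for l using h by simp
  define slot where "slot l = {l * h..<(real l + 1) * h}" for l :: nat
  have slot: "slot l \<in> sets borel" "slot l \<subseteq> time D" "measure lborel (slot l) = h" "emeasure lborel (slot l) \<noteq> \<infinity>"
    if "l < n" for l
  proof -
    have "(real l + 1) * h \<le> n * h" using that h by (intro mult_right_mono) auto
    then show "slot l \<subseteq> time D" unfolding slot_def using nh lh0[of l] by auto
    show "measure lborel (slot l) = h" using h by (simp add: slot_def algebra_simps)
    have "real l * h \<le> (real l + 1) * h" using h by (simp add: algebra_simps)
    then show "emeasure lborel (slot l) \<noteq> \<infinity>" by (simp add: slot_def)
  qed (simp add: slot_def)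
  define a where "a l k = measure \<alpha> (slot l \<times> controls D \<inter> Q k)" for l k
  have strip: "measure \<alpha> (slot l \<times> controls D) = h" if "l < n" for l
  proof -
    have "measure \<alpha> (slot l \<times> controls D) = (LINT z:slot l \<times> controls D|\<alpha>. 1)"
      using control_strip_sets[OF \<alpha> slot(1,2)[OF that]]
      by (subst set_integral_const) (auto simp: \<alpha>.emeasure_eq_measure)
    also have "\<dots> = (LINT t:slot l|lborel. 1)"
      using control_integral_time[OF \<alpha> slot(1,2)[OF that], of "\<lambda>_. 1"] by simp
    also have "\<dots> = h" using slot[OF that] by (subst set_integral_const) auto
    finally show ?thesis .
  qed
  have strip_cover: "slot l \<times> controls D \<subseteq> (\<Union>k<K. Q k)" if "l < n" for l
  proof
    fix z assume "z \<in> slot l \<times> controls D"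
    then have "z \<in> space \<alpha>" using slot(2)[OF that] by (auto simp: space_control[OF \<alpha>])
    then show "z \<in> (\<Union>k<K. Q k)" using Q_cover by blast
  qed
  have a_sum: "(\<Sum>k<K. a l k) = h" if "l < n" for l
  proof -
    have "slot l \<times> controls D = (\<Union>k<K. slot l \<times> controls D \<inter> Q k)"
      using strip_cover[OF that] by blast
    then have "h = measure \<alpha> (\<Union>k<K. slot l \<times> controls D \<inter> Q k)" using strip[OF that] by simp
    also have "\<dots> = (\<Sum>k<K. measure \<alpha> (slot l \<times> controls D \<inter> Q k))"
      using control_strip_sets[OF \<alpha> slot(1,2)[OF that]] Q_sets Q_disj
      by (intro \<alpha>.finite_measure_finite_Union) (auto simp: disjoint_family_on_def)
    finally show ?thesis by (simp add: a_def)
  qed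
  obtain \<kappa> B where \<kappa>: "finite B" "\<kappa> \<in> borel \<rightarrow>\<^sub>M count_space UNIV"
    "\<And>t. t \<notin> B \<Longrightarrow> \<forall>\<^sub>F s in nhds t. \<kappa> s = \<kappa> t"
    "\<And>l t. l < n \<Longrightarrow> t \<in> slot l \<Longrightarrow> \<kappa> t < K"
    "\<And>l k. l < n \<Longrightarrow> k < K \<Longrightarrow> measure lborel (slot l \<inter> {t. \<kappa> t = k}) = a l k"
    unfolding slot_def
    by (rule step_index_exists[of n K a h]) (use a_sum h in \<open>auto simp: a_def\<close>)
  let ?\<beta> = "ordinary_control (\<lambda>t. c (\<kappa> t))"
  have \<beta>: "?\<beta> \<in> control_measures D" by (rule step_control[OF \<kappa>(2) cP \<kappa>(1,3)])
  have near: "norm (F (\<tau>, u) - F (l * h, c k)) \<le> e1"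
    if "l < n" "\<tau> \<in> slot l" "u \<in> controls D" "dist u (c k) < d / 2" for l \<tau> u k
  proof -
    have "dist (\<tau>, u) (real l * h, c k) \<le> dist \<tau> (l * h) + dist u (c k)"
      by (simp add: dist_prod_def sqrt_sum_squares_le_sum)
    also have "dist \<tau> (l * h) \<le> h" using that(2) by (auto simp: slot_def dist_real_def algebra_simps)
    finally have "dist (\<tau>, u) (real l * h, c k) < d" using that(4) h by linarith
    moreover have "real l * h \<in> time D" using slot(2)[OF that(1)] h by (auto simp: slot_def subset_eq)
    ultimately have "dist (F (\<tau>, u)) (F (l * h, c k)) < e1"
      using d(2) cP slot(2)[OF that(1)] that by auto
    then show ?thesis by (simp add: dist_norm)
  qed
  have slot_diff: "norm ((strip_integral \<alpha> (slot l) F) - (strip_integral ?\<beta> (slot l) F)) \<le> 2 * e1 * h"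
    if l: "l < n" for l
  proof -
    have "norm ((strip_integral \<alpha> (slot l) F) - (\<Sum>k<K. a l k *\<^sub>R F (l * h, c k)))
        \<le> e1 * measure \<alpha> (slot l \<times> controls D)"
      unfolding a_def
    proof (rule integral_step_approximation)
      show "slot l \<times> controls D \<subseteq> (\<Union>k<K. Q k)"
        by (rule strip_cover[OF l])
      show "norm (F z - F (l * h, c k)) \<le> e1" if "z \<in> slot l \<times> controls D" "z \<in> Q k" for k z
        using near[OF l, of "fst z" "snd z" k] that by (auto simp: Q_def)
    qed (use control_strip_sets[OF \<alpha> slot(1,2)[OF l]] Q_sets Q_disj set_integrable_control[OF \<alpha> F slot(1,2)[OF l]] in auto)
    moreover have "norm ((LINT t:slot l|lborel. F (t, c (\<kappa> t))) - (\<Sum>k<K. measure lborel (slot l \<inter> {t. \<kappa> t = k}) *\<^sub>R F (l * h, c k)))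
        \<le> e1 * measure lborel (slot l)"
    proof (rule integral_step_approximation)
      show "{t. \<kappa> t = k} \<in> sets lborel" for k
        using measurable_sets[OF \<kappa>(2), of "{k}"] by (simp add: vimage_def)
      show "slot l \<subseteq> (\<Union>k<K. {t. \<kappa> t = k})" using \<kappa>(4)[OF l] by auto
      show "set_integrable lborel (slot l) (\<lambda>t. F (t, c (\<kappa> t)))"
        by (rule step_control_integrable[OF \<kappa>(2) cP \<kappa>(1,3) F slot(1,2)[OF l]])
      show "norm (F (t, c (\<kappa> t)) - F (l * h, c k)) \<le> e1" if "t \<in> slot l" "t \<in> {t. \<kappa> t = k}" for k t
        using near[OF l, of t "c (\<kappa> t)" k] that cP d by auto
    qed (use slot[OF l] in auto)
    moreover have step_integral: "(strip_integral ?\<beta> (slot l) F) = (LINT t:slot l|lborel. F (t, c (\<kappa> t)))"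
      by (rule step_control_integral[OF \<kappa>(2) cP \<kappa>(1,3) F slot(1,2)[OF l]])
    ultimately have "norm ((strip_integral \<alpha> (slot l) F) - (\<Sum>k<K. a l k *\<^sub>R F (l * h, c k))) \<le> e1 * h"
      "norm ((strip_integral ?\<beta> (slot l) F) - (\<Sum>k<K. a l k *\<^sub>R F (l * h, c k))) \<le> e1 * h"
      using \<kappa>(5)[OF l] slot(3)[OF l] strip[OF l] by simp_all
    then have "norm ((strip_integral \<alpha> (slot l) F) - (strip_integral ?\<beta> (slot l) F)) \<le> e1 * h + e1 * h + 0"
      using strip[OF l] by (intro norm_diff_intermediate[where a' = "\<Sum>k<K. a l k *\<^sub>R F (l * h, c k)"
        and b' = "\<Sum>k<K. a l k *\<^sub>R F (l * h, c k)"]) auto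
    then show ?thesis by simp
  qed
  have Un: "(strip_integral \<theta> (S \<union> S') F) = (strip_integral \<theta> S F) + (strip_integral \<theta> S' F)"
    if "\<theta> \<in> control_measures D" "S \<in> sets borel" "S' \<in> sets borel" "S \<subseteq> time D" "S' \<subseteq> time D" "S \<inter> S' = {}" for \<theta> S S'
    using that set_integral_Un[of "S \<times> controls D" "S' \<times> controls D" \<theta> F]
    by (auto simp: Sigma_Un_distrib1 set_integrable_control[OF that(1) F])
  have grid_diff: "norm ((strip_integral \<alpha> {0..<l * h} F) - (strip_integral ?\<beta> {0..<l * h} F)) \<le> 2 * e1 * (l * h)"
    if "l \<le> n" for l
    using that
  proof (induction l)
    case (Suc l)
    then have l: "l < n" by simp
    have "real (Suc l) * h = (real l + 1) * h" "l * h \<le> (real l + 1) * h" using h by (simp_all add: algebra_simps)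
    then have eq: "{0..<Suc l * h} = {0..<l * h} \<union> slot l"
      unfolding slot_def using lh0[of l] ivl_disj_un_two(3)[of 0 "l * h" "(real l + 1) * h"] by (simp add: add.commute)
    have "real l * h \<le> n * h" using l h by (intro mult_right_mono) auto
    then have sub: "{0..<l * h} \<subseteq> time D" using nh by auto
    have "(strip_integral \<theta> {0..<Suc l * h} F) = (strip_integral \<theta> {0..<l * h} F) + (strip_integral \<theta> (slot l) F)"
      if "\<theta> \<in> control_measures D" for \<theta>
      unfolding eq using that sub slot[OF l] by (intro Un) (auto simp: slot_def)
    then have "(strip_integral \<alpha> {0..<Suc l * h} F) - (strip_integral ?\<beta> {0..<Suc l * h} F)
        = ((strip_integral \<alpha> {0..<l * h} F) - (strip_integral ?\<beta> {0..<l * h} F))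
        + ((strip_integral \<alpha> (slot l) F) - (strip_integral ?\<beta> (slot l) F))"
      using \<alpha> \<beta> by simp
    also have "norm \<dots> \<le> 2 * e1 * (l * h) + 2 * e1 * h"
      using Suc l slot_diff[OF l] by (intro order_trans[OF norm_triangle_ineq] add_mono) auto
    finally show ?case by (simp add: algebra_simps)
  qed (simp add: set_lebesgue_integral_def)
  show thesis
  proof (rule that[OF \<kappa>(2) cP \<kappa>(1,3)])
    fix t assume t: "t \<in> time D"
    from n(3)[OF t] obtain l where l: "l \<le> n" "l * h \<le> t" "t \<le> (real l + 1) * h" by (auto simp: h_def)
    have eq: "{0..t} = {0..<l * h} \<union> {l * h..t}" using l lh0[of l] by auto
    have sub: "{0..<l * h} \<subseteq> time D" "{l * h..t} \<subseteq> time D"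
      using t l lh0[of l] by auto
    have split: "(strip_integral \<theta> {0..t} F) - (strip_integral \<theta> {0..<l * h} F) = (strip_integral \<theta> {l * h..t} F)"
      if "\<theta> \<in> control_measures D" for \<theta>
    proof -
      have "{0..<l * h} \<inter> {l * h..t} = {}" by auto
      then show ?thesis unfolding eq using Un[OF that _ _ sub] by simp
    qed
    have rest: "norm (strip_integral \<theta> {l * h..t} F) \<le> M * h" if "\<theta> \<in> control_measures D" for \<theta>
    proof -
      have "norm (strip_integral \<theta> {l * h..t} F) \<le> M * measure lborel {l * h..t}"
        using sub M(2) by (intro control_integral_strip_bound[OF that]) auto
      also have "\<dots> \<le> M * h" using M(1) l by (intro mult_left_mono) (auto simp: algebra_simps)
      finally show ?thesis .
    qed
    have "2 * e1 * (l * h) \<le> 2 * e1 * (n * h)"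
      using l h e1 by (intro mult_left_mono mult_right_mono) auto
    also have "\<dots> = e / 2" using nh horizon_pos by (simp add: e1_def)
    finally have "2 * e1 * (l * h) \<le> e / 2" .
    then have "norm ((strip_integral \<alpha> {0..<l * h} F) - (strip_integral ?\<beta> {0..<l * h} F)) \<le> e / 2"
      using grid_diff[OF l(1)] by linarith
    then have "norm ((strip_integral \<alpha> {0..t} F) - (strip_integral ?\<beta> {0..t} F)) \<le> M * h + M * h + e / 2"
      using rest[OF \<alpha>] rest[OF \<beta>] by (intro norm_diff_intermediate) (auto simp: split[OF \<alpha>] split[OF \<beta>])
    then show "norm ((strip_integral \<alpha> {0..t} F) - (strip_integral ?\<beta> {0..t} F)) \<le> e"
      using Mh by linarith
  qed
qed

lemma traj_in_G:
  assumes \<nu>: "\<nu> \<in> flows D" and \<alpha>: "\<alpha> \<in> control_measures D" and y: "y \<in> initial_set D" and t: "t \<in> time D"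
  shows "traj D \<nu> 0 y \<alpha> t \<in> G"
proof -
  have "\<exists>g\<in>G. dist g (traj D \<nu> 0 y \<alpha> t) < e" if e: "0 < e" for e
  proof -
    define e1 where "e1 = e / (4 * growth t)"
    have e1: "0 < e1" using e by (simp add: e1_def)
    obtain \<kappa> :: "real \<Rightarrow> nat" and c B where \<kappa>: "\<kappa> \<in> borel \<rightarrow>\<^sub>M count_space UNIV" "\<And>k. c k \<in> controls D" "finite B"
      "\<And>t. t \<notin> B \<Longrightarrow> \<forall>\<^sub>F s in nhds t. \<kappa> s = \<kappa> t"
      "\<And>s. s \<in> time D \<Longrightarrow> norm ((strip_integral \<alpha> {0..s} (along (dynam D) \<nu> (traj D \<nu> 0 y \<alpha>))) -
         (strip_integral (ordinary_control (\<lambda>t. c (\<kappa> t))) {0..s} (along (dynam D) \<nu> (traj D \<nu> 0 y \<alpha>)))) \<le> e1"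
      using chattering[OF continuous_on_along_traj[OF continuous_dynam \<nu> \<alpha>] \<alpha> e1] by metis
    let ?\<beta> = "ordinary_control (\<lambda>t. c (\<kappa> t))"
    have "norm (traj D \<nu> 0 y \<alpha> t - traj D \<nu> 0 y ?\<beta> t) \<le> 2 * e1 * growth t"
      using e1 \<kappa>(5) by (intro traj_perturbation[OF \<nu> \<alpha> step_control[OF \<kappa>(1-4)] _ _ t]) auto
    also have "\<dots> < e" using e by (simp add: e1_def)
    finally have "dist (traj D \<nu> 0 y ?\<beta> t) (traj D \<nu> 0 y \<alpha> t) < e"
      by (simp add: dist_norm norm_minus_commute)
    moreover have "traj D \<nu> 0 y ?\<beta> t \<in> G" by (rule step_traj_in_G[OF \<kappa>(1-4) \<nu> y t])
    ultimately show ?thesis by blast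
  qed
  then have "traj D \<nu> 0 y \<alpha> t \<in> closure G" by (simp add: closure_approachable)
  then show ?thesis using compact_G by (simp add: compact_imp_closed)
qed

end

section \<open>Kantorovich distance of laws\<close>

lemma distr_prob_measures1:
  fixes X :: "'q \<Rightarrow> 'x::euclidean_space"
  assumes Q: "prob_space Q" and X: "X \<in> borel_measurable Q" and B: "\<And>q. q \<in> space Q \<Longrightarrow> norm (X q) \<le> B"
  shows "distr Q borel X \<in> prob_measures1"
proof -
  interpret prob_space Q by fact
  have "integrable Q (\<lambda>q. norm (X q))"
    by (rule integrable_const_bound[of _ B]) (use B X in auto)
  then show ?thesis
    using X by (auto simp: prob_measures1_def integrable_distr_eq intro: prob_space_distr)
qed

text \<open>The pair \<open>(X, Y)\<close> is a coupling of the two laws.\<close>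

lemma kantorovich_distr_le:
  fixes X Y :: "'q \<Rightarrow> 'x::euclidean_space"
  assumes Q: "prob_space Q" and X: "X \<in> borel_measurable Q" "Y \<in> borel_measurable Q"
    and B: "\<And>q. q \<in> space Q \<Longrightarrow> norm (X q) \<le> B" "\<And>q. q \<in> space Q \<Longrightarrow> norm (Y q) \<le> B"
    and c: "\<And>q. q \<in> space Q \<Longrightarrow> norm (X q - Y q) \<le> c"
  shows "kantorovich (distr Q borel X) (distr Q borel Y) \<le> c"
proof (rule kantorovich_least)
  interpret prob_space Q by fact
  fix \<phi> :: "'x \<Rightarrow> real" assume \<phi>: "1-lipschitz_on UNIV \<phi>"
  have \<phi>m: "\<phi> \<in> borel_measurable borel"
    using lipschitz_on_continuous_on[OF \<phi>] by (rule borel_measurable_continuous_onI)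
  have int: "integrable Q (\<lambda>q. \<phi> (X q))" "integrable Q (\<lambda>q. \<phi> (Y q))"
    using lipschitz_integrable[OF distr_prob_measures1[OF Q X(1) B(1)] \<phi>]
      lipschitz_integrable[OF distr_prob_measures1[OF Q X(2) B(2)] \<phi>]
    by (simp_all add: integrable_distr_eq[OF X(1) \<phi>m] integrable_distr_eq[OF X(2) \<phi>m])
  have "(\<integral>x. \<phi> x \<partial>distr Q borel X) - (\<integral>x. \<phi> x \<partial>distr Q borel Y) = (\<integral>q. \<phi> (X q) - \<phi> (Y q) \<partial>Q)"
    using int by (simp add: integral_distr[OF X(1) \<phi>m] integral_distr[OF X(2) \<phi>m])
  also have "\<dots> \<le> (\<integral>q. c \<partial>Q)"
  proof (rule integral_mono)
    show "\<phi> (X q) - \<phi> (Y q) \<le> c" if "q \<in> space Q" for q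
      using lipschitz_onD[OF \<phi>, of "X q" "Y q"] c[OF that] by (auto simp: dist_norm)
  qed (use int in auto)
  also have "\<dots> = c" by (simp add: prob_space)
  finally show "(\<integral>x. \<phi> x \<partial>distr Q borel X) - (\<integral>x. \<phi> x \<partial>distr Q borel Y) \<le> c" .
qed

text \<open>The Kantorovich distance tests with unbounded functions; truncation and dominated convergence reduce these
  to bounded ones.\<close>

lemma prob_measures1_eqI:
  fixes m m' :: "'x::euclidean_space measure"
  assumes m: "m \<in> prob_measures1" "m' \<in> prob_measures1"
    and eq: "\<And>\<phi> :: 'x \<Rightarrow> real. continuous_on UNIV \<phi> \<Longrightarrow> bounded (range \<phi>) \<Longrightarrow> (\<integral>x. \<phi> x \<partial>m) = (\<integral>x. \<phi> x \<partial>m')"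
  shows "m = m'"
proof (rule kantorovich_eq_0_imp_eq[OF m])
  have "kantorovich m m' \<le> 0"
  proof (rule kantorovich_least)
    fix \<phi> :: "'x \<Rightarrow> real" assume \<phi>: "1-lipschitz_on UNIV \<phi>"
    have cont: "continuous_on UNIV \<phi>" by (rule lipschitz_on_continuous_on[OF \<phi>])
    define \<psi> where "\<psi> k x = max (- real k) (min (real k) (\<phi> x))" for k x
    have \<psi>: "continuous_on UNIV (\<psi> k)" for k unfolding \<psi>_def by (intro continuous_intros cont)
    have bnd: "bounded (range (\<psi> k))" for k
      by (rule boundedI[of _ "real k"]) (auto simp: \<psi>_def)
    have lim: "(\<lambda>k. \<psi> k x) \<longlonglongrightarrow> \<phi> x" for x
    proof -
      obtain k0 :: nat where k0: "\<bar>\<phi> x\<bar> \<le> real k0" using real_arch_simple by blast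
      then have "\<psi> k x = \<phi> x" if "k \<ge> k0" for k
      proof -
        have "\<bar>\<phi> x\<bar> \<le> real k" using k0 that by linarith
        then show ?thesis by (auto simp: \<psi>_def)
      qed
      then show ?thesis by (intro tendsto_eventually eventually_sequentiallyI[of k0])
    qed
    have conv: "(\<lambda>k. \<integral>x. \<psi> k x \<partial>M) \<longlonglongrightarrow> (\<integral>x. \<phi> x \<partial>M)" if M: "M \<in> prob_measures1" for M
    proof (rule integral_dominated_convergence[where w = "\<lambda>x. \<bar>\<phi> x\<bar>"])
      have sets: "sets M = sets borel" using M by (simp add: prob_measures1_def)
      show "\<phi> \<in> borel_measurable M" "\<And>k. \<psi> k \<in> borel_measurable M"
        using cont \<psi> by (simp_all add: measurable_cong_sets[OF sets refl] borel_measurable_continuous_onI)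
      show "integrable M (\<lambda>x. \<bar>\<phi> x\<bar>)" using lipschitz_integrable[OF M \<phi>] by simp
    qed (use lim in \<open>auto simp: \<psi>_def\<close>)
    have "(\<lambda>k. \<integral>x. \<psi> k x \<partial>m) \<longlonglongrightarrow> (\<integral>x. \<phi> x \<partial>m')"
      using conv[OF m(2)] eq[OF \<psi> bnd] by simp
    from LIMSEQ_unique[OF conv[OF m(1)] this]
    show "(\<integral>x. \<phi> x \<partial>m) - (\<integral>x. \<phi> x \<partial>m') \<le> 0" by simp
  qed
  moreover have "0 \<le> kantorovich m m'"
    using kantorovich_upper[OF m, of "\<lambda>_. 0"] by (auto simp: lipschitz_on_def)
  ultimately show "kantorovich m m' = 0" by simp
qed

context mean_field_game
begin

section \<open>Well-posedness of the mean-field dynamics\<close>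

lemma flowI:
  assumes ext: "\<nu> \<in> extensional (time D)" and P1: "\<And>t. t \<in> time D \<Longrightarrow> \<nu> t \<in> prob_measures1"
    and cont: "\<And>e. 0 < e \<Longrightarrow> \<exists>d>0. \<forall>s\<in>time D. \<forall>t\<in>time D. \<bar>s - t\<bar> < d \<longrightarrow> kantorovich (\<nu> s) (\<nu> t) \<le> e"
  shows "\<nu> \<in> flows D"
proof -
  interpret M: Metric_space "mspace kantorovich_metric" "mdist kantorovich_metric :: 'x measure \<Rightarrow> _"
    by (rule Metric_space_mspace_mdist)
  have "continuous_map (top_of_set (time D)) M.mtopology \<nu>"
    unfolding M.continuous_map_to_metric
  proof (intro ballI allI impI)
    fix t e :: real assume "t \<in> topspace (top_of_set (time D))" and e: "0 < e"
    then have t: "t \<in> time D" by simp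
    obtain d where d: "0 < d" "\<forall>s\<in>time D. \<forall>t\<in>time D. \<bar>s - t\<bar> < d \<longrightarrow> kantorovich (\<nu> s) (\<nu> t) \<le> e / 2"
      using cont[of "e / 2"] e by auto
    show "\<exists>U. openin (top_of_set (time D)) U \<and> t \<in> U \<and> (\<forall>s\<in>U. \<nu> s \<in> M.mball (\<nu> t) e)"
    proof (intro exI[of _ "time D \<inter> ball t d"] conjI ballI)
      show "openin (top_of_set (time D)) (time D \<inter> ball t d)" by (rule openin_open_Int) simp
      fix s assume s: "s \<in> time D \<inter> ball t d"
      then have "kantorovich (\<nu> t) (\<nu> s) \<le> e / 2" using d(2) t by (auto simp: dist_real_def)
      then show "\<nu> s \<in> M.mball (\<nu> t) e"
        using e s t P1[of s] P1[of t] by (simp add: M.in_mball[unfolded mspace_kantorovich_metric] mdist_kantorovich_metric)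
    qed (use t d in auto)
  qed
  then show ?thesis using ext by (simp add: flows_def mtopology_of_def)
qed

lemma constant_flow: "(\<lambda>t\<in>time D. initial D) \<in> flows D"
  by (rule flowI) (use initial_P1 kantorovich_self[OF initial_P1] in \<open>auto intro!: exI[of _ 1]\<close>)

lemma G_bound: obtains B where "0 \<le> B" "\<And>x. x \<in> G \<Longrightarrow> norm x \<le> B"
  using compact_imp_bounded[OF compact_G] by (auto simp: bounded_pos intro: less_imp_le)

lemma traj_increment:
  assumes \<nu>: "\<nu> \<in> flows D"
  obtains M where "0 \<le> M" "\<And>y \<alpha> s t. y \<in> initial_set D \<Longrightarrow> \<alpha> \<in> control_measures D \<Longrightarrow> s \<in> time D \<Longrightarrow> t \<in> time D \<Longrightarrow>
    norm (traj D \<nu> 0 y \<alpha> s - traj D \<nu> 0 y \<alpha> t) \<le> M * \<bar>s - t\<bar>"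
proof -
  obtain M where M: "0 \<le> M" "\<And>t x u. t \<in> time D \<Longrightarrow> x \<in> G \<Longrightarrow> u \<in> controls D \<Longrightarrow> norm (dynam D t x (\<nu> t) u) \<le> M"
    by (rule bounded_along_flow[OF continuous_dynam \<nu> compact_G]) blast
  show thesis
  proof (rule that[OF M(1)])
    fix y \<alpha> s t assume y: "y \<in> initial_set D" and \<alpha>: "\<alpha> \<in> control_measures D" and st: "s \<in> time D" "t \<in> time D"
    let ?F = "along (dynam D) \<nu> (traj D \<nu> 0 y \<alpha>)"
    have "norm (?F z) \<le> M" if "z \<in> time D \<times> controls D" for z
      using that M(2) traj_in_G[OF \<nu> \<alpha> y] by (auto simp: along_def)
    then show "norm (traj D \<nu> 0 y \<alpha> s - traj D \<nu> 0 y \<alpha> t) \<le> M * \<bar>s - t\<bar>"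
      using control_integral_increment[OF \<alpha> continuous_on_along_traj[OF continuous_dynam \<nu> \<alpha>] st(2,1), of y M]
        traj_eq[OF \<nu> \<alpha> st(1), of y] traj_eq[OF \<nu> \<alpha> st(2), of y] by simp
  qed
qed

context
  fixes Q :: "'q measure" and \<xi> :: "'q \<Rightarrow> 'x" and A :: "'q \<Rightarrow> (real \<times> 'p) measure"
  assumes Q: "prob_space Q"
    and \<xi>: "\<And>q. q \<in> space Q \<Longrightarrow> \<xi> q \<in> initial_set D" and A: "\<And>q. q \<in> space Q \<Longrightarrow> A q \<in> control_measures D"
    and meas: "\<And>\<nu> t. \<nu> \<in> flows D \<Longrightarrow> t \<in> time D \<Longrightarrow> (\<lambda>q. traj D \<nu> 0 (\<xi> q) (A q) t) \<in> borel_measurable Q"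
begin

abbreviation mean_field_solution :: "(real \<Rightarrow> 'x measure) \<Rightarrow> bool" where
  "mean_field_solution \<nu> \<equiv> \<nu> \<in> flows D \<and> (\<forall>t\<in>time D. \<nu> t = distr Q borel (\<lambda>q. traj D \<nu> 0 (\<xi> q) (A q) t))"

text \<open>The fixed point is sought among families \<open>X (q, t)\<close> of curves in \<open>G\<close> rather than among flows: the law
  of a family moves by no more than the family does, uniformly in \<open>q\<close>, and completeness comes from
  that of the state space. Equicontinuity, uniform in \<open>q\<close>, is part of \<open>S\<close> so that the law is
  continuous in time.\<close>

lemma mean_field_solution_exists: "\<exists>\<nu>. mean_field_solution \<nu>"
proof -
  obtain B0 where B0: "0 \<le> B0" "\<And>x. x \<in> G \<Longrightarrow> norm x \<le> B0" by (rule G_bound) blast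
  define equi where "equi X \<longleftrightarrow> (\<forall>e>0. \<exists>d>0. \<forall>s\<in>time D. \<forall>t\<in>time D. \<bar>s - t\<bar> < d \<longrightarrow>
    (\<forall>q\<in>space Q. norm (X (q, s) - X (q, t)) \<le> e))" for X :: "'q \<times> real \<Rightarrow> 'x"
  define S where "S = {X :: 'q \<times> real \<Rightarrow> 'x. (\<forall>t\<in>time D. (\<lambda>q. X (q, t)) \<in> borel_measurable Q) \<and>
    (\<forall>q\<in>space Q. \<forall>t\<in>time D. X (q, t) \<in> G) \<and> equi X}"
  define law where "law X = (\<lambda>t\<in>time D. distr Q borel (\<lambda>q. X (q, t)))" for X :: "'q \<times> real \<Rightarrow> 'x"
  define sol where "sol \<nu> = (\<lambda>(q, t). traj D \<nu> 0 (\<xi> q) (A q) t)" for \<nu>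
  have law_dist: "kantorovich (law X t) (law X' t') \<le> c"
    if "X \<in> S" "X' \<in> S" "t \<in> time D" "t' \<in> time D" "\<And>q. q \<in> space Q \<Longrightarrow> norm (X (q, t) - X' (q, t')) \<le> c" for X X' t t' c
    using that B0 unfolding law_def by (simp, intro kantorovich_distr_le[OF Q, where B = B0]) (auto simp: S_def)
  have law: "law X \<in> flows D" if X: "X \<in> S" for X
  proof (rule flowI)
    show "law X t \<in> prob_measures1" if "t \<in> time D" for t
      using X B0 that unfolding law_def by (simp, intro distr_prob_measures1[OF Q, where B = B0]) (auto simp: S_def)
    fix e :: real assume "0 < e"
    then obtain d where "d > 0" "\<forall>s\<in>time D. \<forall>t\<in>time D. \<bar>s - t\<bar> < d \<longrightarrow> (\<forall>q\<in>space Q. norm (X (q, s) - X (q, t)) \<le> e)"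
      using X unfolding S_def equi_def by blast
    then show "\<exists>d>0. \<forall>s\<in>time D. \<forall>t\<in>time D. \<bar>s - t\<bar> < d \<longrightarrow> kantorovich (law X s) (law X t) \<le> e"
      using law_dist[OF X X] by blast
  qed (simp add: law_def)
  have sol: "sol \<nu> \<in> S" if \<nu>: "\<nu> \<in> flows D" for \<nu>
  proof -
    obtain M where M: "0 \<le> M" "\<And>y \<alpha> s t. y \<in> initial_set D \<Longrightarrow> \<alpha> \<in> control_measures D \<Longrightarrow> s \<in> time D \<Longrightarrow> t \<in> time D \<Longrightarrow>
        norm (traj D \<nu> 0 y \<alpha> s - traj D \<nu> 0 y \<alpha> t) \<le> M * \<bar>s - t\<bar>"
      by (rule traj_increment[OF \<nu>]) blast
    have "equi (sol \<nu>)"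
      unfolding equi_def
    proof (intro allI impI exI[of _ "e / (M + 1)" for e] conjI ballI)
      fix e :: real assume e: "0 < e"
      show "0 < e / (M + 1)" using e M by simp
      fix s t q assume st: "s \<in> time D" "t \<in> time D" "\<bar>s - t\<bar> < e / (M + 1)" and q: "q \<in> space Q"
      have "norm (sol \<nu> (q, s) - sol \<nu> (q, t)) \<le> M * \<bar>s - t\<bar>"
        using M(2)[OF \<xi>[OF q] A[OF q] st(1,2)] by (simp add: sol_def)
      also have "\<dots> \<le> (M + 1) * (e / (M + 1))" using st(3) M by (intro mult_mono) auto
      also have "\<dots> = e" using M by simp
      finally show "norm (sol \<nu> (q, s) - sol \<nu> (q, t)) \<le> e" .
    qed
    then show ?thesis using meas[OF \<nu>] traj_in_G[OF \<nu> A \<xi>] by (auto simp: S_def sol_def)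
  qed
  have "\<exists>X\<in>S. \<forall>k\<in>space Q \<times> time D. sol (law X) k = X k"
  proof (rule weighted_contraction_fixed_point[where S = S and K = "space Q \<times> time D" and \<Psi> = "\<lambda>X. sol (law X)"
      and w = "\<lambda>k. growth (snd k)" and B = "growth (horizon D)" and ?c0.0 = "2 * B0" and ?h0.0 = "sol (\<lambda>t\<in>time D. initial D)"])
    show "sol (\<lambda>t\<in>time D. initial D) \<in> S" by (rule sol[OF constant_flow])
    show "sol (law X) \<in> S" if "X \<in> S" for X by (rule sol[OF law[OF that]])
    show "1 \<le> growth (snd k)" "growth (snd k) \<le> growth (horizon D)" if "k \<in> space Q \<times> time D" for k
      using that L_ge_1 by auto
    show "norm (sol (law X) k - sol (law X') k) \<le> c / 2 * growth (snd k)"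
      if X: "X \<in> S" "X' \<in> S" and c: "0 \<le> c" "\<And>k. k \<in> space Q \<times> time D \<Longrightarrow> norm (X k - X' k) \<le> c * growth (snd k)"
        and k: "k \<in> space Q \<times> time D" for X X' c k
    proof -
      obtain q t where qt: "k = (q, t)" "q \<in> space Q" "t \<in> time D" using k by auto
      have "norm (traj D (law X) 0 (\<xi> q) (A q) t - traj D (law X') 0 (\<xi> q) (A q) t) \<le> (2 * norm (\<xi> q - \<xi> q) + c / 2) * growth t"
      proof (rule traj_stability[OF law[OF X(1)] law[OF X(2)] A[OF qt(2)] c(1) _ qt(3)])
        show "kantorovich (law X t) (law X' t) \<le> c * growth t" if "t \<in> time D" for t
          using c(2)[of "(q, t)" for q] that by (intro law_dist X) auto
      qed
      then show ?thesis by (simp add: sol_def qt)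
    qed
    show "norm (sol (law (sol (\<lambda>t\<in>time D. initial D))) k - sol (\<lambda>t\<in>time D. initial D) k) \<le> 2 * B0 * growth (snd k)"
      if k: "k \<in> space Q \<times> time D" for k
    proof -
      let ?X = "sol (\<lambda>t\<in>time D. initial D)"
      have "sol (law ?X) \<in> S" "?X \<in> S" using sol[OF constant_flow] sol[OF law[OF sol[OF constant_flow]]] by auto
      then have "norm (sol (law ?X) k) \<le> B0" "norm (?X k) \<le> B0" using k B0(2) by (auto simp: S_def)
      then have "norm (sol (law ?X) k - ?X k) \<le> 2 * B0" using norm_triangle_ineq4[of "sol (law ?X) k" "?X k"] by linarith
      also have "\<dots> = 2 * B0 * 1" by simp
      also have "\<dots> \<le> 2 * B0 * growth (snd k)" using k B0(1) L_ge_1 by (intro mult_left_mono) auto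
      finally show ?thesis .
    qed
    show "X \<in> S" if H: "\<And>n. H n \<in> S" and lim: "uniform_limit (space Q \<times> time D) H X sequentially" for H X
    proof -
      have lim': "(\<lambda>n. H n (q, t)) \<longlonglongrightarrow> X (q, t)" if "q \<in> space Q" "t \<in> time D" for q t
        using tendsto_uniform_limitI[OF lim, of "(q, t)"] that by simp
      have "(\<lambda>q. X (q, t)) \<in> borel_measurable Q" if t: "t \<in> time D" for t
        by (rule borel_measurable_LIMSEQ_metric[of "\<lambda>n q. H n (q, t)"]) (use H lim' t in \<open>auto simp: S_def\<close>)
      moreover have "X (q, t) \<in> G" if "q \<in> space Q" "t \<in> time D" for q t
        by (rule closed_sequentially[OF compact_imp_closed[OF compact_G] _ lim'[OF that]]) (use H that in \<open>auto simp: S_def\<close>)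
      moreover have "equi X"
        unfolding equi_def
      proof (intro allI impI)
        fix e :: real assume e: "0 < e"
        have "\<forall>\<^sub>F n in sequentially. \<forall>k\<in>space Q \<times> time D. dist (H n k) (X k) < e / 3"
          by (rule uniform_limitD[OF lim]) (use e in simp)
        then obtain n where n: "\<And>k. k \<in> space Q \<times> time D \<Longrightarrow> dist (H n k) (X k) < e / 3"
          using eventually_happens'[OF sequentially_bot] by blast
        obtain d where d: "d > 0" "\<And>s t q. s \<in> time D \<Longrightarrow> t \<in> time D \<Longrightarrow> \<bar>s - t\<bar> < d \<Longrightarrow> q \<in> space Q \<Longrightarrow> norm (H n (q, s) - H n (q, t)) \<le> e / 3"
        proof -
          have "0 < e / 3" "equi (H n)" using H[of n] e by (simp_all add: S_def)
          then show ?thesis unfolding equi_def using that by blast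
        qed
        show "\<exists>d>0. \<forall>s\<in>time D. \<forall>t\<in>time D. \<bar>s - t\<bar> < d \<longrightarrow> (\<forall>q\<in>space Q. norm (X (q, s) - X (q, t)) \<le> e)"
        proof (intro exI[of _ d] conjI ballI impI d(1))
          fix s t q assume st: "s \<in> time D" "t \<in> time D" "\<bar>s - t\<bar> < d" and q: "q \<in> space Q"
          have "norm (X (q, s) - X (q, t)) \<le> e / 3 + e / 3 + e / 3"
          proof (rule norm_diff_intermediate[OF _ _ d(2)[OF st q]])
            show "norm (X (q, s) - H n (q, s)) \<le> e / 3" "norm (X (q, t) - H n (q, t)) \<le> e / 3"
              using n[of "(q, s)"] n[of "(q, t)"] st q by (auto simp: dist_norm norm_minus_commute)
          qed
          then show "norm (X (q, s) - X (q, t)) \<le> e" by simp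
        qed
      qed
      ultimately show ?thesis by (auto simp: S_def)
    qed
  qed blast
  then obtain X where X: "X \<in> S" "\<And>k. k \<in> space Q \<times> time D \<Longrightarrow> sol (law X) k = X k" by blast
  have "law X t = distr Q borel (\<lambda>q. traj D (law X) 0 (\<xi> q) (A q) t)" if t: "t \<in> time D" for t
  proof -
    have "traj D (law X) 0 (\<xi> q) (A q) t = X (q, t)" if "q \<in> space Q" for q
      using X(2)[of "(q, t)"] that t by (simp add: sol_def)
    then have "distr Q borel (\<lambda>q. traj D (law X) 0 (\<xi> q) (A q) t) = distr Q borel (\<lambda>q. X (q, t))"
      by (intro distr_cong) auto
    then show ?thesis using t by (simp add: law_def)
  qed
  then show ?thesis using law[OF X(1)] by blast
qed

lemma mean_field_solution_unique:
  assumes \<nu>: "mean_field_solution \<nu>" and \<nu>': "mean_field_solution \<nu>'"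
  shows "\<nu> = \<nu>'"
proof -
  obtain B0 where B0: "0 \<le> B0" "\<And>x. x \<in> G \<Longrightarrow> norm x \<le> B0" by (rule G_bound) blast
  have le: "kantorovich (\<nu> t) (\<nu>' t) \<le> c" if t: "t \<in> time D"
    and c: "\<And>q. q \<in> space Q \<Longrightarrow> norm (traj D \<nu> 0 (\<xi> q) (A q) t - traj D \<nu>' 0 (\<xi> q) (A q) t) \<le> c" for t c
  proof -
    have "\<nu> t = distr Q borel (\<lambda>q. traj D \<nu> 0 (\<xi> q) (A q) t)" "\<nu>' t = distr Q borel (\<lambda>q. traj D \<nu>' 0 (\<xi> q) (A q) t)"
      using \<nu> \<nu>' t by blast+
    then show ?thesis
      using kantorovich_distr_le[OF Q meas meas, of \<nu> t \<nu>' t B0 c] \<nu> \<nu>' t c B0(2) traj_in_G A \<xi> by simp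
  qed
  have "kantorovich (\<nu> t) (\<nu>' t) \<le> 2 * 0 * growth t" if t: "t \<in> time D" for t
  proof (rule halving_bound[where K = "time D" and h = "\<lambda>t. kantorovich (\<nu> t) (\<nu>' t)" and ?c0.0 = "2 * B0"])
    fix t assume t: "t \<in> time D"
    have "kantorovich (\<nu> t) (\<nu>' t) \<le> 2 * B0"
    proof (rule le[OF t])
      fix q assume q: "q \<in> space Q"
      have "norm (traj D \<nu> 0 (\<xi> q) (A q) t) \<le> B0" "norm (traj D \<nu>' 0 (\<xi> q) (A q) t) \<le> B0"
        using \<nu> \<nu>' traj_in_G[OF _ A[OF q] \<xi>[OF q] t] B0(2) by auto
      then show "norm (traj D \<nu> 0 (\<xi> q) (A q) t - traj D \<nu>' 0 (\<xi> q) (A q) t) \<le> 2 * B0"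
        using norm_triangle_ineq4[of "traj D \<nu> 0 (\<xi> q) (A q) t" "traj D \<nu>' 0 (\<xi> q) (A q) t"] by linarith
    qed
    also have "\<dots> = 2 * B0 * 1" by simp
    also have "\<dots> \<le> 2 * B0 * growth t" using t B0(1) L_ge_1 by (intro mult_left_mono) auto
    finally show "kantorovich (\<nu> t) (\<nu>' t) \<le> 2 * B0 * growth t" .
  next
    fix c t assume c: "0 \<le> c" "\<And>t. t \<in> time D \<Longrightarrow> kantorovich (\<nu> t) (\<nu>' t) \<le> c * growth t" and t: "t \<in> time D"
    show "kantorovich (\<nu> t) (\<nu>' t) \<le> (0 + c / 2) * growth t"
    proof (rule le[OF t])
      fix q assume q: "q \<in> space Q"
      have "norm (traj D \<nu> 0 (\<xi> q) (A q) t - traj D \<nu>' 0 (\<xi> q) (A q) t) \<le> (2 * norm (\<xi> q - \<xi> q) + c / 2) * growth t"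
        using \<nu> \<nu>' by (intro traj_stability A q c t) auto
      then show "norm (traj D \<nu> 0 (\<xi> q) (A q) t - traj D \<nu>' 0 (\<xi> q) (A q) t) \<le> (0 + c / 2) * growth t" by simp
    qed
  qed (use t in auto)
  then have le0: "kantorovich (\<nu> t) (\<nu>' t) \<le> 0" if "t \<in> time D" for t using that by simp
  have "\<nu> t = \<nu>' t" if t: "t \<in> time D" for t
  proof -
    have P1: "\<nu> t \<in> prob_measures1" "\<nu>' t \<in> prob_measures1" using flow_P1 \<nu> \<nu>' t by blast+
    show ?thesis
      using kantorovich_eq_0_imp_eq[OF P1] kantorovich_nonneg[OF P1] le0[OF t] by simp
  qed
  then show ?thesis using \<nu> \<nu>' by (intro extensionalityI[of _ "time D"]) (auto simp: flows_def)
qed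

lemma mean_field_solution_in_G:
  assumes \<nu>: "mean_field_solution \<nu>" and t: "t \<in> time D"
  shows "\<nu> t \<in> prob_measures_on G"
proof -
  interpret prob_space Q by (rule Q)
  have \<nu>f: "\<nu> \<in> flows D" and \<nu>t: "\<nu> t = distr Q borel (\<lambda>q. traj D \<nu> 0 (\<xi> q) (A q) t)"
    using \<nu> t by blast+
  have "emeasure (\<nu> t) G = emeasure Q ((\<lambda>q. traj D \<nu> 0 (\<xi> q) (A q) t) -` G \<inter> space Q)"
    by (subst \<nu>t, rule emeasure_distr[OF meas[OF \<nu>f t]]) (simp add: compact_imp_closed[OF compact_G])
  also have "(\<lambda>q. traj D \<nu> 0 (\<xi> q) (A q) t) -` G \<inter> space Q = space Q"
    using traj_in_G[OF \<nu>f A \<xi> t] by blast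
  finally show ?thesis using flow_P1[OF \<nu>f t] by (simp add: prob_measures_on_def emeasure_space_1)
qed

end

end

section \<open>Weighted sums of measures\<close>

lemma nn_integral_sum_of_measures:
  assumes sets: "\<And>i. i \<in> I \<Longrightarrow> sets (N i) = sets M"
    and em: "\<And>A. A \<in> sets M \<Longrightarrow> emeasure M A = (\<Sum>i\<in>I. ennreal (c i) * emeasure (N i) A)"
    and f: "f \<in> borel_measurable M"
  shows "(\<integral>\<^sup>+x. f x \<partial>M) = (\<Sum>i\<in>I. ennreal (c i) * (\<integral>\<^sup>+x. f x \<partial>N i))"
proof -
  have space: "space (N i) = space M" if "i \<in> I" for i using sets_eq_imp_space_eq[OF sets[OF that]] .
  have meas: "g \<in> borel_measurable M \<Longrightarrow> i \<in> I \<Longrightarrow> g \<in> borel_measurable (N i)" for g :: "'b \<Rightarrow> ennreal" and i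
    using measurable_cong_sets[OF sets refl] by blast
  show ?thesis
    using f
  proof (induction f rule: borel_measurable_induct)
    case (cong f g)
    have 1: "(\<integral>\<^sup>+x. f x \<partial>M) = (\<integral>\<^sup>+x. g x \<partial>M)"
      using cong(3) by (rule nn_integral_cong)
    have 2: "(\<integral>\<^sup>+x. g x \<partial>N i) = (\<integral>\<^sup>+x. f x \<partial>N i)" if "i \<in> I" for i
      by (rule nn_integral_cong) (metis cong(3) space[OF that])
    have 3: "(\<Sum>i\<in>I. ennreal (c i) * (\<integral>\<^sup>+x. g x \<partial>N i)) = (\<Sum>i\<in>I. ennreal (c i) * (\<integral>\<^sup>+x. f x \<partial>N i))"
      by (rule sum.cong[OF refl]) (simp only: 2)
    show ?case by (rule trans[OF 1 trans[OF cong(4) 3]])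
  next
    case (set A)
    have "emeasure M A = (\<Sum>i\<in>I. ennreal (c i) * (\<integral>\<^sup>+x. indicator A x \<partial>N i))"
      unfolding em[OF set] by (rule sum.cong[OF refl]) (simp add: sets set)
    then show ?case by (simp only: nn_integral_indicator[OF set])
  next
    case (mult u k)
    have "(\<integral>\<^sup>+x. k * u x \<partial>M) = k * (\<Sum>i\<in>I. ennreal (c i) * (\<integral>\<^sup>+x. u x \<partial>N i))"
      by (simp only: nn_integral_cmult[OF mult.hyps(2)] mult.IH)
    also have "\<dots> = (\<Sum>i\<in>I. ennreal (c i) * (\<integral>\<^sup>+x. k * u x \<partial>N i))"
      unfolding sum_distrib_left
      by (rule sum.cong[OF refl]) (simp only: nn_integral_cmult[OF meas[OF mult.hyps(2)]] mult.left_commute)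
    finally show ?case .
  next
    case (add u v)
    have "(\<integral>\<^sup>+x. v x + u x \<partial>M) =
        (\<Sum>i\<in>I. ennreal (c i) * (\<integral>\<^sup>+x. v x \<partial>N i)) + (\<Sum>i\<in>I. ennreal (c i) * (\<integral>\<^sup>+x. u x \<partial>N i))"
      by (simp only: nn_integral_add[OF add.hyps(3,1)] add.IH)
    also have "\<dots> = (\<Sum>i\<in>I. ennreal (c i) * (\<integral>\<^sup>+x. v x + u x \<partial>N i))"
      unfolding sum.distrib[symmetric]
      by (rule sum.cong[OF refl]) (simp only: nn_integral_add[OF meas[OF add.hyps(3)] meas[OF add.hyps(1)]] distrib_left)
    finally show ?case .
  next
    case (seq U)
    have Umono: "U n x \<le> U (Suc n) x" for n x
      using \<open>incseq U\<close> by (simp add: incseq_Suc_iff le_fun_def)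
    have eq: "(\<integral>\<^sup>+x. (SUP i. U i) x \<partial>L) = (SUP i. \<integral>\<^sup>+x. U i x \<partial>L)" if "\<And>i. U i \<in> borel_measurable L" for L
      unfolding SUP_apply by (rule nn_integral_monotone_convergence_SUP[OF \<open>incseq U\<close> that])
    have inc: "incseq (\<lambda>n. ennreal (c i) * (\<integral>\<^sup>+x. U n x \<partial>N i))" for i
      by (intro incseq_SucI mult_left_mono nn_integral_mono Umono) simp
    have "(\<integral>\<^sup>+x. (SUP i. U i) x \<partial>M) = (SUP n. \<integral>\<^sup>+x. U n x \<partial>M)"
      by (rule eq[OF seq(1)])
    also have "\<dots> = (SUP n. \<Sum>i\<in>I. ennreal (c i) * (\<integral>\<^sup>+x. U n x \<partial>N i))"
      by (rule SUP_cong[OF refl], rule seq)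
    also have "\<dots> = (\<Sum>i\<in>I. SUP n. ennreal (c i) * (\<integral>\<^sup>+x. U n x \<partial>N i))"
      by (rule ennreal_SUP_sum[OF inc])
    also have "\<dots> = (\<Sum>i\<in>I. ennreal (c i) * (\<integral>\<^sup>+x. (SUP i. U i) x \<partial>N i))"
    proof (rule sum.cong[OF refl])
      fix i assume i: "i \<in> I"
      show "(SUP n. ennreal (c i) * (\<integral>\<^sup>+x. U n x \<partial>N i)) = ennreal (c i) * (\<integral>\<^sup>+x. (SUP i. U i) x \<partial>N i)"
        by (simp only: eq[OF meas[OF seq(1) i]] SUP_mult_left_ennreal)
    qed
    finally show ?case .
  qed
qed

text \<open>This covers the mixture over the players, the scaling of a measure by \<open>N\<close>, and the splitting of the
  path distribution.\<close>

lemma integral_sum_of_measures: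
  fixes f :: "'b \<Rightarrow> real"
  assumes I: "finite I" and sets: "\<And>i. i \<in> I \<Longrightarrow> sets (N i) = sets M"
    and fin: "\<And>i. i \<in> I \<Longrightarrow> finite_measure (N i)" and c: "\<And>i. i \<in> I \<Longrightarrow> 0 \<le> c i"
    and em: "\<And>A. A \<in> sets M \<Longrightarrow> emeasure M A = (\<Sum>i\<in>I. ennreal (c i) * emeasure (N i) A)"
    and f: "f \<in> borel_measurable M" and B: "\<And>x. x \<in> space M \<Longrightarrow> \<bar>f x\<bar> \<le> B"
  shows "(\<integral>x. f x \<partial>M) = (\<Sum>i\<in>I. c i * (\<integral>x. f x \<partial>N i))"
proof -
  have space: "space (N i) = space M" if "i \<in> I" for i using sets_eq_imp_space_eq[OF sets[OF that]] .
  have finM: "finite_measure M"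
  proof
    have "ennreal (c i) * emeasure (N i) (space M) \<noteq> \<infinity>" if "i \<in> I" for i
      using finite_measure.emeasure_finite[OF fin[OF that], of "space M"] by (simp add: ennreal_mult_eq_top_iff)
    then show "emeasure M (space M) \<noteq> \<infinity>" using em[of "space M"] I by simp
  qed
  have int: "integrable L g" if "finite_measure L" "g \<in> borel_measurable L" "\<And>x. x \<in> space L \<Longrightarrow> \<bar>g x\<bar> \<le> b" for L b and g :: "'b \<Rightarrow> real"
    by (rule finite_measure.integrable_const_bound[OF that(1), of _ b]) (use that in auto)
  have meas: "g \<in> borel_measurable M \<Longrightarrow> i \<in> I \<Longrightarrow> g \<in> borel_measurable (N i)" for g :: "'b \<Rightarrow> real" and i
    using measurable_cong_sets[OF sets refl] by blast
  have nonneg: "(\<integral>x. g x \<partial>M) = (\<Sum>i\<in>I. c i * (\<integral>x. g x \<partial>N i))"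
    if g: "g \<in> borel_measurable M" "\<And>x. x \<in> space M \<Longrightarrow> 0 \<le> g x" "\<And>x. x \<in> space M \<Longrightarrow> g x \<le> b" for b and g :: "'b \<Rightarrow> real"
  proof -
    have iM: "integrable M g" using g by (intro int[OF finM, of _ b]) auto
    have iN: "integrable (N i) g" if "i \<in> I" for i
      using g that by (intro int[OF fin[OF that], of _ b]) (auto simp: space meas)
    have posM: "0 \<le> (\<integral>x. g x \<partial>M)" by (rule integral_nonneg_AE) (use g in auto)
    have posN: "0 \<le> (\<integral>x. g x \<partial>N i)" if "i \<in> I" for i by (rule integral_nonneg_AE) (use g space[OF that] in auto)
    have "ennreal (\<integral>x. g x \<partial>M) = (\<integral>\<^sup>+x. ennreal (g x) \<partial>M)"
      by (rule nn_integral_eq_integral[OF iM, symmetric]) (use g in auto)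
    also have "\<dots> = (\<Sum>i\<in>I. ennreal (c i) * (\<integral>\<^sup>+x. ennreal (g x) \<partial>N i))"
      by (rule nn_integral_sum_of_measures[OF sets em]) (use g in auto)
    also have "\<dots> = (\<Sum>i\<in>I. ennreal (c i * (\<integral>x. g x \<partial>N i)))"
    proof (rule sum.cong[OF refl])
      fix i assume i: "i \<in> I"
      have "(\<integral>\<^sup>+x. ennreal (g x) \<partial>N i) = ennreal (\<integral>x. g x \<partial>N i)"
        by (rule nn_integral_eq_integral[OF iN[OF i]]) (use g space[OF i] in auto)
      then show "ennreal (c i) * (\<integral>\<^sup>+x. ennreal (g x) \<partial>N i) = ennreal (c i * (\<integral>x. g x \<partial>N i))"
        using c[OF i] posN[OF i] by (simp add: ennreal_mult)
    qed
    also have "\<dots> = ennreal (\<Sum>i\<in>I. c i * (\<integral>x. g x \<partial>N i))"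
      using c posN by (intro sum_ennreal) auto
    finally show ?thesis using posM c posN by (simp add: sum_nonneg)
  qed
  define b where "b = \<bar>B\<bar>"
  have b: "\<bar>f x\<bar> \<le> b" if "x \<in> space M" for x using B[OF that] unfolding b_def by linarith
  have b0: "0 \<le> b" by (simp add: b_def)
  have 1: "(\<integral>x. f x + b \<partial>M) = (\<Sum>i\<in>I. c i * (\<integral>x. f x + b \<partial>N i))"
  proof (rule nonneg[of _ "2 * b"])
    show "0 \<le> f x + b" "f x + b \<le> 2 * b" if "x \<in> space M" for x using b[OF that] by linarith+
  qed (use f in auto)
  have 2: "(\<integral>x. b \<partial>M) = (\<Sum>i\<in>I. c i * (\<integral>x. b \<partial>N i))"
    using b0 by (intro nonneg[of _ b]) auto
  have M: "(\<integral>x. f x + b \<partial>M) = (\<integral>x. f x \<partial>M) + (\<integral>x. b \<partial>M)"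
    by (rule Bochner_Integration.integral_add[OF int[OF finM f b] int[OF finM, of _ b]]) (use b0 in auto)
  have N: "(\<integral>x. f x + b \<partial>N i) = (\<integral>x. f x \<partial>N i) + (\<integral>x. b \<partial>N i)" if "i \<in> I" for i
    by (rule Bochner_Integration.integral_add[OF int[OF fin[OF that] meas[OF f that], of b] int[OF fin[OF that], of _ b]])
      (use b b0 space[OF that] in auto)
  have "(\<Sum>i\<in>I. c i * (\<integral>x. f x + b \<partial>N i)) = (\<Sum>i\<in>I. c i * (\<integral>x. f x \<partial>N i)) + (\<Sum>i\<in>I. c i * (\<integral>x. b \<partial>N i))"
    by (simp only: sum.distrib[symmetric] distrib_left[symmetric]) (rule sum.cong[OF refl], simp only: N)
  then show ?thesis using 1 2 M by linarith
qed

context mean_field_game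
begin

section \<open>Payoffs\<close>

text \<open>The Lipschitz conditions on the payoffs hold for these flows.\<close>

definition flows_in_G :: "(real \<Rightarrow> 'x measure) set" where
  "flows_in_G = {\<nu> \<in> flows D. \<forall>t\<in>time D. \<nu> t \<in> prob_measures_on G}"

lemma flows_in_GD: "\<nu> \<in> flows_in_G \<Longrightarrow> \<nu> \<in> flows D" "\<nu> \<in> flows_in_G \<Longrightarrow> t \<in> time D \<Longrightarrow> \<nu> t \<in> prob_measures_on G"
  by (auto simp: flows_in_G_def)

lemma horizon_in_time: "horizon D \<in> time D" using horizon_pos by simp

lemma control_integral_whole:
  fixes F :: "real \<times> 'p \<Rightarrow> 'b::{banach, second_countable_topology}"
  assumes "\<alpha> \<in> control_measures D"
  shows "(strip_integral \<alpha> (time D) F) = (\<integral>z. F z \<partial>\<alpha>)"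
  unfolding set_lebesgue_integral_def space_control[OF assms, symmetric]
  by (rule Bochner_Integration.integral_cong) auto

lemma payoff_eq:
  assumes "\<alpha> \<in> control_measures D"
  shows "payoff D \<nu> 0 y \<alpha> = terminal D (traj D \<nu> 0 y \<alpha> (horizon D)) (\<nu> (horizon D))
    - (\<integral>z. along (running D) \<nu> (traj D \<nu> 0 y \<alpha>) z \<partial>\<alpha>)"
  using control_integral_whole[OF assms, of "along (running D) \<nu> (traj D \<nu> 0 y \<alpha>)"]
  by (simp add: payoff_def cost_def along_def)

lemma running_integral_difference:
  assumes \<alpha>: "\<alpha> \<in> control_measures D" and \<nu>: "\<nu> \<in> flows_in_G" "\<nu>' \<in> flows_in_G"
    and x: "continuous_on (time D) x" "continuous_on (time D) x'" "\<And>t. t \<in> time D \<Longrightarrow> x t \<in> G" "\<And>t. t \<in> time D \<Longrightarrow> x' t \<in> G"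
    and b: "\<And>t. t \<in> time D \<Longrightarrow> norm (x t - x' t) + kantorovich (\<nu> t) (\<nu>' t) \<le> b"
  shows "\<bar>(\<integral>z. along (running D) \<nu> x z \<partial>\<alpha>) - (\<integral>z. along (running D) \<nu>' x' z \<partial>\<alpha>)\<bar> \<le> K * b * horizon D"
proof -
  let ?F = "along (running D) \<nu> x" and ?F' = "along (running D) \<nu>' x'"
  have int: "integrable \<alpha> ?F" "integrable \<alpha> ?F'"
    using \<nu> x by (auto intro!: integrable_control[OF \<alpha>] continuous_on_along continuous_running dest: flows_in_GD)
  have "norm (LINT z:time D \<times> controls D|\<alpha>. ?F z - ?F' z) \<le> K * b * measure lborel (time D)"
  proof (rule control_integral_strip_bound[OF \<alpha>])
    fix \<tau> u assume \<tau>: "\<tau> \<in> time D" "u \<in> controls D"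
    have "\<bar>running D \<tau> (x \<tau>) (\<nu> \<tau>) u - running D \<tau> (x' \<tau>) (\<nu>' \<tau>) u\<bar> \<le> K * (norm (x \<tau> - x' \<tau>) + kantorovich (\<nu> \<tau>) (\<nu>' \<tau>))"
      by (intro lipschitz_running \<tau> x flows_in_GD \<nu>)
    also have "\<dots> \<le> K * b" by (intro mult_left_mono b \<tau> K_nonneg)
    finally show "norm (?F (\<tau>, u) - ?F' (\<tau>, u)) \<le> K * b" by (simp add: along_def)
  qed auto
  then show ?thesis using int horizon_pos by (simp add: control_integral_whole[OF \<alpha>])
qed

text \<open>The terminal and the running payoff contribute \<open>K\<close> and \<open>K * horizon D\<close>; the factor
  \<open>2 * growth (horizon D)\<close> comes from \<open>traj_stability\<close> and the weight.\<close>

definition payoff_const :: real where "payoff_const = 2 * K * (1 + horizon D) * growth (horizon D)"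

lemma payoff_const_nonneg: "0 \<le> payoff_const"
  unfolding payoff_const_def using K_nonneg horizon_pos by simp

lemma payoff_stability:
  assumes \<nu>: "\<nu> \<in> flows_in_G" "\<nu>' \<in> flows_in_G" and \<alpha>: "\<alpha> \<in> control_measures D"
    and y: "y \<in> initial_set D" "y' \<in> initial_set D"
    and c: "0 \<le> c" "\<And>t. t \<in> time D \<Longrightarrow> kantorovich (\<nu> t) (\<nu>' t) \<le> c * growth t"
  shows "\<bar>payoff D \<nu> 0 y \<alpha> - payoff D \<nu>' 0 y' \<alpha>\<bar> \<le> payoff_const * (norm (y - y') + c)"
proof -
  note \<nu>f = flows_in_GD(1)[OF \<nu>(1)] flows_in_GD(1)[OF \<nu>(2)]
  let ?x = "traj D \<nu> 0 y \<alpha>" and ?x' = "traj D \<nu>' 0 y' \<alpha>" and ?T = "horizon D"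
  let ?b = "2 * (norm (y - y') + c) * growth ?T"
  have b: "norm (?x t - ?x' t) + kantorovich (\<nu> t) (\<nu>' t) \<le> ?b" if t: "t \<in> time D" for t
  proof -
    have "norm (?x t - ?x' t) \<le> (2 * norm (y - y') + c / 2) * growth t"
      by (rule traj_stability[OF \<nu>f \<alpha> c t])
    then have "norm (?x t - ?x' t) + kantorovich (\<nu> t) (\<nu>' t) \<le> (2 * norm (y - y') + c / 2) * growth t + c * growth t"
      using c(2)[OF t] by linarith
    also have "\<dots> = (2 * norm (y - y') + c / 2 + c) * growth t" by (simp add: algebra_simps)
    also have "\<dots> \<le> (2 * (norm (y - y') + c)) * growth ?T"
      using t c(1) L_ge_1 by (intro mult_mono) auto
    finally show ?thesis .
  qed
  have "\<bar>terminal D (?x ?T) (\<nu> ?T) - terminal D (?x' ?T) (\<nu>' ?T)\<bar> \<le> K * (norm (?x ?T - ?x' ?T) + kantorovich (\<nu> ?T) (\<nu>' ?T))"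
    by (intro lipschitz_terminal traj_in_G \<nu>f \<alpha> y horizon_in_time flows_in_GD \<nu>)
  also have "\<dots> \<le> K * ?b" by (intro mult_left_mono b K_nonneg horizon_in_time)
  finally have "\<bar>terminal D (?x ?T) (\<nu> ?T) - terminal D (?x' ?T) (\<nu>' ?T)\<bar> \<le> K * ?b" .
  moreover have "\<bar>(\<integral>z. along (running D) \<nu> ?x z \<partial>\<alpha>) - (\<integral>z. along (running D) \<nu>' ?x' z \<partial>\<alpha>)\<bar> \<le> K * ?b * ?T"
    by (intro running_integral_difference \<alpha> \<nu> traj_continuous \<nu>f traj_in_G y b)
  ultimately have "\<bar>payoff D \<nu> 0 y \<alpha> - payoff D \<nu>' 0 y' \<alpha>\<bar> \<le> K * ?b + K * ?b * ?T"
    unfolding payoff_eq[OF \<alpha>] by linarith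
  also have "\<dots> = payoff_const * (norm (y - y') + c)" by (simp add: payoff_const_def algebra_simps)
  finally show ?thesis .
qed

lemma payoff_measurable:
  assumes \<nu>: "\<nu> \<in> flows_in_G" and y: "y \<in> initial_set D"
  shows "(\<lambda>\<alpha>. payoff D \<nu> 0 y \<alpha>) \<in> borel_measurable (borel_of (control_topology D))"
proof (rule continuous_map_measurable_borel, rule continuous_map_by_neighbourhoods)
  note \<nu>f = flows_in_GD(1)[OF \<nu>]
  fix \<alpha> and e :: real assume "\<alpha> \<in> topspace (control_topology D)" and e: "0 < e"
  then have \<alpha>: "\<alpha> \<in> control_measures D" by (simp add: topspace_control_topology)
  let ?T = "horizon D" and ?x = "traj D \<nu> 0 y"
  define e1 where "e1 = e / (4 * ((K + 1) * (1 + ?T)))"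
  have pos: "0 < (K + 1) * (1 + ?T)" using K_nonneg horizon_pos by simp
  have e1: "0 < e1" using e pos by (simp add: e1_def)
  have cancel: "P * (e / (4 * P)) = e / 4" if "0 < P" for P using that by simp
  have Ke1: "K * e1 + K * e1 * ?T \<le> e / 4"
  proof -
    have "K * e1 + K * e1 * ?T = K * (1 + ?T) * e1" by (simp add: algebra_simps)
    also have "\<dots> \<le> (K + 1) * (1 + ?T) * e1" using e1 horizon_pos K_nonneg by (intro mult_right_mono) auto
    also have "\<dots> = e / 4" unfolding e1_def by (rule cancel[OF pos])
    finally show ?thesis .
  qed
  obtain W1 where W1: "openin (control_topology D) W1" "\<alpha> \<in> W1" "W1 \<subseteq> control_measures D"
    "\<And>\<beta> t. \<beta> \<in> W1 \<Longrightarrow> t \<in> time D \<Longrightarrow> norm (?x \<alpha> t - ?x \<beta> t) \<le> e1"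
    by (rule traj_neighbourhood[OF \<nu>f \<alpha> e1]) blast
  have F: "continuous_on (time D \<times> controls D) (along (running D) \<nu> (?x \<alpha>))"
    by (intro continuous_on_along_traj continuous_running \<nu>f \<alpha>)
  obtain W2 where W2: "openin (control_topology D) W2" "\<alpha> \<in> W2"
    "\<And>\<beta> i. \<beta> \<in> W2 \<Longrightarrow> i \<in> {()} \<Longrightarrow> norm ((\<integral>z. along (running D) \<nu> (?x \<alpha>) z \<partial>\<alpha>) - (\<integral>z. along (running D) \<nu> (?x \<alpha>) z \<partial>\<beta>)) < e / 4"
    by (rule control_neighbourhood[of "{()}" "\<lambda>_. along (running D) \<nu> (?x \<alpha>)" \<alpha> "e / 4"]) (use F \<alpha> e in auto)
  show "\<exists>W. openin (control_topology D) W \<and> \<alpha> \<in> W \<and> (\<forall>\<beta>\<in>W. dist (payoff D \<nu> 0 y \<alpha>) (payoff D \<nu> 0 y \<beta>) < e)"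
  proof (intro exI[of _ "W1 \<inter> W2"] conjI ballI)
    show "openin (control_topology D) (W1 \<inter> W2)" by (rule openin_Int[OF W1(1) W2(1)])
    fix \<beta> assume \<beta>W: "\<beta> \<in> W1 \<inter> W2"
    then have \<beta>: "\<beta> \<in> control_measures D" using W1(3) by auto
    have close: "norm (?x \<alpha> t - ?x \<beta> t) + kantorovich (\<nu> t) (\<nu> t) \<le> e1" if "t \<in> time D" for t
      using W1(4)[of \<beta> t] \<beta>W that kantorovich_self[OF flow_P1[OF \<nu>f that]] by simp
    have "\<bar>terminal D (?x \<alpha> ?T) (\<nu> ?T) - terminal D (?x \<beta> ?T) (\<nu> ?T)\<bar> \<le> K * (norm (?x \<alpha> ?T - ?x \<beta> ?T) + kantorovich (\<nu> ?T) (\<nu> ?T))"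
      by (intro lipschitz_terminal traj_in_G \<nu>f \<alpha> \<beta> y horizon_in_time flows_in_GD \<nu>)
    also have "\<dots> \<le> K * e1" by (intro mult_left_mono close K_nonneg horizon_in_time)
    finally have "\<bar>terminal D (?x \<alpha> ?T) (\<nu> ?T) - terminal D (?x \<beta> ?T) (\<nu> ?T)\<bar> \<le> K * e1" .
    moreover have "\<bar>(\<integral>z. along (running D) \<nu> (?x \<alpha>) z \<partial>\<beta>) - (\<integral>z. along (running D) \<nu> (?x \<beta>) z \<partial>\<beta>)\<bar> \<le> K * e1 * ?T"
      by (intro running_integral_difference \<alpha> \<beta> \<nu> traj_continuous \<nu>f traj_in_G y close)
    moreover have "\<bar>(\<integral>z. along (running D) \<nu> (?x \<alpha>) z \<partial>\<alpha>) - (\<integral>z. along (running D) \<nu> (?x \<alpha>) z \<partial>\<beta>)\<bar> < e / 4"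
      using W2(3)[of \<beta> "()"] \<beta>W by simp
    ultimately have "\<bar>payoff D \<nu> 0 y \<alpha> - payoff D \<nu> 0 y \<beta>\<bar> < K * e1 + K * e1 * ?T + e / 4"
      unfolding payoff_eq[OF \<alpha>] payoff_eq[OF \<beta>] by linarith
    then show "dist (payoff D \<nu> 0 y \<alpha>) (payoff D \<nu> 0 y \<beta>) < e"
      using Ke1 e unfolding dist_real_def by linarith
  qed (use W1 W2 in auto)
qed

lemma payoff_bounded:
  assumes \<nu>: "\<nu> \<in> flows_in_G"
  obtains B where "\<And>y \<alpha>. y \<in> initial_set D \<Longrightarrow> \<alpha> \<in> control_measures D \<Longrightarrow> \<bar>payoff D \<nu> 0 y \<alpha>\<bar> \<le> B"
proof -
  note \<nu>f = flows_in_GD(1)[OF \<nu>]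
  let ?T = "horizon D"
  have "K-lipschitz_on G (\<lambda>x. terminal D x (\<nu> ?T))"
  proof (rule lipschitz_onI[OF _ K_nonneg])
    fix x x' assume x: "x \<in> G" "x' \<in> G"
    show "dist (terminal D x (\<nu> ?T)) (terminal D x' (\<nu> ?T)) \<le> K * dist x x'"
      using lipschitz_terminal[OF x flows_in_GD(2)[OF \<nu> horizon_in_time] flows_in_GD(2)[OF \<nu> horizon_in_time]]
        kantorovich_self[OF flow_P1[OF \<nu>f horizon_in_time]] by (simp add: dist_norm)
  qed
  then have "continuous_on G (\<lambda>x. terminal D x (\<nu> ?T))" by (rule lipschitz_on_continuous_on)
  then obtain B1 where B1: "\<And>x. x \<in> G \<Longrightarrow> norm (terminal D x (\<nu> ?T)) \<le> B1"
    by (rule continuous_on_compact_bound[OF compact_G]) blast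
  obtain M where M: "0 \<le> M" "\<And>t x u. t \<in> time D \<Longrightarrow> x \<in> G \<Longrightarrow> u \<in> controls D \<Longrightarrow> norm (running D t x (\<nu> t) u) \<le> M"
    by (rule bounded_along_flow[OF continuous_running \<nu>f compact_G]) blast
  show thesis
  proof (rule that)
    fix y \<alpha> assume y: "y \<in> initial_set D" and \<alpha>: "\<alpha> \<in> control_measures D"
    have "norm (strip_integral \<alpha> (time D) (along (running D) \<nu> (traj D \<nu> 0 y \<alpha>))) \<le> M * measure lborel (time D)"
      using M(2) traj_in_G[OF \<nu>f \<alpha> y] by (intro control_integral_strip_bound[OF \<alpha>]) (auto simp: along_def)
    moreover have "\<bar>terminal D (traj D \<nu> 0 y \<alpha> ?T) (\<nu> ?T)\<bar> \<le> B1"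
      using B1[OF traj_in_G[OF \<nu>f \<alpha> y horizon_in_time]] by simp
    ultimately show "\<bar>payoff D \<nu> 0 y \<alpha>\<bar> \<le> B1 + M * ?T"
      using horizon_pos unfolding payoff_eq[OF \<alpha>] control_integral_whole[OF \<alpha>] by simp
  qed
qed


section \<open>The external field of a profile\<close>

lemma strategiesD:
  assumes "\<rho> \<in> strategies D"
  shows "prob_space \<rho>" "sets \<rho> = sets (borel_of (control_topology D))" "space \<rho> = control_measures D"
proof -
  show "prob_space \<rho>" and sets: "sets \<rho> = sets (borel_of (control_topology D))"
    using assms by (auto simp: space_prob_algebra)
  show "space \<rho> = control_measures D"
    using sets_eq_imp_space_eq[OF sets] by (simp add: space_borel_control)
qed

text \<open>On the space \<open>Q\<close> of pairs of a player and a control measure, the defining identity for bounded continuous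
  functions says that \<open>\<nu> t\<close> is the law of the position at time \<open>t\<close>. Existence and uniqueness for such
  laws then give the field denoted by the definite description.\<close>

lemma external_field_char:
  assumes N: "1 \<le> N" and x: "\<And>i. i \<in> {1..N} \<Longrightarrow> x i \<in> initial_set D"
    and \<rho>: "\<And>i. i \<in> {1..N} \<Longrightarrow> \<rho> i \<in> strategies D"
  shows "external_field D N x \<rho> \<in> flows_in_G"
    and "\<And>t \<phi> :: 'x \<Rightarrow> real. t \<in> time D \<Longrightarrow> continuous_on UNIV \<phi> \<Longrightarrow> bounded (range \<phi>) \<Longrightarrow>
      (\<integral>y. \<phi> y \<partial>external_field D N x \<rho> t) =
        1 / N * (\<Sum>i=1..N. \<integral>\<alpha>. \<phi> (traj D (external_field D N x \<rho>) 0 (x i) \<alpha> t) \<partial>\<rho> i)"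
proof -
  let ?U = "borel_of (control_topology D)"
  let ?S = "count_space {1..N} \<Otimes>\<^sub>M ?U"
  define Q where "Q = uniform_count_measure {1..N} \<bind> (\<lambda>i. distr (\<rho> i) ?S (\<lambda>\<alpha>. (i, \<alpha>)))"
  let ?k = "\<lambda>i. distr (\<rho> i) ?S (\<lambda>\<alpha>. (i, \<alpha>))"
  have pair: "(\<lambda>\<alpha>. (i, \<alpha>)) \<in> \<rho> i \<rightarrow>\<^sub>M ?S" if "i \<in> {1..N}" for i
    using that by (simp add: measurable_cong_sets[OF strategiesD(2)[OF \<rho>[OF that]] refl])
  have kprob: "prob_space (?k i)" if "i \<in> {1..N}" for i
    by (rule prob_space.prob_space_distr[OF strategiesD(1)[OF \<rho>[OF that]] pair[OF that]])
  interpret U: prob_space "uniform_count_measure {1..N}"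
    using N by (intro prob_space_uniform_count_measure) auto
  have kernel: "?k \<in> uniform_count_measure {1..N} \<rightarrow>\<^sub>M subprob_algebra ?S"
    using kprob by (auto simp: measurable_cong_sets[OF sets_uniform_count_measure_count_space refl]
        space_subprob_algebra prob_space_imp_subprob_space)
  have ne: "space (uniform_count_measure {1..N}) \<noteq> {}" using N by (simp add: space_uniform_count_measure)
  have Qsets: "sets Q = sets ?S" unfolding Q_def by (rule sets_bind[OF sets_distr ne])
  have Qspace: "space Q = {1..N} \<times> control_measures D"
    using sets_eq_imp_space_eq[OF Qsets] by (simp add: space_pair_measure space_borel_control)
  have Qprob: "prob_space Q"
    unfolding Q_def by (rule U.prob_space_bind[OF _ kernel]) (use kprob in \<open>auto simp: space_uniform_count_measure intro!: AE_I2\<close>)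
  have Qint: "(\<integral>q. h q \<partial>Q) = 1 / N * (\<Sum>i=1..N. \<integral>\<alpha>. h (i, \<alpha>) \<partial>\<rho> i)"
    if h: "h \<in> borel_measurable ?S" "\<And>q. q \<in> space Q \<Longrightarrow> \<bar>h q\<bar> \<le> B" for h B
  proof -
    have "(\<integral>q. h q \<partial>Q) = (\<Sum>i\<in>{1..N}. (1 / N) * (\<integral>q. h q \<partial>?k i))"
    proof (rule integral_sum_of_measures)
      show "h \<in> borel_measurable Q" using h(1) by (simp add: measurable_cong_sets[OF Qsets refl])
      show "emeasure Q A = (\<Sum>i\<in>{1..N}. ennreal (1 / N) * emeasure (?k i) A)" if "A \<in> sets Q" for A
      proof -
        have "emeasure Q A = (\<integral>\<^sup>+i. emeasure (?k i) A \<partial>uniform_count_measure {1..N})"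
          unfolding Q_def using that Qsets by (intro emeasure_bind[OF ne kernel]) auto
        also have "\<dots> = (\<Sum>i\<in>{1..N}. ennreal (1 / N) * emeasure (?k i) A)"
          unfolding uniform_count_measure_def by (subst nn_integral_point_measure_finite) auto
        finally show ?thesis .
      qed
      show "sets (?k i) = sets Q" for i by (simp only: sets_distr Qsets)
      show "finite_measure (?k i)" if "i \<in> {1..N}" for i by (rule prob_space.axioms(1)[OF kprob[OF that]])
    qed (use h(2) in auto)
    also have "\<dots> = (\<Sum>i\<in>{1..N}. (1 / N) * (\<integral>\<alpha>. h (i, \<alpha>) \<partial>\<rho> i))"
      by (intro sum.cong refl) (simp only: integral_distr[OF pair h(1)])
    finally show ?thesis by (simp add: sum_distrib_left)
  qed
  have meas: "(\<lambda>q. traj D \<nu> 0 (x (fst q)) (snd q) t) \<in> borel_measurable ?S" if "\<nu> \<in> flows D" "t \<in> time D" for \<nu> t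
    using traj_measurable[OF that] by (intro measurable_pair_measure_countable1) auto
  have measQ: "(\<lambda>q. traj D \<nu> 0 (x (fst q)) (snd q) t) \<in> borel_measurable Q" if "\<nu> \<in> flows D" "t \<in> time D" for \<nu> t
    using meas[OF that] by (simp add: measurable_cong_sets[OF Qsets refl])
  have xQ: "x (fst q) \<in> initial_set D" "snd q \<in> control_measures D" if "q \<in> space Q" for q
    using that x by (auto simp: Qspace)
  let ?sol = "\<lambda>\<nu>. \<nu> \<in> flows D \<and> (\<forall>t\<in>time D. \<nu> t = distr Q borel (\<lambda>q. traj D \<nu> 0 (x (fst q)) (snd q) t))"
  let ?field = "\<lambda>\<nu>. \<nu> \<in> flows D \<and> (\<forall>t\<in>time D. \<forall>\<phi> :: 'x \<Rightarrow> real. continuous_on UNIV \<phi> \<and> bounded (range \<phi>) \<longrightarrow>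
        (\<integral>y. \<phi> y \<partial>\<nu> t) = 1 / N * (\<Sum>i=1..N. \<integral>\<alpha>. \<phi> (traj D \<nu> 0 (x i) \<alpha> t) \<partial>\<rho> i))"
  have law: "(\<integral>y. \<phi> y \<partial>distr Q borel (\<lambda>q. traj D \<nu> 0 (x (fst q)) (snd q) t)) =
        1 / N * (\<Sum>i=1..N. \<integral>\<alpha>. \<phi> (traj D \<nu> 0 (x i) \<alpha> t) \<partial>\<rho> i)"
    if \<nu>: "\<nu> \<in> flows D" and t: "t \<in> time D" and \<phi>: "continuous_on UNIV \<phi>" "bounded (range \<phi>)" for \<nu> t and \<phi> :: "'x \<Rightarrow> real"
  proof -
    have \<phi>m: "\<phi> \<in> borel_measurable borel" using \<phi>(1) by (rule borel_measurable_continuous_onI)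
    obtain B where B: "\<And>y. \<bar>\<phi> y\<bar> \<le> B" using \<phi>(2) by (auto simp: bounded_iff)
    show ?thesis
      using Qint[of "\<lambda>q. \<phi> (traj D \<nu> 0 (x (fst q)) (snd q) t)" B] B measurable_compose[OF meas[OF \<nu> t] \<phi>m]
      by (simp add: integral_distr[OF measQ[OF \<nu> t] \<phi>m])
  qed
  have iff: "?field \<nu> \<longleftrightarrow> ?sol \<nu>" for \<nu>
  proof
    assume f: "?field \<nu>"
    have "\<nu> t = distr Q borel (\<lambda>q. traj D \<nu> 0 (x (fst q)) (snd q) t)" if t: "t \<in> time D" for t
    proof (rule prob_measures1_eqI)
      obtain B where B: "\<And>x. x \<in> G \<Longrightarrow> norm x \<le> B" by (rule G_bound) blast
      show "\<nu> t \<in> prob_measures1" using f flow_P1 t by blast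
      show "distr Q borel (\<lambda>q. traj D \<nu> 0 (x (fst q)) (snd q) t) \<in> prob_measures1"
        using f t xQ B traj_in_G by (intro distr_prob_measures1[OF Qprob measQ, of _ _ B]) auto
      show "(\<integral>x. \<phi> x \<partial>\<nu> t) = (\<integral>x. \<phi> x \<partial>distr Q borel (\<lambda>q. traj D \<nu> 0 (x (fst q)) (snd q) t))"
        if "continuous_on UNIV \<phi>" "bounded (range \<phi>)" for \<phi> :: "'x \<Rightarrow> real"
        using f law[OF _ t that, of \<nu>] that t by auto
    qed
    then show "?sol \<nu>" using f by blast
  next
    assume s: "?sol \<nu>"
    then show "?field \<nu>" using law by simp
  qed
  obtain \<nu> where \<nu>: "?sol \<nu>"
    using mean_field_solution_exists[OF Qprob xQ measQ] by blast
  have "external_field D N x \<rho> = \<nu>"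
    unfolding external_field_def iff
  proof (rule the_equality)
    show "?sol \<nu>" by (rule \<nu>)
    show "\<nu>' = \<nu>" if "?sol \<nu>'" for \<nu>'
      by (rule mean_field_solution_unique[OF Qprob xQ measQ that \<nu>])
  qed
  then have e: "?sol (external_field D N x \<rho>)" using \<nu> by simp
  then show "external_field D N x \<rho> \<in> flows_in_G"
    using mean_field_solution_in_G[OF Qprob xQ measQ e] by (auto simp: flows_in_G_def)
  show "(\<integral>y. \<phi> y \<partial>external_field D N x \<rho> t) =
        1 / N * (\<Sum>i=1..N. \<integral>\<alpha>. \<phi> (traj D (external_field D N x \<rho>) 0 (x i) \<alpha> t) \<partial>\<rho> i)"
    if "t \<in> time D" "continuous_on UNIV \<phi>" "bounded (range \<phi>)" for t and \<phi> :: "'x \<Rightarrow> real"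
    using e iff[of "external_field D N x \<rho>"] that by blast
qed

end

section \<open>Measures carried by a compact set\<close>

lemma emeasure_eq_1_imp_AE:
  assumes M: "prob_space M" and A: "emeasure M A = 1"
  shows "A \<in> sets M" "AE x in M. x \<in> A"
proof -
  show s: "A \<in> sets M" using A emeasure_notin_sets[of A M] by auto
  have "measure M A = 1" using A by (simp add: measure_def)
  then show "AE x in M. x \<in> A" using prob_space.AE_prob_1[OF M] by blast
qed

lemma integrable_bounded:
  fixes f :: "'a \<Rightarrow> real"
  assumes "finite_measure M" "f \<in> borel_measurable M" "\<And>x. x \<in> space M \<Longrightarrow> \<bar>f x\<bar> \<le> B"
  shows "integrable M f"
  by (rule finite_measure.integrable_const_bound[OF assms(1), of _ B]) (use assms in auto)

text \<open>A Lipschitz function can be truncated at its bound on \<open>G\<close>; so bounded test functions, for which external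
  fields are defined, determine the distance of measures carried by \<open>G\<close>.\<close>

lemma kantorovich_least_on_compact:
  fixes m m' :: "'x::euclidean_space measure"
  assumes G: "compact G" and m: "m \<in> prob_measures_on G" "m' \<in> prob_measures_on G"
    and le: "\<And>\<phi>. 1-lipschitz_on UNIV \<phi> \<Longrightarrow> bounded (range \<phi>) \<Longrightarrow> (\<integral>x. \<phi> x \<partial>m) - (\<integral>x. \<phi> x \<partial>m') \<le> c"
  shows "kantorovich m m' \<le> c"
proof (rule kantorovich_least)
  fix \<phi> :: "'x \<Rightarrow> real" assume \<phi>: "1-lipschitz_on UNIV \<phi>"
  have cont: "continuous_on UNIV \<phi>" by (rule lipschitz_on_continuous_on[OF \<phi>])
  obtain R where R: "0 \<le> R" "\<And>x. x \<in> G \<Longrightarrow> norm (\<phi> x) \<le> R"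
    by (rule continuous_on_compact_bound[OF G continuous_on_subset[OF cont]]) auto
  define \<psi> where "\<psi> x = max (- R) (min R (\<phi> x))" for x
  have \<psi>: "1-lipschitz_on UNIV \<psi>"
  proof (rule lipschitz_onI)
    fix x y :: 'x
    have "\<bar>\<psi> x - \<psi> y\<bar> \<le> \<bar>\<phi> x - \<phi> y\<bar>" unfolding \<psi>_def by (auto simp: max_def min_def)
    then show "dist (\<psi> x) (\<psi> y) \<le> 1 * dist x y"
      using lipschitz_onD[OF \<phi>, of x y] by (simp add: dist_real_def)
  qed simp
  have bnd: "bounded (range \<psi>)" by (rule boundedI[of _ R]) (use R(1) in \<open>auto simp: \<psi>_def\<close>)
  have eq: "(\<integral>x. \<phi> x \<partial>M) = (\<integral>x. \<psi> x \<partial>M)" if M: "M \<in> prob_measures_on G" for M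
  proof (rule integral_cong_AE)
    have M1: "M \<in> prob_measures1" "prob_space M" "emeasure M G = 1" and sets: "sets M = sets borel"
      using M by (auto simp: prob_measures_on_def prob_measures1_def)
    show "\<phi> \<in> borel_measurable M" "\<psi> \<in> borel_measurable M"
      using cont lipschitz_on_continuous_on[OF \<psi>]
      by (simp_all add: measurable_cong_sets[OF sets refl] borel_measurable_continuous_onI)
    have "AE x in M. x \<in> G" by (rule emeasure_eq_1_imp_AE(2)[OF M1(2,3)])
    then show "AE x in M. \<phi> x = \<psi> x"
    proof eventually_elim
      case (elim x)
      then show ?case using R(2)[of x] by (auto simp: \<psi>_def abs_le_iff)
    qed
  qed
  show "(\<integral>x. \<phi> x \<partial>m) - (\<integral>x. \<phi> x \<partial>m') \<le> c"
    unfolding eq[OF m(1)] eq[OF m(2)] by (rule le[OF \<psi> bnd])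
qed

context mean_field_game
begin

section \<open>Trajectories and values at the end points of the time interval\<close>

lemma control_integral_at_horizon:
  assumes h: "jointly_continuous (h :: real \<Rightarrow> 'x \<Rightarrow> 'x measure \<Rightarrow> 'p \<Rightarrow> 'b::euclidean_space)" and \<nu>: "\<nu> \<in> flows D" and \<alpha>: "\<alpha> \<in> control_measures D"
  shows "(LINT z:{horizon D..horizon D} \<times> controls D|\<alpha>. along h \<nu> x z) = 0"
proof -
  obtain M where M: "\<And>t y u. t \<in> time D \<Longrightarrow> y \<in> {x (horizon D)} \<Longrightarrow> u \<in> controls D \<Longrightarrow> norm (h t y (\<nu> t) u) \<le> M"
    by (rule bounded_along_flow[OF h \<nu>, of "{x (horizon D)}"]) auto
  have "norm (LINT z:{horizon D..horizon D} \<times> controls D|\<alpha>. along h \<nu> x z) \<le> M * measure lborel {horizon D..horizon D}"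
    by (rule control_integral_strip_bound[OF \<alpha>]) (use M horizon_pos in \<open>auto simp: along_def\<close>)
  then show ?thesis by simp
qed

lemma traj_at_horizon:
  assumes \<nu>: "\<nu> \<in> flows D" and \<alpha>: "\<alpha> \<in> control_measures D"
  shows "traj D \<nu> (horizon D) y \<alpha> (horizon D) = y"
proof -
  let ?T = "horizon D"
  let ?P = "\<lambda>x. x \<in> extensional {?T..?T} \<and> continuous_on {?T..?T} x \<and>
     (\<forall>t\<in>{?T..?T}. x t = y + (strip_integral \<alpha> {?T..t} (along (dynam D) \<nu> x)))"
  have iff: "?P x \<longleftrightarrow> x = (\<lambda>t\<in>{?T..?T}. y)" for x
  proof
    assume P: "?P x"
    then have "x ?T = y" using control_integral_at_horizon[OF continuous_dynam \<nu> \<alpha>, of x] by simp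
    then show "x = (\<lambda>t\<in>{?T..?T}. y)"
      using P by (intro extensionalityI[of _ "{?T..?T}"]) auto
  next
    assume "x = (\<lambda>t\<in>{?T..?T}. y)"
    then show "?P x" using control_integral_at_horizon[OF continuous_dynam \<nu> \<alpha>, of x] by simp
  qed
  have "traj D \<nu> ?T y \<alpha> = (THE x. ?P x)" by (simp only: traj_def along_def)
  also have "\<dots> = (\<lambda>t\<in>{?T..?T}. y)" unfolding iff by (rule the_eq_trivial)
  finally show ?thesis by simp
qed

text \<open>At the final time no control has any effect. This connects the last component \<open>z\<close> of an extended
  trajectory, which equals \<open>V\<close> along it, with the terminal payoff.\<close>

lemma val_at_horizon:
  assumes \<nu>: "\<nu> \<in> flows D" and ne: "control_measures D \<noteq> {}"
  shows "val D \<nu> (horizon D) y = terminal D y (\<nu> (horizon D))"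
proof -
  have "payoff D \<nu> (horizon D) y \<alpha> = terminal D y (\<nu> (horizon D))" if \<alpha>: "\<alpha> \<in> control_measures D" for \<alpha>
    using control_integral_at_horizon[OF continuous_running \<nu> \<alpha>, of "traj D \<nu> (horizon D) y \<alpha>"]
    by (simp add: payoff_def cost_def traj_at_horizon[OF \<nu> \<alpha>] along_def)
  then have iff: "(\<exists>\<alpha>\<in>control_measures D. v = payoff D \<nu> (horizon D) y \<alpha>) \<longleftrightarrow> v = terminal D y (\<nu> (horizon D))" for v
    using ne by (metis all_not_in_conv)
  show ?thesis unfolding val_def iff by (rule Greatest_equality) auto
qed

lemma traj_start:
  assumes \<nu>: "\<nu> \<in> flows D" and \<alpha>: "\<alpha> \<in> control_measures D"
  shows "traj D \<nu> 0 y \<alpha> 0 = y"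
proof -
  let ?F = "along (dynam D) \<nu> (traj D \<nu> 0 y \<alpha>)"
  obtain M where M: "\<And>z. z \<in> time D \<times> controls D \<Longrightarrow> norm (?F z) \<le> M"
    by (rule continuous_on_compact_bound[OF compact_Times[OF compact_Icc compact_controls]
          continuous_on_along_traj[OF continuous_dynam \<nu> \<alpha>]]) blast
  have "norm (strip_integral \<alpha> {0..0} ?F) \<le> M * measure lborel {0..0::real}"
    by (rule control_integral_strip_bound[OF \<alpha>]) (use M horizon_pos in auto)
  then show ?thesis using traj_eq[OF \<nu> \<alpha>, of 0 y] horizon_pos by simp
qed

lemma initial_set_in_G: "control_measures D \<noteq> {} \<Longrightarrow> initial_set D \<subseteq> G"
proof
  fix y assume ne: "control_measures D \<noteq> {}" and y: "y \<in> initial_set D"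
  then obtain \<alpha> where \<alpha>: "\<alpha> \<in> control_measures D" by auto
  show "y \<in> G" using traj_in_G[OF constant_flow \<alpha> y, of 0] horizon_pos by (simp add: traj_start[OF constant_flow \<alpha>])
qed

section \<open>Positions along a path\<close>

lemma eval_continuous: "t \<in> time D \<Longrightarrow> continuous_map (path_topology D) euclidean (\<lambda>p. p t)"
proof (rule continuous_map_by_neighbourhoods)
  let ?m = "cfunspace (top_of_set (time D)) (euclidean_metric :: ('x \<times> real) metric)"
  interpret M: Metric_space "mspace ?m" "mdist ?m" by (rule Metric_space_mspace_mdist)
  fix p :: "real \<Rightarrow> 'x \<times> real" and e :: real
  assume t: "t \<in> time D" and p: "p \<in> topspace (path_topology D)" and e: "0 < e"
  have pm: "p \<in> mspace ?m" using p by (simp add: path_topology_def del: mspace_cfunspace)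
  show "\<exists>W. openin (path_topology D) W \<and> p \<in> W \<and> (\<forall>q\<in>W. dist (p t) (q t) < e)"
  proof (intro exI[of _ "M.mball p e"] conjI ballI)
    show "openin (path_topology D) (M.mball p e)"
      using M.openin_mball by (simp add: path_topology_def mtopology_of_def)
    show "p \<in> M.mball p e" using pm e by (simp only: M.centre_in_mball_iff)
    fix q assume "q \<in> M.mball p e"
    then have q: "q \<in> mspace ?m" "mdist ?m p q < e" by (simp_all only: M.in_mball)
    have "mdist euclidean_metric (p t) (q t) \<le> mdist ?m p q"
      by (rule mdist_cfunspace_imp_mdist_le[OF pm q(1) order_refl]) (use t in simp)
    then show "dist (p t) (q t) < e" using q(2) by simp
  qed
qed

lemma position_continuous:
  assumes "t \<in> time D"
  shows "continuous_map (path_topology D) euclidean (\<lambda>p. fst (p t))"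
proof -
  have "continuous_map euclidean euclidean (fst :: 'x \<times> real \<Rightarrow> 'x)"
    by (simp add: continuous_on_fst[OF continuous_on_id])
  from continuous_map_compose[OF eval_continuous[OF assms] this] show ?thesis by (simp add: o_def)
qed

end


section \<open>The equilibrium and its distribution on paths\<close>

locale mean_field_equilibrium = mean_field_game D G L K
  for D :: "('x::euclidean_space, 'p::metric_space) mfg" and G :: "'x set" and L K :: real +
  fixes \<gamma> :: "(('x \<times> real) \<times> (real \<times> 'p) measure) measure" and \<mu> :: "real \<Rightarrow> 'x measure"
    and \<chi>\<^sub>0 :: "'x \<Rightarrow> (real \<Rightarrow> 'x \<times> real) measure" and \<Theta> :: "(real \<Rightarrow> 'x \<times> real) \<Rightarrow> (real \<times> 'p) measure"
  assumes nash: "nash_equilibrium D \<gamma> \<mu>" and disintegration: "path_disintegration D \<gamma> \<mu> \<chi>\<^sub>0"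
    and selector: "control_selector D \<mu> \<Theta>"
begin

abbreviation paths :: "(real \<Rightarrow> 'x \<times> real) measure" where
  "paths \<equiv> borel_ext_trajs D (val D \<mu>) \<mu>"

lemma \<mu>_flow: "\<mu> \<in> flows D"
  using nash by (simp add: nash_equilibrium_def corresponding_flow_def)

lemma prob_\<gamma>: "prob_space \<gamma>"
  using nash by (simp add: nash_equilibrium_def control_distributions_def)

lemma space_\<gamma>: "space \<gamma> = (initial_set D \<times> {0..1}) \<times> control_measures D"
proof -
  have "sets \<gamma> = sets (borel_of (prod_topology (top_of_set (initial_set D \<times> {0..1})) (control_topology D)))"
    using nash by (simp add: nash_equilibrium_def control_distributions_def)
  from sets_eq_imp_space_eq[OF this] show ?thesis
    by (simp add: space_borel_of topspace_control_topology)
qed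

abbreviation position :: "real \<Rightarrow> ('x \<times> real) \<times> (real \<times> 'p) measure \<Rightarrow> 'x" where
  "position t \<equiv> \<lambda>(\<omega>, \<alpha>). traj D \<mu> 0 (fst \<omega>) \<alpha> t"

text \<open>The measures \<open>\<mu> t\<close> have mass 1, so \<open>measurable_of_distr_nonzero\<close> applies to the position map.\<close>

lemma \<mu>_law:
  assumes t: "t \<in> time D" and B: "B \<in> sets borel"
  shows "position t -` B \<inter> space \<gamma> \<in> sets \<gamma>" "emeasure (\<mu> t) B = emeasure \<gamma> (position t -` B \<inter> space \<gamma>)"
proof -
  have \<mu>t: "\<mu> t = distr \<gamma> borel (position t)"
    using nash t by (simp add: nash_equilibrium_def corresponding_flow_def)
  have "prob_space (\<mu> t)" using flow_P1[OF \<mu>_flow t] by (simp add: prob_measures1_def)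
  then have "emeasure (\<mu> t) (space (\<mu> t)) = 1" by (rule prob_space.emeasure_space_1)
  then have nz: "emeasure (distr \<gamma> borel (position t)) (space borel) \<noteq> 0" unfolding \<mu>t by simp
  show "position t -` B \<inter> space \<gamma> \<in> sets \<gamma>" "emeasure (\<mu> t) B = emeasure \<gamma> (position t -` B \<inter> space \<gamma>)"
    unfolding \<mu>t by (rule measurable_of_distr_nonzero[OF nz B])+
qed

lemma \<mu>_in_G: "\<mu> \<in> flows_in_G"
proof -
  have "emeasure (\<mu> t) G = 1" if t: "t \<in> time D" for t
  proof -
    have "position t -` G \<inter> space \<gamma> = space \<gamma>"
      using traj_in_G[OF \<mu>_flow _ _ t] by (auto simp: space_\<gamma>)
    then show ?thesis
      using \<mu>_law(2)[OF t, of G] compact_imp_closed[OF compact_G] prob_space.emeasure_space_1[OF prob_\<gamma>] by simp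
  qed
  then show ?thesis using flow_P1[OF \<mu>_flow] \<mu>_flow by (simp add: flows_in_G_def prob_measures_on_def)
qed

lemma space_paths: "p \<in> space paths \<Longrightarrow> p \<in> ext_trajs D (val D \<mu>) \<mu>"
  by (simp add: space_borel_of)

lemma eval_measurable: "t \<in> time D \<Longrightarrow> (\<lambda>p. fst (p t)) \<in> borel_measurable paths"
proof -
  assume t: "t \<in> time D"
  show ?thesis
    by (rule continuous_map_measurable_borel[OF continuous_map_from_subtopology[OF position_continuous[OF t]]])
qed

lemma \<chi>\<^sub>0_kernel: "\<chi>\<^sub>0 \<in> restrict_space borel (initial_set D) \<rightarrow>\<^sub>M prob_algebra paths"
  using disintegration by (simp add: path_disintegration_def)

lemma \<chi>\<^sub>0_prob: "y \<in> initial_set D \<Longrightarrow> prob_space (\<chi>\<^sub>0 y)"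
  and \<chi>\<^sub>0_sets: "y \<in> initial_set D \<Longrightarrow> sets (\<chi>\<^sub>0 y) = sets paths"
proof -
  assume "y \<in> initial_set D"
  then have "y \<in> space (restrict_space borel (initial_set D))" by (simp add: space_restrict_space)
  from measurable_space[OF \<chi>\<^sub>0_kernel this]
  show "prob_space (\<chi>\<^sub>0 y)" "sets (\<chi>\<^sub>0 y) = sets paths" by (simp_all add: space_prob_algebra)
qed

text \<open>The map from players and controls to paths contains \<open>V\<close> along the trajectory. Its measurability is read
  off from the disintegration identity: the right-hand side has total mass 1, so the push-forward is
  nonzero and \<open>measurable_of_distr_nonzero\<close> applies. The position at time \<open>t\<close> of the path is that of
  the trajectory, whose law is \<open>\<mu> t\<close>.\<close>

lemma \<mu>_disintegration:
  assumes t: "t \<in> time D" and B: "B \<in> sets borel" and full: "emeasure (initial D) (initial_set D) = 1"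
  shows "emeasure (\<mu> t) B =
    (\<integral>\<^sup>+y. emeasure (\<chi>\<^sub>0 y) ((\<lambda>p. fst (p t)) -` B \<inter> space paths) * indicator (initial_set D) y \<partial>initial D)"
proof -
  interpret \<gamma>: prob_space \<gamma> by (rule prob_\<gamma>)
  let ?N = "borel_of (path_topology D)" and ?E = "ext_trajs D (val D \<mu>) \<mu>"
  let ?F = "\<lambda>(\<omega>, \<alpha>). \<lambda>t\<in>time D. (traj D \<mu> 0 (fst \<omega>) \<alpha> t, val D \<mu> t (traj D \<mu> 0 (fst \<omega>) \<alpha> t))"
  have G0: "initial_set D \<in> sets (initial D)"
    using initial_P1 compact_imp_closed[OF compact_initial_set] by (auto simp: prob_measures1_def)
  have dis: "emeasure (distr \<gamma> ?N ?F) A = (\<integral>\<^sup>+y. emeasure (\<chi>\<^sub>0 y) (A \<inter> ?E) * indicator (initial_set D) y \<partial>initial D)"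
    if "A \<in> sets ?N" for A
    using disintegration that by (simp add: path_disintegration_def path_distribution_def)
  have sp: "space ?N \<inter> ?E = space paths" by (simp add: space_borel_of)
  have "emeasure (distr \<gamma> ?N ?F) (space ?N) = (\<integral>\<^sup>+y. indicator (initial_set D) y \<partial>initial D)"
  proof (subst dis, simp, unfold sp, rule nn_integral_cong)
    fix y
    show "emeasure (\<chi>\<^sub>0 y) (space paths) * indicator (initial_set D) y = indicator (initial_set D) y"
    proof (cases "y \<in> initial_set D")
      case True
      then show ?thesis using prob_space.emeasure_space_1[OF \<chi>\<^sub>0_prob[OF True]] sets_eq_imp_space_eq[OF \<chi>\<^sub>0_sets[OF True]] by simp
    qed simp
  qed
  then have one: "emeasure (distr \<gamma> ?N ?F) (space ?N) = 1" using G0 full by simp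
  then have nz: "emeasure (distr \<gamma> ?N ?F) (space ?N) \<noteq> 0" by simp
  note F = measurable_of_distr_nonzero[OF nz]
  have top: "AE z in \<gamma>. z \<in> ?F -` space ?N \<inter> space \<gamma>"
    using one F(2)[OF sets.top] by (intro emeasure_eq_1_imp_AE(2)[OF prob_\<gamma>]) simp
  let ?A = "(\<lambda>p. fst (p t)) -` B \<inter> space ?N"
  have A: "?A \<in> sets ?N"
  proof (rule measurable_sets[OF _ B])
    show "(\<lambda>p. fst (p t)) \<in> borel_measurable ?N"
      by (rule continuous_map_measurable_borel[OF position_continuous[OF t]])
  qed
  have "emeasure (\<mu> t) B = emeasure \<gamma> (position t -` B \<inter> space \<gamma>)" by (rule \<mu>_law(2)[OF t B])
  also have "\<dots> = emeasure \<gamma> (?F -` ?A \<inter> space \<gamma>)"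
  proof (rule emeasure_eq_AE)
    show "AE z in \<gamma>. (z \<in> position t -` B \<inter> space \<gamma>) = (z \<in> ?F -` ?A \<inter> space \<gamma>)"
      using top by eventually_elim (use t in \<open>auto simp: case_prod_unfold\<close>)
  qed (use \<mu>_law(1)[OF t B] F(1)[OF A] in auto)
  also have "\<dots> = emeasure (distr \<gamma> ?N ?F) ?A" by (rule F(2)[OF A, symmetric])
  also have "\<dots> = (\<integral>\<^sup>+y. emeasure (\<chi>\<^sub>0 y) (?A \<inter> ?E) * indicator (initial_set D) y \<partial>initial D)" by (rule dis[OF A])
  also have "?A \<inter> ?E = (\<lambda>p. fst (p t)) -` B \<inter> space paths" using sp by blast
  finally show ?thesis .
qed

lemma \<Theta>_control: "p \<in> space paths \<Longrightarrow> \<Theta> p \<in> control_measures D"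
  using selector measurable_space[of \<Theta> paths "borel_of (control_topology D)" p]
  by (simp add: control_selector_def space_borel_control)

lemma path_as_traj: "p \<in> space paths \<Longrightarrow> t \<in> time D \<Longrightarrow> fst (p t) = traj D \<mu> 0 (fst (p 0)) (\<Theta> p) t"
  using selector space_paths[of p] unfolding control_selector_def by blast

text \<open>The final value of the second component of \<open>p\<close> is the terminal payoff, because \<open>p\<close> runs on the graph of
  \<open>V\<close>; by the choice of \<open>\<Theta>\<close> it is also \<open>V (0, p 0)\<close> minus the cost.\<close>

lemma selected_control_payoff:
  assumes p: "p \<in> space paths"
  shows "payoff D \<mu> 0 (fst (p 0)) (\<Theta> p) = val D \<mu> 0 (fst (p 0))"
proof -
  let ?T = "horizon D"
  have ne: "control_measures D \<noteq> {}" using \<Theta>_control[OF p] by auto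
  have "snd (p ?T) = val D \<mu> ?T (fst (p ?T))"
    using space_paths[OF p] horizon_in_time by (simp add: ext_trajs_def)
  also have "\<dots> = terminal D (fst (p ?T)) (\<mu> ?T)" by (rule val_at_horizon[OF \<mu>_flow ne])
  finally have 1: "snd (p ?T) = terminal D (fst (p ?T)) (\<mu> ?T)" .
  have 2: "snd (p ?T) = val D \<mu> 0 (fst (p 0)) - cost D \<mu> 0 (fst (p 0)) (\<Theta> p) ?T"
    using selector space_paths[OF p] horizon_in_time unfolding control_selector_def by blast
  have "payoff D \<mu> 0 (fst (p 0)) (\<Theta> p) = terminal D (fst (p ?T)) (\<mu> ?T) + cost D \<mu> 0 (fst (p 0)) (\<Theta> p) ?T"
    by (simp add: payoff_def path_as_traj[OF p horizon_in_time])
  then show ?thesis using 1 2 by simp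
qed

text \<open>Dirac measures show that every payoff is at most the average payoff \<open>v\<close> under \<open>\<rho>\<close>. A function that is
  bounded by its own average equals it almost surely, so \<open>v\<close> is a maximum, and the definite
  description of the value function denotes it.\<close>

lemma value_attained:
  assumes y: "y \<in> initial_set D" and \<rho>: "\<rho> \<in> strategies D"
    and best: "\<And>\<rho>'. \<rho>' \<in> strategies D \<Longrightarrow> (\<integral>\<alpha>. payoff D \<mu> 0 y \<alpha> \<partial>\<rho>') \<le> (\<integral>\<alpha>. payoff D \<mu> 0 y \<alpha> \<partial>\<rho>)"
    and \<alpha>: "\<alpha> \<in> control_measures D"
  shows "payoff D \<mu> 0 y \<alpha> \<le> val D \<mu> 0 y"
proof -
  let ?U = "borel_of (control_topology D)" and ?J = "payoff D \<mu> 0 y"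
  define v where "v = (\<integral>\<alpha>. ?J \<alpha> \<partial>\<rho>)"
  interpret \<rho>: prob_space \<rho> by (rule strategiesD(1)[OF \<rho>])
  have le: "?J \<alpha> \<le> v" if \<alpha>: "\<alpha> \<in> control_measures D" for \<alpha>
  proof -
    have sp: "\<alpha> \<in> space ?U" using \<alpha> by (simp add: space_borel_control)
    have "return ?U \<alpha> \<in> strategies D" by (simp add: space_prob_algebra prob_space_return[OF sp])
    from best[OF this] show ?thesis
      using integral_return[OF sp payoff_measurable[OF \<mu>_in_G y]] by (simp add: v_def)
  qed
  obtain B where B: "\<And>y \<alpha>. y \<in> initial_set D \<Longrightarrow> \<alpha> \<in> control_measures D \<Longrightarrow> \<bar>payoff D \<mu> 0 y \<alpha>\<bar> \<le> B"
    by (rule payoff_bounded[OF \<mu>_in_G]) blast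
  have int: "integrable \<rho> ?J"
  proof (rule integrable_bounded[OF \<rho>.finite_measure_axioms])
    show "?J \<in> borel_measurable \<rho>"
      using payoff_measurable[OF \<mu>_in_G y] by (simp add: measurable_cong_sets[OF strategiesD(2)[OF \<rho>] refl])
    show "\<bar>?J \<alpha>\<bar> \<le> B" if "\<alpha> \<in> space \<rho>" for \<alpha> using that B[OF y] by (simp add: strategiesD(3)[OF \<rho>])
  qed
  have "(\<integral>\<alpha>. v - ?J \<alpha> \<partial>\<rho>) = 0" using int by (simp add: v_def \<rho>.prob_space)
  moreover have "AE \<alpha> in \<rho>. 0 \<le> v - ?J \<alpha>"
    by (rule AE_I2) (use le in \<open>simp add: strategiesD(3)[OF \<rho>]\<close>)
  ultimately have "AE \<alpha> in \<rho>. v - ?J \<alpha> = 0"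
    using integral_nonneg_eq_0_iff_AE[of \<rho> "\<lambda>\<alpha>. v - ?J \<alpha>"] int by simp
  have "\<exists>\<beta>\<in>space \<rho>. v - ?J \<beta> = 0"
  proof (rule ccontr)
    assume n: "\<not> ?thesis"
    have "AE \<alpha> in \<rho>. False"
      using \<open>AE \<alpha> in \<rho>. v - ?J \<alpha> = 0\<close> AE_space by eventually_elim (use n in blast)
    then show False by simp
  qed
  then obtain \<beta> where \<beta>: "\<beta> \<in> control_measures D" "?J \<beta> = v" by (auto simp: strategiesD(3)[OF \<rho>])
  have "val D \<mu> 0 y = v"
    unfolding val_def by (rule Greatest_equality) (use \<beta> le in auto)
  then show ?thesis using le[OF \<alpha>] by simp
qed

text \<open>The population is a product with \<open>[0, 1]\<close>, and a good second coordinate exists for almost every \<open>y\<close>.\<close>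

lemma value_attained_AE:
  "AE y in initial D. y \<in> initial_set D \<longrightarrow> (\<forall>\<alpha>\<in>control_measures D. payoff D \<mu> 0 y \<alpha> \<le> val D \<mu> 0 y)"
proof -
  let ?\<Omega> = "initial_set D \<times> {0..1::real}"
  let ?P = "\<lambda>y. y \<in> initial_set D \<longrightarrow> (\<forall>\<alpha>\<in>control_measures D. payoff D \<mu> 0 y \<alpha> \<le> val D \<mu> 0 y)"
  interpret m0: prob_space "initial D" using initial_P1 by (simp add: prob_measures1_def)
  interpret pair_sigma_finite "initial D" "lborel :: real measure" ..
  obtain \<kappa> where \<kappa>: "player_disintegration D \<gamma> \<kappa>" "AE \<omega> in players D. \<forall>\<rho>\<in>strategies D.
      (\<integral>\<alpha>. payoff D \<mu> 0 (fst \<omega>) \<alpha> \<partial>\<rho>) \<le> (\<integral>\<alpha>. payoff D \<mu> 0 (fst \<omega>) \<alpha> \<partial>\<kappa> \<omega>)"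
    using nash by (auto simp: nash_equilibrium_def)
  have \<kappa>m: "\<kappa> \<in> players D \<rightarrow>\<^sub>M prob_algebra (borel_of (control_topology D))"
    using \<kappa>(1) by (simp only: player_disintegration_def)
  have sets0: "sets (initial D) = sets borel" using initial_P1 by (simp add: prob_measures1_def)
  have \<Omega>: "?\<Omega> \<inter> space (initial D \<Otimes>\<^sub>M lborel) \<in> sets (initial D \<Otimes>\<^sub>M lborel)"
  proof (rule sets.Int[OF pair_measureI sets.top])
    show "initial_set D \<in> sets (initial D)" using compact_imp_closed[OF compact_initial_set] by (simp add: sets0)
  qed simp
  have "AE \<omega> in players D. ?P (fst \<omega>)"
    using \<kappa>(2) AE_space
  proof eventually_elim
    case (elim \<omega>)
    have \<kappa>\<omega>: "\<kappa> \<omega> \<in> strategies D"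
      by (rule measurable_space[OF \<kappa>m elim(2)])
    show ?case
    proof (intro impI ballI)
      fix \<alpha> assume y: "fst \<omega> \<in> initial_set D" and \<alpha>: "\<alpha> \<in> control_measures D"
      show "payoff D \<mu> 0 (fst \<omega>) \<alpha> \<le> val D \<mu> 0 (fst \<omega>)"
        by (rule value_attained[OF y \<kappa>\<omega> bspec[OF elim(1)] \<alpha>])
    qed
  qed
  then have "AE \<omega> in initial D \<Otimes>\<^sub>M lborel. \<omega> \<in> ?\<Omega> \<longrightarrow> ?P (fst \<omega>)"
    unfolding players_def AE_restrict_space_iff[OF \<Omega>] .
  from AE_pair[OF this] have "AE y in initial D. AE s in lborel. (y, s) \<in> ?\<Omega> \<longrightarrow> ?P y"
    unfolding fst_conv .
  then show ?thesis
  proof eventually_elim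
    case (elim y)
    show ?case
    proof (rule ccontr)
      assume n: "\<not> ?P y"
      have "AE s in lborel. s \<notin> {0..1::real}"
        using elim by eventually_elim (use n in blast)
      then have "{0..1::real} \<in> null_sets lborel" by (subst AE_iff_null_sets) auto
      then show False by (simp add: null_sets_def)
    qed
  qed
qed

end

section \<open>The induced profile\<close>

locale mean_field_splitting = mean_field_equilibrium D G L K \<gamma> \<mu> \<chi>\<^sub>0 \<Theta>
  for D :: "('x::euclidean_space, 'p::metric_space) mfg" and G :: "'x set" and L K :: real
    and \<gamma> :: "(('x \<times> real) \<times> (real \<times> 'p) measure) measure" and \<mu> :: "real \<Rightarrow> 'x measure"
    and \<chi>\<^sub>0 :: "'x \<Rightarrow> (real \<Rightarrow> 'x \<times> real) measure" and \<Theta> :: "(real \<Rightarrow> 'x \<times> real) \<Rightarrow> (real \<times> 'p) measure" +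
  fixes N :: nat and x :: "nat \<Rightarrow> 'x" and m :: "nat \<Rightarrow> 'x measure"
  assumes N: "1 \<le> N" and x: "\<And>i. i \<in> {1..N} \<Longrightarrow> x i \<in> initial_set D"
    and splitting: "optimal_splitting D N x m"
begin

lemma m_sets: "i \<in> {1..N} \<Longrightarrow> sets (m i) = sets borel"
  and m_initial_set: "i \<in> {1..N} \<Longrightarrow> emeasure (m i) (initial_set D) = ennreal (1 / N)"
  and m_sum: "A \<in> sets borel \<Longrightarrow> emeasure (initial D) A = (\<Sum>i=1..N. emeasure (m i) A)"
  using splitting unfolding optimal_splitting_def by blast+

lemma m_space: "i \<in> {1..N} \<Longrightarrow> space (m i) = UNIV"
  using sets_eq_imp_space_eq[OF m_sets] by simp

lemma initial_set_borel: "initial_set D \<in> sets borel"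
  using compact_imp_closed[OF compact_initial_set] by simp

lemma sets_initial: "sets (initial D) = sets borel"
  using initial_P1 by (simp add: prob_measures1_def)

lemma initial_full: "emeasure (initial D) (initial_set D) = 1"
proof -
  have "emeasure (initial D) (initial_set D) = (\<Sum>i=1..N. ennreal (1 / N))"
    unfolding m_sum[OF initial_set_borel] by (intro sum.cong refl m_initial_set)
  also have "\<dots> = ennreal (\<Sum>i=1..N. 1 / N)" by (rule sum_ennreal) simp
  also have "\<dots> = 1" using N by simp
  finally show ?thesis .
qed

lemma m_AE:
  assumes i: "i \<in> {1..N}" and P: "AE y in initial D. P y"
  shows "AE y in m i. P y"
proof -
  obtain A where A: "A \<in> null_sets (initial D)" "{y \<in> space (initial D). \<not> P y} \<subseteq> A"
    using P unfolding eventually_ae_filter by blast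
  have Ab: "A \<in> sets borel" using A(1) sets_initial by (simp add: null_sets_def)
  have "(\<Sum>i=1..N. emeasure (m i) A) = 0" using m_sum[OF Ab] A(1) by (simp add: null_sets_def)
  then have "emeasure (m i) A = 0" using i by (simp add: sum_eq_0_iff)
  then have "A \<in> null_sets (m i)" using Ab m_sets[OF i] by (simp add: null_sets_def)
  moreover have "space (m i) = space (initial D)"
    using sets_eq_imp_space_eq[OF m_sets[OF i]] sets_eq_imp_space_eq[OF sets_initial] by simp
  ultimately show ?thesis using A(2) unfolding eventually_ae_filter by auto
qed

lemma initial_AE: "AE y in initial D. y \<in> initial_set D"
  by (rule emeasure_eq_1_imp_AE(2)[OF _ initial_full])
    (use initial_P1 in \<open>simp add: prob_measures1_def\<close>)

lemma m_in_initial_set: "i \<in> {1..N} \<Longrightarrow> AE y in m i. y \<in> initial_set D"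
  by (rule m_AE[OF _ initial_AE])

lemma m_mass:
  assumes i: "i \<in> {1..N}" shows "emeasure (m i) (space (m i)) = ennreal (1 / N)"
proof -
  have "emeasure (m i) (space (m i)) = emeasure (m i) (initial_set D)"
  proof (rule emeasure_eq_AE)
    show "AE y in m i. (y \<in> space (m i)) = (y \<in> initial_set D)"
      using m_in_initial_set[OF i] AE_space by eventually_elim blast
  qed (simp_all add: m_sets[OF i] m_space[OF i] initial_set_borel)
  then show ?thesis by (simp only: m_initial_set[OF i])
qed

text \<open>The share of player \<open>i\<close> in the path distribution. The initial point \<open>fst (p 0)\<close> has law \<open>m i\<close>
  under it, so that \<open>p\<close> alone carries the coupling of \<open>m i\<close> with the chosen control measure.\<close>

definition \<pi> :: "nat \<Rightarrow> (real \<Rightarrow> 'x \<times> real) measure" where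
  "\<pi> i = bind (restrict_space (m i) (initial_set D)) \<chi>\<^sub>0"

text \<open>The contribution of player \<open>i\<close> to the optimal transport cost, expressed through paths.\<close>

definition transport :: "nat \<Rightarrow> real" where
  "transport i = (\<integral>p. norm (fst (p 0) - x i) \<partial>\<pi> i)"

lemma zero_in_time: "0 \<in> time D"
  using horizon_pos by simp

context
  fixes i assumes i: "i \<in> {1..N}"
begin

lemma restricted_space: "space (restrict_space (m i) (initial_set D)) = initial_set D"
  using sets_eq_imp_space_eq[OF m_sets[OF i]] by (simp add: space_restrict_space)

lemma restricted_kernel: "\<chi>\<^sub>0 \<in> restrict_space (m i) (initial_set D) \<rightarrow>\<^sub>M subprob_algebra paths"
proof -
  have "sets (restrict_space (m i) (initial_set D)) = sets (restrict_space borel (initial_set D))"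
    by (rule sets_restrict_space_cong[OF m_sets[OF i]])
  from measurable_cong_sets[OF this refl] show ?thesis
    using measurable_prob_algebraD[OF \<chi>\<^sub>0_kernel] by blast
qed

lemma restricted_nonempty: "space (restrict_space (m i) (initial_set D)) \<noteq> {}"
  using x[OF i] by (auto simp: restricted_space)

lemma sets_\<pi>: "sets (\<pi> i) = sets paths"
  unfolding \<pi>_def by (rule sets_bind[OF _ restricted_nonempty]) (simp only: restricted_space \<chi>\<^sub>0_sets)

lemma space_\<pi>: "space (\<pi> i) = space paths"
  by (rule sets_eq_imp_space_eq[OF sets_\<pi>])

lemma emeasure_\<pi>:
  assumes A: "A \<in> sets paths"
  shows "emeasure (\<pi> i) A = (\<integral>\<^sup>+y. emeasure (\<chi>\<^sub>0 y) A * indicator (initial_set D) y \<partial>m i)"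
proof -
  have G0: "initial_set D \<inter> space (m i) \<in> sets (m i)"
    by (simp add: m_sets[OF i] m_space[OF i] initial_set_borel)
  have "emeasure (\<pi> i) A = (\<integral>\<^sup>+y. emeasure (\<chi>\<^sub>0 y) A \<partial>restrict_space (m i) (initial_set D))"
    unfolding \<pi>_def by (rule emeasure_bind[OF restricted_nonempty restricted_kernel A])
  also have "\<dots> = (\<integral>\<^sup>+y. emeasure (\<chi>\<^sub>0 y) A * indicator (initial_set D) y \<partial>m i)"
    by (rule nn_integral_restrict_space[OF G0])
  finally show ?thesis .
qed

lemma path_measurable: "t \<in> time D \<Longrightarrow> (\<lambda>p. fst (p t)) \<in> borel_measurable (\<pi> i)"
  using eval_measurable by (simp only: measurable_cong_sets[OF sets_\<pi> refl])

lemma distr_start: "distr (\<pi> i) borel (\<lambda>p. fst (p 0)) = m i"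
proof (rule measure_eqI)
  show "sets (distr (\<pi> i) borel (\<lambda>p. fst (p 0))) = sets (m i)" by (simp add: m_sets[OF i])
  fix B assume "B \<in> sets (distr (\<pi> i) borel (\<lambda>p. fst (p 0)))"
  then have B: "B \<in> sets borel" by simp
  let ?A = "(\<lambda>p. fst (p 0)) -` B \<inter> space paths"
  have A: "?A \<in> sets paths" by (rule measurable_sets[OF eval_measurable[OF zero_in_time] B])
  have fib: "emeasure (\<chi>\<^sub>0 y) ?A * indicator (initial_set D) y = indicator (B \<inter> initial_set D) y" for y
  proof (cases "y \<in> initial_set D")
    case True
    have one: "emeasure (\<chi>\<^sub>0 y) (ext_trajs_from D (val D \<mu>) y \<mu>) = 1"
      using disintegration True unfolding path_disintegration_def by blast
    have space: "space (\<chi>\<^sub>0 y) = space paths" by (rule sets_eq_imp_space_eq[OF \<chi>\<^sub>0_sets[OF True]])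
    have "emeasure (\<chi>\<^sub>0 y) ?A = emeasure (\<chi>\<^sub>0 y) (if y \<in> B then space (\<chi>\<^sub>0 y) else {})"
    proof (rule emeasure_eq_AE)
      show "AE p in \<chi>\<^sub>0 y. (p \<in> ?A) = (p \<in> (if y \<in> B then space (\<chi>\<^sub>0 y) else {}))"
        using emeasure_eq_1_imp_AE(2)[OF \<chi>\<^sub>0_prob[OF True] one] AE_space
      proof eventually_elim
        case (elim p)
        then have "fst (p 0) = y" by (simp add: ext_trajs_from_def)
        then show ?case using elim(2) space by simp
      qed
    qed (use A \<chi>\<^sub>0_sets[OF True] space in simp_all)
    also have "\<dots> = indicator B y" using prob_space.emeasure_space_1[OF \<chi>\<^sub>0_prob[OF True]] by simp
    finally show ?thesis using True by (simp add: indicator_def)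
  qed simp
  have "emeasure (distr (\<pi> i) borel (\<lambda>p. fst (p 0))) B = emeasure (\<pi> i) ?A"
    using emeasure_distr[OF path_measurable[OF zero_in_time] B] by (simp only: space_\<pi>)
  also have "\<dots> = (\<integral>\<^sup>+y. indicator (B \<inter> initial_set D) y \<partial>m i)"
    unfolding emeasure_\<pi>[OF A] fib ..
  also have "\<dots> = emeasure (m i) (B \<inter> initial_set D)"
    by (rule nn_integral_indicator) (simp add: m_sets[OF i] B initial_set_borel sets.Int)
  also have "\<dots> = emeasure (m i) B"
  proof (rule emeasure_eq_AE)
    show "AE y in m i. (y \<in> B \<inter> initial_set D) = (y \<in> B)"
      using m_in_initial_set[OF i] by eventually_elim blast
  qed (simp_all add: m_sets[OF i] B initial_set_borel sets.Int)
  finally show "emeasure (distr (\<pi> i) borel (\<lambda>p. fst (p 0))) B = emeasure (m i) B" .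
qed

lemma \<pi>_mass: "emeasure (\<pi> i) (space (\<pi> i)) = ennreal (1 / N)"
proof -
  have "emeasure (\<pi> i) (space (\<pi> i)) = emeasure (distr (\<pi> i) borel (\<lambda>p. fst (p 0))) UNIV"
    by (subst emeasure_distr[OF path_measurable[OF zero_in_time]]) simp_all
  also have "UNIV = space (m i)" using sets_eq_imp_space_eq[OF m_sets[OF i]] by simp
  finally show ?thesis by (simp only: distr_start m_mass[OF i])
qed

lemma \<pi>_finite: "finite_measure (\<pi> i)"
  by (rule finite_measureI) (simp only: \<pi>_mass, simp)

lemma \<pi>_measure: "measure (\<pi> i) (space (\<pi> i)) = 1 / N"
  unfolding measure_def \<pi>_mass by simp

lemma \<pi>_AE:
  assumes "AE y in initial D. P y" shows "AE p in \<pi> i. P (fst (p 0))"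
proof (rule AE_distrD[OF path_measurable[OF zero_in_time]])
  show "AE y in distr (\<pi> i) borel (\<lambda>p. fst (p 0)). P y"
    unfolding distr_start by (rule m_AE[OF i assms])
qed

lemma start_in_initial_set: "AE p in \<pi> i. fst (p 0) \<in> initial_set D"
  by (rule \<pi>_AE[OF initial_AE])

lemma transport_integrable: "integrable (\<pi> i) (\<lambda>p. norm (fst (p 0) - x i))"
proof -
  obtain B where B: "\<And>z. z \<in> initial_set D \<Longrightarrow> norm z \<le> B"
    using compact_imp_bounded[OF compact_initial_set] unfolding bounded_iff by blast
  show ?thesis
  proof (rule finite_measure.integrable_const_bound[OF \<pi>_finite])
    show "AE p in \<pi> i. norm (norm (fst (p 0) - x i)) \<le> 2 * B"
      using start_in_initial_set
    proof eventually_elim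
      case (elim p)
      have "norm (fst (p 0) - x i) \<le> norm (fst (p 0)) + norm (x i)" by (rule norm_triangle_ineq4)
      then show ?case using B[OF elim] B[OF x[OF i]] by simp
    qed
    show "(\<lambda>p. norm (fst (p 0) - x i)) \<in> borel_measurable (\<pi> i)"
      using path_measurable[OF zero_in_time] by measurable
  qed
qed

lemma transport_eq:
  assumes A: "initial_set D \<subseteq> A" "A \<in> sets borel"
  shows "transport i = (LINT y:A|m i. norm (y - x i))"
proof -
  have "(LINT y:A|m i. norm (y - x i)) = (\<integral>y. norm (y - x i) \<partial>m i)"
    unfolding set_lebesgue_integral_def
  proof (rule integral_cong_AE)
    show "AE y in m i. indicator A y *\<^sub>R norm (y - x i) = norm (y - x i)"
      using m_in_initial_set[OF i] by eventually_elim (use A(1) in auto)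
  qed (use A(2) in \<open>simp_all add: measurable_cong_sets[OF m_sets[OF i] refl]\<close>)
  also have "\<dots> = (\<integral>y. norm (y - x i) \<partial>distr (\<pi> i) borel (\<lambda>p. fst (p 0)))" by (simp only: distr_start)
  also have "\<dots> = transport i"
    unfolding transport_def by (rule integral_distr[OF path_measurable[OF zero_in_time]]) measurable
  finally show ?thesis by simp
qed

abbreviation \<rho>\<^sub>0 :: "(real \<times> 'p) measure measure" where
  "\<rho>\<^sub>0 \<equiv> induced_profile D \<chi>\<^sub>0 \<Theta> N m i"

lemma \<Theta>_measurable: "\<Theta> \<in> \<pi> i \<rightarrow>\<^sub>M borel_of (control_topology D)"
  using selector unfolding control_selector_def measurable_cong_sets[OF sets_\<pi> refl] by blast

lemma profile_eq: "\<rho>\<^sub>0 = scale_measure (of_nat N) (distr (\<pi> i) (borel_of (control_topology D)) \<Theta>)"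
  by (simp only: induced_profile_def \<pi>_def)

lemma profile_strategy: "\<rho>\<^sub>0 \<in> strategies D"
proof -
  let ?U = "borel_of (control_topology D)"
  have "\<Theta> -` space ?U \<inter> space (\<pi> i) = space (\<pi> i)"
    using measurable_space[OF \<Theta>_measurable] by blast
  then have "emeasure (distr (\<pi> i) ?U \<Theta>) (space ?U) = ennreal (1 / N)"
    using emeasure_distr[OF \<Theta>_measurable sets.top] \<pi>_mass by simp
  then have "emeasure \<rho>\<^sub>0 (space \<rho>\<^sub>0) = of_nat N * ennreal (1 / N)"
    by (simp add: profile_eq space_scale_measure)
  also have "\<dots> = ennreal (real N * (1 / N))"
    by (simp only: ennreal_mult' ennreal_of_nat_eq_real_of_nat of_nat_0_le_iff)
  also have "\<dots> = 1" using N by simp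
  finally have "prob_space \<rho>\<^sub>0" by (rule prob_spaceI)
  then show ?thesis by (simp add: space_prob_algebra profile_eq)
qed

lemma profile_integral:
  fixes h :: "(real \<times> 'p) measure \<Rightarrow> real"
  assumes h: "h \<in> borel_measurable (borel_of (control_topology D))" "\<And>\<alpha>. \<alpha> \<in> control_measures D \<Longrightarrow> \<bar>h \<alpha>\<bar> \<le> B"
  shows "(\<integral>\<alpha>. h \<alpha> \<partial>\<rho>\<^sub>0) = N * (\<integral>p. h (\<Theta> p) \<partial>\<pi> i)"
proof -
  let ?d = "distr (\<pi> i) (borel_of (control_topology D)) \<Theta>"
  have "(\<integral>\<alpha>. h \<alpha> \<partial>\<rho>\<^sub>0) = (\<Sum>k\<in>{()}. real N * (\<integral>\<alpha>. h \<alpha> \<partial>?d))"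
  proof (rule integral_sum_of_measures)
    show "finite_measure ?d" by (rule finite_measure.finite_measure_distr[OF \<pi>_finite \<Theta>_measurable])
    show "emeasure \<rho>\<^sub>0 A = (\<Sum>k\<in>{()}. ennreal (real N) * emeasure ?d A)" for A
      by (simp add: profile_eq ennreal_of_nat_eq_real_of_nat)
    show "h \<in> borel_measurable \<rho>\<^sub>0"
      using h(1) measurable_cong_sets[OF strategiesD(2)[OF profile_strategy] refl] by blast
    show "\<bar>h \<alpha>\<bar> \<le> B" if "\<alpha> \<in> space \<rho>\<^sub>0" for \<alpha>
      using that h(2) strategiesD(3)[OF profile_strategy] by blast
  qed (simp_all add: profile_eq)
  also have "\<dots> = N * (\<integral>p. h (\<Theta> p) \<partial>\<pi> i)" by (simp add: integral_distr[OF \<Theta>_measurable h(1)])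
  finally show ?thesis .
qed

end

lemma \<mu>_as_sum:
  assumes t: "t \<in> time D" and \<phi>: "\<phi> \<in> borel_measurable borel" "\<And>y. \<bar>\<phi> y\<bar> \<le> (B::real)"
  shows "(\<integral>y. \<phi> y \<partial>\<mu> t) = (\<Sum>i=1..N. \<integral>p. \<phi> (fst (p t)) \<partial>\<pi> i)"
proof -
  let ?d = "\<lambda>i. distr (\<pi> i) borel (\<lambda>p. fst (p t))"
  have sets\<mu>: "sets (\<mu> t) = sets borel" using flow_P1[OF \<mu>_flow t] by (simp add: prob_measures1_def)
  have "(\<integral>y. \<phi> y \<partial>\<mu> t) = (\<Sum>i\<in>{1..N}. 1 * (\<integral>y. \<phi> y \<partial>?d i))"
  proof (rule integral_sum_of_measures)
    show "finite_measure (?d i)" if "i \<in> {1..N}" for i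
      by (rule finite_measure.finite_measure_distr[OF \<pi>_finite[OF that] path_measurable[OF that t]])
    show "emeasure (\<mu> t) A = (\<Sum>i\<in>{1..N}. ennreal 1 * emeasure (?d i) A)" if "A \<in> sets (\<mu> t)" for A
    proof -
      have A: "A \<in> sets borel" using that sets\<mu> by simp
      let ?A = "(\<lambda>p. fst (p t)) -` A \<inter> space paths"
      let ?g = "\<lambda>y. emeasure (\<chi>\<^sub>0 y) ?A * indicator (initial_set D) y"
      have A': "?A \<in> sets paths" by (rule measurable_sets[OF eval_measurable[OF t] A])
      have g: "?g \<in> borel_measurable borel"
      proof -
        have "(\<lambda>y. emeasure (\<chi>\<^sub>0 y) ?A) \<in> borel_measurable (restrict_space borel (initial_set D))"
          by (rule measurable_compose[OF measurable_prob_algebraD[OF \<chi>\<^sub>0_kernel] measurable_emeasure_subprob_algebra[OF A']])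
        then show ?thesis
          by (subst (asm) borel_measurable_restrict_space_iff_ennreal) (simp_all add: initial_set_borel)
      qed
      have "emeasure (\<mu> t) A = (\<integral>\<^sup>+y. ?g y \<partial>initial D)" by (rule \<mu>_disintegration[OF t A initial_full])
      also have "\<dots> = (\<Sum>i\<in>{1..N}. ennreal 1 * (\<integral>\<^sup>+y. ?g y \<partial>m i))"
      proof (rule nn_integral_sum_of_measures)
        show "sets (m i) = sets (initial D)" if "i \<in> {1..N}" for i using m_sets[OF that] sets_initial by simp
        show "emeasure (initial D) A = (\<Sum>i\<in>{1..N}. ennreal 1 * emeasure (m i) A)" if "A \<in> sets (initial D)" for A
          using m_sum[of A] that sets_initial by simp
        show "?g \<in> borel_measurable (initial D)" using g by (simp only: measurable_cong_sets[OF sets_initial refl])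
      qed
      also have "\<dots> = (\<Sum>i\<in>{1..N}. ennreal 1 * emeasure (?d i) A)"
      proof (rule sum.cong[OF refl])
        fix i assume i: "i \<in> {1..N}"
        show "ennreal 1 * (\<integral>\<^sup>+y. ?g y \<partial>m i) = ennreal 1 * emeasure (?d i) A"
          by (simp only: emeasure_distr[OF path_measurable[OF i t] A] space_\<pi>[OF i] emeasure_\<pi>[OF i A'])
      qed
      finally show ?thesis .
    qed
    show "\<phi> \<in> borel_measurable (\<mu> t)" using \<phi>(1) by (simp only: measurable_cong_sets[OF sets\<mu> refl])
    show "\<bar>\<phi> y\<bar> \<le> B" for y by (rule \<phi>(2))
  qed (simp_all add: sets\<mu>)
  also have "\<dots> = (\<Sum>i=1..N. \<integral>p. \<phi> (fst (p t)) \<partial>\<pi> i)"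
  proof (rule sum.cong[OF refl])
    fix i assume i: "i \<in> {1..N}"
    show "1 * (\<integral>y. \<phi> y \<partial>?d i) = (\<integral>p. \<phi> (fst (p t)) \<partial>\<pi> i)"
      by (simp only: integral_distr[OF path_measurable[OF i t] \<phi>(1)] mult_1)
  qed
  finally show ?thesis .
qed

end

context mean_field_splitting
begin

section \<open>Comparison with the mean field\<close>

lemma total_transport: "kantorovich (initial D) (empirical N x) = (\<Sum>i=1..N. transport i)"
proof -
  have "kantorovich (initial D) (empirical N x) = (\<Sum>i=1..N. LINT y:initial_set D|m i. norm (y - x i))"
    using splitting by (simp add: optimal_splitting_def)
  also have "\<dots> = (\<Sum>i=1..N. transport i)"
    by (rule sum.cong[OF refl]) (rule transport_eq[OF _ order_refl initial_set_borel, symmetric])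
  finally show ?thesis .
qed

lemma transport_nonneg: "0 \<le> transport i"
  unfolding transport_def by (rule integral_nonneg_AE) simp

text \<open>With \<open>B\<close> a bound of \<open>G\<close>, this bounds the weighted distance from \<open>\<mu>\<close> of the external field with one
  deviating player.\<close>

definition discrepancy :: "real \<Rightarrow> real" where
  "discrepancy B = 2 * (2 * kantorovich (initial D) (empirical N x) + 4 * B / N)"

context
  fixes j :: nat and \<rho> :: "(real \<times> 'p) measure measure" and B0 :: real
  assumes j: "j \<in> {1..N}" and \<rho>: "\<rho> \<in> strategies D"
    and B0: "0 \<le> B0" "\<And>z. z \<in> G \<Longrightarrow> norm z \<le> B0"
begin

abbreviation profile :: "nat \<Rightarrow> (real \<times> 'p) measure measure" where
  "profile \<equiv> (induced_profile D \<chi>\<^sub>0 \<Theta> N m)(j := \<rho>)"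

abbreviation field :: "real \<Rightarrow> 'x measure" where
  "field \<equiv> external_field D N x profile"

lemma profile_strategies: "i \<in> {1..N} \<Longrightarrow> profile i \<in> strategies D"
  using \<rho> profile_strategy by simp

lemma field_in_G: "field \<in> flows_in_G"
  by (rule external_field_char(1)[OF N x profile_strategies])

lemma field_flow: "field \<in> flows D"
  by (rule flows_in_GD(1)[OF field_in_G])

lemma initial_in_G: "initial_set D \<subseteq> G"
proof (rule initial_set_in_G)
  show "control_measures D \<noteq> {}"
    using prob_space.not_empty[OF strategiesD(1)[OF \<rho>]] strategiesD(3)[OF \<rho>] by simp
qed

lemma discrepancy_nonneg: "0 \<le> discrepancy B0"
  unfolding discrepancy_def total_transport using B0(1) by (simp add: sum_nonneg transport_nonneg)

lemma lipschitz_oscillation: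
  assumes \<phi>: "1-lipschitz_on UNIV (\<phi> :: 'x \<Rightarrow> real)" and z: "z \<in> G" "z' \<in> G"
  shows "\<phi> z \<le> \<phi> z' + 2 * B0"
proof -
  have "\<bar>\<phi> z - \<phi> z'\<bar> \<le> norm (z - z')" using lipschitz_onD[OF \<phi>, of z z'] by (simp add: dist_norm)
  also have "\<dots> \<le> norm z + norm z'" by (rule norm_triangle_ineq4)
  finally show ?thesis using B0(2)[OF z(1)] B0(2)[OF z(2)] by linarith
qed

text \<open>For a player that follows the profile, the path \<open>p\<close> and the player's trajectory under \<open>\<Theta> p\<close> are
  compared by \<open>traj_stability\<close>. The deviating player has weight \<open>1 / N\<close> in both measures, and
  \<open>\<phi>\<close> varies by at most \<open>2 * B0\<close> from its value at \<open>x j\<close>.\<close>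

lemma player_contribution:
  assumes i: "i \<in> {1..N}" and t: "t \<in> time D"
    and \<phi>: "1-lipschitz_on UNIV (\<phi> :: 'x \<Rightarrow> real)" "bounded (range \<phi>)"
    and c: "0 \<le> c" "\<And>t. t \<in> time D \<Longrightarrow> kantorovich (field t) (\<mu> t) \<le> c * growth t"
  shows "1 / N * (\<integral>\<alpha>. \<phi> (traj D field 0 (x i) \<alpha> t) \<partial>profile i) - (\<integral>p. \<phi> (fst (p t)) \<partial>\<pi> i)
    \<le> (2 * transport i + c / 2 * (1 / N)) * growth t + (if i = j then 4 * B0 / N * growth t else 0)"
proof -
  interpret \<pi>: finite_measure "\<pi> i" by (rule \<pi>_finite[OF i])
  have g1: "1 \<le> growth t" using t L_ge_1 by simp
  obtain R where R: "\<And>y. \<bar>\<phi> y\<bar> \<le> R" using \<phi>(2) by (auto simp: bounded_iff)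
  have \<phi>m: "\<phi> \<in> borel_measurable borel"
    by (rule borel_measurable_continuous_onI[OF lipschitz_on_continuous_on[OF \<phi>(1)]])
  have Xm: "(\<lambda>\<alpha>. \<phi> (traj D field 0 (x i) \<alpha> t)) \<in> borel_measurable (borel_of (control_topology D))"
    by (rule measurable_compose[OF traj_measurable[OF field_flow t] \<phi>m])
  have pm: "(\<lambda>p. \<phi> (fst (p t))) \<in> borel_measurable (\<pi> i)"
    by (rule measurable_compose[OF path_measurable[OF i t] \<phi>m])
  have pint: "integrable (\<pi> i) (\<lambda>p. \<phi> (fst (p t)))"
    by (rule integrable_bounded[OF \<pi>.finite_measure_axioms pm R])
  show ?thesis
  proof (cases "i = j")
    case False
    have Xint: "integrable (\<pi> i) (\<lambda>p. \<phi> (traj D field 0 (x i) (\<Theta> p) t))"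
      by (rule integrable_bounded[OF \<pi>.finite_measure_axioms measurable_compose[OF \<Theta>_measurable[OF i] Xm] R])
    have "(\<integral>\<alpha>. \<phi> (traj D field 0 (x i) \<alpha> t) \<partial>profile i) = N * (\<integral>p. \<phi> (traj D field 0 (x i) (\<Theta> p) t) \<partial>\<pi> i)"
      using False profile_integral[OF i Xm R] by simp
    then have "1 / N * (\<integral>\<alpha>. \<phi> (traj D field 0 (x i) \<alpha> t) \<partial>profile i) - (\<integral>p. \<phi> (fst (p t)) \<partial>\<pi> i)
        = (\<integral>p. \<phi> (traj D field 0 (x i) (\<Theta> p) t) - \<phi> (fst (p t)) \<partial>\<pi> i)"
      using N pint Xint by simp
    also have "\<dots> \<le> (\<integral>p. (2 * norm (fst (p 0) - x i) + c / 2) * growth t \<partial>\<pi> i)"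
    proof (rule integral_mono)
      show "integrable (\<pi> i) (\<lambda>p. \<phi> (traj D field 0 (x i) (\<Theta> p) t) - \<phi> (fst (p t)))"
        using Xint pint by simp
      show "integrable (\<pi> i) (\<lambda>p. (2 * norm (fst (p 0) - x i) + c / 2) * growth t)"
        using transport_integrable[OF i] by simp
      fix p assume "p \<in> space (\<pi> i)"
      then have p: "p \<in> space paths" by (simp only: space_\<pi>[OF i])
      have "\<phi> (traj D field 0 (x i) (\<Theta> p) t) - \<phi> (fst (p t)) \<le> norm (traj D field 0 (x i) (\<Theta> p) t - fst (p t))"
        using lipschitz_onD[OF \<phi>(1), of "traj D field 0 (x i) (\<Theta> p) t" "fst (p t)"]
        by (simp add: dist_norm abs_le_iff)
      also have "\<dots> = norm (traj D field 0 (x i) (\<Theta> p) t - traj D \<mu> 0 (fst (p 0)) (\<Theta> p) t)"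
        by (subst path_as_traj[OF p t]) (rule refl)
      also have "\<dots> \<le> (2 * norm (x i - fst (p 0)) + c / 2) * growth t"
        by (rule traj_stability[OF field_flow \<mu>_flow \<Theta>_control[OF p] c t])
      finally show "\<phi> (traj D field 0 (x i) (\<Theta> p) t) - \<phi> (fst (p t)) \<le> (2 * norm (fst (p 0) - x i) + c / 2) * growth t"
        by (simp only: norm_minus_commute)
    qed
    also have "\<dots> = (2 * transport i + c / 2 * (1 / N)) * growth t"
      using transport_integrable[OF i] by (simp add: transport_def \<pi>_measure[OF i])
    finally show ?thesis using False by simp
  next
    case True
    interpret \<rho>: prob_space \<rho> by (rule strategiesD(1)[OF \<rho>])
    define z where "z = x i"
    have z: "z \<in> G" using initial_in_G x[OF i] by (auto simp: z_def)
    have "(\<integral>\<alpha>. \<phi> (traj D field 0 (x i) \<alpha> t) \<partial>\<rho>) \<le> (\<integral>\<alpha>. \<phi> z + 2 * B0 \<partial>\<rho>)"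
    proof (rule integral_mono)
      show "integrable \<rho> (\<lambda>\<alpha>. \<phi> (traj D field 0 (x i) \<alpha> t))"
        by (rule integrable_bounded[OF \<rho>.finite_measure_axioms _ R])
          (use Xm in \<open>simp only: measurable_cong_sets[OF strategiesD(2)[OF \<rho>] refl]\<close>)
      show "\<phi> (traj D field 0 (x i) \<alpha> t) \<le> \<phi> z + 2 * B0" if "\<alpha> \<in> space \<rho>" for \<alpha>
        using that strategiesD(3)[OF \<rho>]
        by (intro lipschitz_oscillation[OF \<phi>(1)] z traj_in_G[OF field_flow _ x[OF i] t]) simp
    qed simp
    then have 1: "(\<integral>\<alpha>. \<phi> (traj D field 0 (x i) \<alpha> t) \<partial>\<rho>) \<le> \<phi> z + 2 * B0" by (simp add: \<rho>.prob_space)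
    have "(\<integral>p. \<phi> z - 2 * B0 \<partial>\<pi> i) \<le> (\<integral>p. \<phi> (fst (p t)) \<partial>\<pi> i)"
    proof (rule integral_mono_AE[OF _ pint])
      show "AE p in \<pi> i. \<phi> z - 2 * B0 \<le> \<phi> (fst (p t))"
        using start_in_initial_set[OF i] AE_space
      proof eventually_elim
        case (elim p)
        then have p: "p \<in> space paths" by (simp only: space_\<pi>[OF i])
        have "fst (p t) \<in> G"
          by (subst path_as_traj[OF p t]) (rule traj_in_G[OF \<mu>_flow \<Theta>_control[OF p] elim(1) t])
        then show ?case using lipschitz_oscillation[OF \<phi>(1) z] by fastforce
      qed
    qed simp
    then have 2: "1 / N * (\<phi> z - 2 * B0) \<le> (\<integral>p. \<phi> (fst (p t)) \<partial>\<pi> i)" by (simp add: \<pi>_measure[OF i])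
    have "1 / N * (\<integral>\<alpha>. \<phi> (traj D field 0 (x i) \<alpha> t) \<partial>profile i) \<le> 1 / N * (\<phi> z + 2 * B0)"
      using 1 True by (intro mult_left_mono) auto
    then have "1 / N * (\<integral>\<alpha>. \<phi> (traj D field 0 (x i) \<alpha> t) \<partial>profile i) - (\<integral>p. \<phi> (fst (p t)) \<partial>\<pi> i)
        \<le> 1 / N * (\<phi> z + 2 * B0) - 1 / N * (\<phi> z - 2 * B0)" using 2 by linarith
    also have "\<dots> = 4 * B0 / N * 1" using N by (simp add: field_simps)
    also have "\<dots> \<le> 4 * B0 / N * growth t" by (rule mult_left_mono[OF g1]) (use B0(1) in simp)
    also have "\<dots> \<le> (2 * transport i + c / 2 * (1 / N)) * growth t + 4 * B0 / N * growth t"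
      using transport_nonneg[of i] c(1) by simp
    finally show ?thesis using True by simp
  qed
qed

lemma field_contraction:
  assumes t: "t \<in> time D"
    and c: "0 \<le> c" "\<And>t. t \<in> time D \<Longrightarrow> kantorovich (field t) (\<mu> t) \<le> c * growth t"
  shows "kantorovich (field t) (\<mu> t) \<le> (2 * kantorovich (initial D) (empirical N x) + 4 * B0 / N + c / 2) * growth t"
proof (rule kantorovich_least_on_compact[OF compact_G flows_in_GD(2)[OF field_in_G t] flows_in_GD(2)[OF \<mu>_in_G t]])
  fix \<phi> :: "'x \<Rightarrow> real" assume \<phi>: "1-lipschitz_on UNIV \<phi>" "bounded (range \<phi>)"
  note cont = lipschitz_on_continuous_on[OF \<phi>(1)]
  obtain R where R: "\<And>y. \<bar>\<phi> y\<bar> \<le> R" using \<phi>(2) by (auto simp: bounded_iff)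
  let ?a = "\<lambda>i. 1 / N * (\<integral>\<alpha>. \<phi> (traj D field 0 (x i) \<alpha> t) \<partial>profile i)" and ?b = "\<lambda>i. \<integral>p. \<phi> (fst (p t)) \<partial>\<pi> i"
  have "(\<integral>y. \<phi> y \<partial>field t) = (\<Sum>i=1..N. ?a i)"
    using external_field_char(2)[OF N x profile_strategies t cont \<phi>(2)] by (simp only: sum_distrib_left)
  moreover have "(\<integral>y. \<phi> y \<partial>\<mu> t) = (\<Sum>i=1..N. ?b i)"
    by (rule \<mu>_as_sum[OF t borel_measurable_continuous_onI[OF cont] R])
  ultimately have "(\<integral>y. \<phi> y \<partial>field t) - (\<integral>y. \<phi> y \<partial>\<mu> t) = (\<Sum>i=1..N. ?a i - ?b i)"
    by (simp only: sum_subtractf)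
  also have "\<dots> \<le> (\<Sum>i=1..N. (2 * transport i + c / 2 * (1 / N)) * growth t + (if i = j then 4 * B0 / N * growth t else 0))"
    by (rule sum_mono) (rule player_contribution[OF _ t \<phi> c])
  also have "\<dots> = (2 * (\<Sum>i=1..N. transport i) + (\<Sum>i=1..N. c / 2 * (1 / N))) * growth t + 4 * B0 / N * growth t"
    using j by (simp only: sum.distrib sum_distrib_right[symmetric] sum_distrib_left[symmetric] sum.delta finite_atLeastAtMost if_True)
  also have "(\<Sum>i=1..N. c / 2 * (1 / N)) = c / 2" using N by simp
  also have "(p + q) * g + r * g = (p + r + q) * g" for p q r g :: real by (simp add: algebra_simps)
  finally show "(\<integral>y. \<phi> y \<partial>field t) - (\<integral>y. \<phi> y \<partial>\<mu> t) \<le>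
      (2 * kantorovich (initial D) (empirical N x) + 4 * B0 / N + c / 2) * growth t"
    unfolding total_transport .
qed

text \<open>\<open>field_contraction\<close> bounds the distance in terms of itself with a factor 1/2.\<close>

lemma field_estimate:
  assumes t: "t \<in> time D"
  shows "kantorovich (field t) (\<mu> t) \<le> discrepancy B0 * growth t"
  unfolding discrepancy_def
proof (rule halving_bound[where K = "time D" and h = "\<lambda>t. kantorovich (field t) (\<mu> t)" and ?c0.0 = "2 * B0"])
  show "kantorovich (field t) (\<mu> t) \<le> 2 * B0 * growth t" if t: "t \<in> time D" for t
  proof -
    have "kantorovich (field t) (\<mu> t) \<le> 2 * B0"
    proof (rule kantorovich_least)
      fix \<phi> :: "'x \<Rightarrow> real" assume \<phi>: "1-lipschitz_on UNIV \<phi>"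
      have P: "prob_space (field t)" "prob_space (\<mu> t)" "field t \<in> prob_measures1" "\<mu> t \<in> prob_measures1"
        "emeasure (field t) G = 1" "emeasure (\<mu> t) G = 1"
        using flows_in_GD(2)[OF field_in_G t] flows_in_GD(2)[OF \<mu>_in_G t]
        by (auto simp: prob_measures_on_def prob_measures1_def)
      interpret f: prob_space "field t" by (rule P(1))
      interpret u: prob_space "\<mu> t" by (rule P(2))
      have "(\<integral>y. \<phi> y \<partial>field t) \<le> \<phi> z + 2 * B0" if z: "z \<in> G" for z
      proof -
        have "(\<integral>y. \<phi> y \<partial>field t) \<le> (\<integral>y. \<phi> z + 2 * B0 \<partial>field t)"
        proof (rule integral_mono_AE[OF lipschitz_integrable[OF P(3) \<phi>]])
          show "AE y in field t. \<phi> y \<le> \<phi> z + 2 * B0"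
            using emeasure_eq_1_imp_AE(2)[OF P(1,5)] by eventually_elim (rule lipschitz_oscillation[OF \<phi> _ z])
        qed simp
        then show ?thesis by (simp add: f.prob_space)
      qed
      then have le: "(\<integral>y. \<phi> y \<partial>field t) - 2 * B0 \<le> \<phi> z" if "z \<in> G" for z
        using that by (simp add: diff_le_eq)
      have "(\<integral>z. (\<integral>y. \<phi> y \<partial>field t) - 2 * B0 \<partial>\<mu> t) \<le> (\<integral>z. \<phi> z \<partial>\<mu> t)"
      proof (rule integral_mono_AE[OF _ lipschitz_integrable[OF P(4) \<phi>]])
        show "AE z in \<mu> t. (\<integral>y. \<phi> y \<partial>field t) - 2 * B0 \<le> \<phi> z"
          using emeasure_eq_1_imp_AE(2)[OF P(2,6)] by eventually_elim (rule le)
      qed simp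
      then show "(\<integral>y. \<phi> y \<partial>field t) - (\<integral>y. \<phi> y \<partial>\<mu> t) \<le> 2 * B0" by (simp add: u.prob_space)
    qed
    also have "\<dots> = 2 * B0 * 1" by simp
    also have "\<dots> \<le> 2 * B0 * growth t" using t B0(1) L_ge_1 by (intro mult_left_mono) auto
    finally show ?thesis .
  qed
  show "0 \<le> 2 * kantorovich (initial D) (empirical N x) + 4 * B0 / N"
    using discrepancy_nonneg by (simp add: discrepancy_def)
qed (use t field_contraction in auto)

end

section \<open>The gain of a deviation\<close>

text \<open>For almost every path \<open>p\<close> and every control measure \<open>\<alpha>\<close>, pass from the payoff of \<open>\<alpha>\<close> in the perturbed
  field at \<open>x j\<close> to the mean field at \<open>fst (p 0)\<close>, replace \<open>\<alpha>\<close> by the optimal \<open>\<Theta> p\<close>, and pass to the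
  field of the profile at \<open>x j\<close>. Averaging \<open>\<alpha>\<close> under \<open>\<rho>\<close> and \<open>p\<close> under \<open>\<pi> j\<close> gives the claim.\<close>

lemma deviation_bound:
  assumes j: "j \<in> {1..N}" and \<rho>: "\<rho> \<in> strategies D"
    and B0: "0 \<le> B0" "\<And>z. z \<in> G \<Longrightarrow> norm z \<le> B0"
  shows "outcome D N x j ((induced_profile D \<chi>\<^sub>0 \<Theta> N m)(j := \<rho>)) \<le> outcome D N x j (induced_profile D \<chi>\<^sub>0 \<Theta> N m)
    + 2 * payoff_const * (N * transport j + discrepancy B0)"
proof -
  let ?\<rho>0 = "induced_profile D \<chi>\<^sub>0 \<Theta> N m"
  let ?\<nu>' = "external_field D N x (?\<rho>0(j := \<rho>))" and ?\<nu> = "external_field D N x ?\<rho>0"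
  let ?C = payoff_const and ?d = "discrepancy B0"
  have \<rho>0: "?\<rho>0 j \<in> strategies D" by (rule profile_strategy[OF j])
  have upd: "?\<rho>0(j := ?\<rho>0 j) = ?\<rho>0" by (rule fun_upd_triv)
  have \<nu>': "?\<nu>' \<in> flows_in_G" by (rule field_in_G[OF j \<rho> B0])
  have \<nu>: "?\<nu> \<in> flows_in_G" using field_in_G[OF j \<rho>0 B0] by (simp only: upd)
  have W': "kantorovich (?\<nu>' t) (\<mu> t) \<le> ?d * growth t" if "t \<in> time D" for t
    by (rule field_estimate[OF j \<rho> B0 that])
  have W: "kantorovich (?\<nu> t) (\<mu> t) \<le> ?d * growth t" if "t \<in> time D" for t
    using field_estimate[OF j \<rho>0 B0 that] by (simp only: upd)
  have d: "0 \<le> ?d" by (rule discrepancy_nonneg[OF j \<rho> B0])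
  interpret \<rho>: prob_space \<rho> by (rule strategiesD(1)[OF \<rho>])
  obtain B' where B': "\<And>y \<alpha>. y \<in> initial_set D \<Longrightarrow> \<alpha> \<in> control_measures D \<Longrightarrow> \<bar>payoff D ?\<nu>' 0 y \<alpha>\<bar> \<le> B'"
    by (rule payoff_bounded[OF \<nu>']) blast
  obtain B where B: "\<And>y \<alpha>. y \<in> initial_set D \<Longrightarrow> \<alpha> \<in> control_measures D \<Longrightarrow> \<bar>payoff D ?\<nu> 0 y \<alpha>\<bar> \<le> B"
    by (rule payoff_bounded[OF \<nu>]) blast
  let ?O = "outcome D N x j (?\<rho>0(j := \<rho>))"
  have O: "?O = (\<integral>\<alpha>. payoff D ?\<nu>' 0 (x j) \<alpha> \<partial>\<rho>)" by (simp add: outcome_def)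
  have int': "integrable \<rho> (\<lambda>\<alpha>. payoff D ?\<nu>' 0 (x j) \<alpha>)"
  proof (rule integrable_bounded[OF \<rho>.finite_measure_axioms])
    show "(\<lambda>\<alpha>. payoff D ?\<nu>' 0 (x j) \<alpha>) \<in> borel_measurable \<rho>"
      using payoff_measurable[OF \<nu>' x[OF j]] by (simp only: measurable_cong_sets[OF strategiesD(2)[OF \<rho>] refl])
    show "\<bar>payoff D ?\<nu>' 0 (x j) \<alpha>\<bar> \<le> B'" if "\<alpha> \<in> space \<rho>" for \<alpha>
      using B'[OF x[OF j]] that strategiesD(3)[OF \<rho>] by blast
  qed
  let ?r = "\<lambda>p. payoff D ?\<nu> 0 (x j) (\<Theta> p) + 2 * ?C * (norm (fst (p 0) - x j) + ?d)"
  have pathwise: "AE p in \<pi> j. ?O \<le> ?r p"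
    using \<pi>_AE[OF j value_attained_AE] start_in_initial_set[OF j] AE_space
  proof eventually_elim
    case (elim p)
    let ?y = "fst (p 0)"
    have p: "p \<in> space paths" using elim(3) by (simp only: space_\<pi>[OF j])
    have le: "payoff D ?\<nu>' 0 (x j) \<alpha> \<le> ?r p" if \<alpha>: "\<alpha> \<in> control_measures D" for \<alpha>
    proof -
      have "\<bar>payoff D ?\<nu>' 0 (x j) \<alpha> - payoff D \<mu> 0 ?y \<alpha>\<bar> \<le> ?C * (norm (x j - ?y) + ?d)"
        by (rule payoff_stability[OF \<nu>' \<mu>_in_G \<alpha> x[OF j] elim(2) d W'])
      moreover have "\<bar>payoff D ?\<nu> 0 (x j) (\<Theta> p) - payoff D \<mu> 0 ?y (\<Theta> p)\<bar> \<le> ?C * (norm (x j - ?y) + ?d)"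
        by (rule payoff_stability[OF \<nu> \<mu>_in_G \<Theta>_control[OF p] x[OF j] elim(2) d W])
      moreover have "payoff D \<mu> 0 ?y \<alpha> \<le> payoff D \<mu> 0 ?y (\<Theta> p)"
        unfolding selected_control_payoff[OF p] using elim(1,2) \<alpha> by blast
      moreover have "2 * ?C * (norm (?y - x j) + ?d) = ?C * (norm (x j - ?y) + ?d) + ?C * (norm (x j - ?y) + ?d)"
        by (simp add: norm_minus_commute)
      ultimately show ?thesis by linarith
    qed
    have "?O \<le> (\<integral>\<alpha>. ?r p \<partial>\<rho>)"
      unfolding O by (rule integral_mono[OF int']) (use le strategiesD(3)[OF \<rho>] in auto)
    then show ?case by (simp add: \<rho>.prob_space)
  qed
  have Jint: "integrable (\<pi> j) (\<lambda>p. payoff D ?\<nu> 0 (x j) (\<Theta> p))"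
  proof (rule integrable_bounded[OF \<pi>_finite[OF j]])
    show "(\<lambda>p. payoff D ?\<nu> 0 (x j) (\<Theta> p)) \<in> borel_measurable (\<pi> j)"
      by (rule measurable_compose[OF \<Theta>_measurable[OF j] payoff_measurable[OF \<nu> x[OF j]]])
    show "\<bar>payoff D ?\<nu> 0 (x j) (\<Theta> p)\<bar> \<le> B" if "p \<in> space (\<pi> j)" for p
      using B[OF x[OF j] \<Theta>_control] that by (simp only: space_\<pi>[OF j])
  qed
  interpret \<pi>: finite_measure "\<pi> j" by (rule \<pi>_finite[OF j])
  have rint: "integrable (\<pi> j) ?r" using Jint transport_integrable[OF j] by simp
  have "(\<integral>p. ?O \<partial>\<pi> j) \<le> (\<integral>p. ?r p \<partial>\<pi> j)"
    by (rule integral_mono_AE[OF _ rint pathwise]) simp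
  also have "(\<integral>p. ?O \<partial>\<pi> j) = ?O / N" by (simp add: \<pi>_measure[OF j])
  also have "(\<integral>p. ?r p \<partial>\<pi> j) = (\<integral>p. payoff D ?\<nu> 0 (x j) (\<Theta> p) \<partial>\<pi> j) + 2 * ?C * (transport j + ?d / N)"
    using Jint transport_integrable[OF j] by (simp add: transport_def \<pi>_measure[OF j])
  finally have "?O / N \<le> (\<integral>p. payoff D ?\<nu> 0 (x j) (\<Theta> p) \<partial>\<pi> j) + 2 * ?C * (transport j + ?d / N)" .
  then have "N * (?O / N) \<le> N * ((\<integral>p. payoff D ?\<nu> 0 (x j) (\<Theta> p) \<partial>\<pi> j) + 2 * ?C * (transport j + ?d / N))"
    by (rule mult_left_mono) simp
  moreover have "outcome D N x j ?\<rho>0 = N * (\<integral>p. payoff D ?\<nu> 0 (x j) (\<Theta> p) \<partial>\<pi> j)"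
    unfolding outcome_def by (rule profile_integral[OF j payoff_measurable[OF \<nu> x[OF j]] B[OF x[OF j]]])
  moreover have "N * (?O / N) = ?O" using N by simp
  moreover have "N * (a + 2 * C * (T + d / N)) = N * a + 2 * C * (N * T + d)" for a C T d :: real
    using N by (simp add: field_simps)
  ultimately show ?thesis by (simp only:)
qed

text \<open>The summands 1 make the constants positive also if the payoffs are constant.\<close>

lemma deviation_gain:
  assumes j: "j \<in> {1..N}" and \<rho>: "\<rho> \<in> strategies D"
    and B0: "0 \<le> B0" "\<And>z. z \<in> G \<Longrightarrow> norm z \<le> B0"
  shows "outcome D N x j ((induced_profile D \<chi>\<^sub>0 \<Theta> N m)(j := \<rho>))
    - (8 * payoff_const + 1) * kantorovich (initial D) (empirical N x)
    - (2 * payoff_const + 1) * (N * Max ((\<lambda>i. LINT y:G|m i. norm (y - x i)) ` {1..N}))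
    - (16 * payoff_const * B0 + 1) * (1 / N) \<le> outcome D N x j (induced_profile D \<chi>\<^sub>0 \<Theta> N m)"
proof -
  let ?C = payoff_const and ?W = "kantorovich (initial D) (empirical N x)"
  let ?M = "Max ((\<lambda>i. LINT y:G|m i. norm (y - x i)) ` {1..N})"
  have Gb: "G \<in> sets borel" using compact_imp_closed[OF compact_G] by simp
  have "transport j = (LINT y:G|m j. norm (y - x j))"
    by (rule transport_eq[OF j initial_in_G[OF j \<rho> B0] Gb])
  also have "\<dots> \<le> ?M" by (rule Max_ge) (use j in auto)
  finally have T: "N * transport j \<le> N * ?M" by (rule mult_left_mono) simp
  have W0: "0 \<le> ?W" unfolding total_transport by (intro sum_nonneg transport_nonneg)
  have M0: "0 \<le> N * ?M" by (rule order_trans[OF _ T]) (simp add: transport_nonneg)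
  have "2 * ?C * (N * transport j + discrepancy B0) \<le> 2 * ?C * (N * ?M + discrepancy B0)"
    by (rule mult_left_mono) (use T payoff_const_nonneg in auto)
  also have "\<dots> = 8 * ?C * ?W + 2 * ?C * (N * ?M) + 16 * ?C * B0 * (1 / N)"
    unfolding discrepancy_def by (simp add: distrib_left)
  also have "\<dots> \<le> (8 * ?C + 1) * ?W + (2 * ?C + 1) * (N * ?M) + (16 * ?C * B0 + 1) * (1 / N)"
    using W0 M0 by (simp only: distrib_right mult_1) simp
  finally show ?thesis using deviation_bound[OF j \<rho> B0] by linarith
qed

end

text \<open>The separate Lipschitz constants are replaced by their maximum.\<close>

lemma mean_field_game_of_setting:
  assumes "mfg_setting D G"
  obtains L K where "mean_field_game D G L K"
proof -
  have "\<exists>L. \<forall>t\<in>time D. \<forall>x' x''. \<forall>m\<in>prob_measures1. \<forall>u\<in>controls D.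
      norm (dynam D t x' m u - dynam D t x'' m u) \<le> L * norm (x' - x'')"
    using assms unfolding mfg_setting_def by (elim conjE) assumption
  then obtain Lx where Lx: "\<And>t x' x'' m u. t \<in> time D \<Longrightarrow> m \<in> prob_measures1 \<Longrightarrow> u \<in> controls D \<Longrightarrow>
      norm (dynam D t x' m u - dynam D t x'' m u) \<le> Lx * norm (x' - x'')"
    by blast
  have "\<exists>L. \<forall>t\<in>time D. \<forall>x. \<forall>m'\<in>prob_measures1. \<forall>m''\<in>prob_measures1. \<forall>u\<in>controls D.
      norm (dynam D t x m' u - dynam D t x m'' u) \<le> L * kantorovich m' m''"
    using assms unfolding mfg_setting_def by (elim conjE) assumption
  then obtain Lm where Lm: "\<And>t x m' m'' u. t \<in> time D \<Longrightarrow> m' \<in> prob_measures1 \<Longrightarrow> m'' \<in> prob_measures1 \<Longrightarrow> u \<in> controls D \<Longrightarrow>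
      norm (dynam D t x m' u - dynam D t x m'' u) \<le> Lm * kantorovich m' m''"
    by blast
  have "\<exists>Lx Lm. \<forall>x'\<in>G. \<forall>x''\<in>G. \<forall>m'\<in>prob_measures_on G. \<forall>m''\<in>prob_measures_on G.
      \<bar>terminal D x' m' - terminal D x'' m''\<bar> \<le> Lx * norm (x' - x'') + Lm * kantorovich m' m''"
    using assms unfolding mfg_setting_def by (elim conjE) assumption
  then obtain Sx Sm where S: "\<And>x' x'' m' m''. x' \<in> G \<Longrightarrow> x'' \<in> G \<Longrightarrow> m' \<in> prob_measures_on G \<Longrightarrow> m'' \<in> prob_measures_on G \<Longrightarrow>
      \<bar>terminal D x' m' - terminal D x'' m''\<bar> \<le> Sx * norm (x' - x'') + Sm * kantorovich m' m''"
    by blast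
  have "\<exists>Lx Lm. \<forall>t\<in>time D. \<forall>x'\<in>G. \<forall>x''\<in>G.
      \<forall>m'\<in>prob_measures_on G. \<forall>m''\<in>prob_measures_on G. \<forall>u\<in>controls D.
      \<bar>running D t x' m' u - running D t x'' m'' u\<bar> \<le> Lx * norm (x' - x'') + Lm * kantorovich m' m''"
    using assms unfolding mfg_setting_def by (elim conjE) assumption
  then obtain Gx Gm where R: "\<And>t x' x'' m' m'' u. t \<in> time D \<Longrightarrow> x' \<in> G \<Longrightarrow> x'' \<in> G \<Longrightarrow> m' \<in> prob_measures_on G \<Longrightarrow>
      m'' \<in> prob_measures_on G \<Longrightarrow> u \<in> controls D \<Longrightarrow>
      \<bar>running D t x' m' u - running D t x'' m'' u\<bar> \<le> Gx * norm (x' - x'') + Gm * kantorovich m' m''"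
    by blast
  define L where "L = max 1 (max Lx Lm)"
  define K where "K = max (max 0 (max Sx Sm)) (max Gx Gm)"
  have pos: "0 \<le> kantorovich m m'" if "m \<in> prob_measures1" "m' \<in> prob_measures1" for m m' :: "'a measure"
    using kantorovich_upper[OF that, of "\<lambda>_. 0"] by (auto simp: lipschitz_on_def)
  have posG: "0 \<le> kantorovich m m'" if "m \<in> prob_measures_on G" "m' \<in> prob_measures_on G" for m m'
    using that pos by (simp add: prob_measures_on_def)
  have comb: "a * r + b * s \<le> k * (r + s)" if "a \<le> k" "b \<le> k" "0 \<le> r" "0 \<le> s" for a b k r s :: real
    using mult_right_mono[OF that(1,3)] mult_right_mono[OF that(2,4)] by (simp add: distrib_left)
  have "mean_field_game D G L K"
  proof
    show "norm (dynam D t x m u - dynam D t x' m' u) \<le> L * (norm (x - x') + kantorovich m m')"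
      if t: "t \<in> time D" and m: "m \<in> prob_measures1" "m' \<in> prob_measures1" and u: "u \<in> controls D" for t x x' m m' u
    proof -
      have "norm (dynam D t x m u - dynam D t x' m' u) \<le> norm (dynam D t x m u - dynam D t x' m u) + norm (dynam D t x' m u - dynam D t x' m' u)"
        by (rule norm_diff_triangle_le[OF order_refl order_refl])
      also have "\<dots> \<le> Lx * norm (x - x') + Lm * kantorovich m m'"
        by (rule add_mono[OF Lx[OF t m(1) u] Lm[OF t m u]])
      also have "\<dots> \<le> L * (norm (x - x') + kantorovich m m')"
        by (rule comb) (use pos[OF m] in \<open>auto simp: L_def\<close>)
      finally show ?thesis .
    qed
    show "\<bar>terminal D x m - terminal D x' m'\<bar> \<le> K * (norm (x - x') + kantorovich m m')"
      if "x \<in> G" "x' \<in> G" "m \<in> prob_measures_on G" "m' \<in> prob_measures_on G" for x x' m m'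
      by (rule order_trans[OF S[OF that] comb]) (use posG[OF that(3,4)] in \<open>auto simp: K_def\<close>)
    show "\<bar>running D t x m u - running D t x' m' u\<bar> \<le> K * (norm (x - x') + kantorovich m m')"
      if "t \<in> time D" "x \<in> G" "x' \<in> G" "m \<in> prob_measures_on G" "m' \<in> prob_measures_on G" "u \<in> controls D" for t x x' m m' u
      by (rule order_trans[OF R[OF that] comb]) (use posG[OF that(4,5)] in \<open>auto simp: K_def\<close>)
    show "1 \<le> L" "0 \<le> K" by (simp_all add: L_def K_def)
  qed (rule assms)
  then show thesis by (rule that)
qed

section \<open>The approximate equilibrium\<close>

theorem theorem3:
  fixes D :: "(real ^ 'n, 'p::metric_space) mfg"
    and G :: "(real ^ 'n) set"
    and \<gamma> :: "(((real ^ 'n) \<times> real) \<times> (real \<times> 'p) measure) measure"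
    and \<mu> :: "real \<Rightarrow> (real ^ 'n) measure"
    and \<chi>\<^sub>0 :: "(real ^ 'n) \<Rightarrow> (real \<Rightarrow> (real ^ 'n) \<times> real) measure"
    and \<Theta> :: "(real \<Rightarrow> (real ^ 'n) \<times> real) \<Rightarrow> (real \<times> 'p) measure"
  assumes "mfg_setting D G"
    and "nash_equilibrium D \<gamma> \<mu>"
    and "path_disintegration D \<gamma> \<mu> \<chi>\<^sub>0"
    and "control_selector D \<mu> \<Theta>"
  shows "(\<exists>C1>0. \<exists>C2>0. \<exists>C3>0. \<forall>N\<ge>1. \<forall>x m.
            (\<forall>i\<in>{1..N}. x i \<in> initial_set D) \<and> optimal_splitting D N x m \<longrightarrow>
            (\<forall>j\<in>{1..N}. \<forall>\<rho>\<in>strategies D.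
               outcome D N x j (induced_profile D \<chi>\<^sub>0 \<Theta> N m)
                 \<ge> outcome D N x j ((induced_profile D \<chi>\<^sub>0 \<Theta> N m)(j := \<rho>))
                   - C1 * kantorovich (initial D) (empirical N x)
                   - C2 * (N * Max ((\<lambda>i. LINT y:G|m i. norm (y - x i)) ` {1..N}))
                   - C3 * (1 / N)))
       \<and> (\<forall>x m. (\<forall>N\<ge>1. (\<forall>i\<in>{1..N}. x N i \<in> initial_set D) \<and> optimal_splitting D N (x N) (m N)) \<and>
            (\<lambda>N. kantorovich (initial D) (empirical N (x N))) \<longlonglongrightarrow> 0 \<and>
            (\<lambda>N. N * Max ((\<lambda>i. LINT y:G|m N i. norm (y - x N i)) ` {1..N})) \<longlonglongrightarrow> 0 \<longrightarrow>
            (\<forall>\<epsilon>>0. \<exists>N0. \<forall>N>N0. eps_nash D N (x N) \<epsilon> (induced_profile D \<chi>\<^sub>0 \<Theta> N (m N))))"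
proof -
  obtain L K where LK: "mean_field_game D G L K" by (rule mean_field_game_of_setting[OF assms(1)])
  interpret mean_field_game D G L K by (rule LK)
  interpret mean_field_equilibrium D G L K \<gamma> \<mu> \<chi>\<^sub>0 \<Theta> by standard (rule assms)+
  obtain B0 where B0: "0 \<le> B0" "\<And>z. z \<in> G \<Longrightarrow> norm z \<le> B0" by (rule G_bound) blast
  define C1 where "C1 = 8 * payoff_const + 1"
  define C2 where "C2 = 2 * payoff_const + 1"
  define C3 where "C3 = 16 * payoff_const * B0 + 1"
  have C: "0 < C1" "0 < C2" "0 < C3"
    using payoff_const_nonneg B0(1) by (simp_all add: C1_def C2_def C3_def add_nonneg_pos)
  have main: "outcome D N x j ((induced_profile D \<chi>\<^sub>0 \<Theta> N m)(j := \<rho>))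
        - C1 * kantorovich (initial D) (empirical N x)
        - C2 * (N * Max ((\<lambda>i. LINT y:G|m i. norm (y - x i)) ` {1..N})) - C3 * (1 / N)
      \<le> outcome D N x j (induced_profile D \<chi>\<^sub>0 \<Theta> N m)"
    if N: "1 \<le> N" and x: "\<forall>i\<in>{1..N}. x i \<in> initial_set D" and m: "optimal_splitting D N x m"
      and j: "j \<in> {1..N}" and \<rho>: "\<rho> \<in> strategies D" for N x m j \<rho>
  proof -
    interpret mean_field_splitting D G L K \<gamma> \<mu> \<chi>\<^sub>0 \<Theta> N x m
      by standard (use N x m in auto)
    show ?thesis unfolding C1_def C2_def C3_def by (rule deviation_gain[OF j \<rho> B0])
  qed
  show ?thesis
  proof (intro conjI, goal_cases)
    case 1
    show ?case
      by (intro exI[of _ C1] exI[of _ C2] exI[of _ C3] conjI C allI impI ballI, elim conjE, rule main)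
  next
    case 2
    show ?case
    proof (intro allI impI, elim conjE)
      fix x m and \<epsilon> :: real
      assume xm: "\<forall>N\<ge>1. (\<forall>i\<in>{1..N}. x N i \<in> initial_set D) \<and> optimal_splitting D N (x N) (m N)"
        and W: "(\<lambda>N. kantorovich (initial D) (empirical N (x N))) \<longlonglongrightarrow> 0"
        and M: "(\<lambda>N. N * Max ((\<lambda>i. LINT y:G|m N i. norm (y - x N i)) ` {1..N})) \<longlonglongrightarrow> 0"
        and \<epsilon>: "0 < \<epsilon>"
      let ?W = "\<lambda>N. kantorovich (initial D) (empirical N (x N))"
        and ?M = "\<lambda>N. N * Max ((\<lambda>i. LINT y:G|m N i. norm (y - x N i)) ` {1..N})"
      have "(\<lambda>N. C1 * ?W N + C2 * ?M N + C3 * (1 / real N)) \<longlonglongrightarrow> C1 * 0 + C2 * 0 + C3 * 0"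
        by (intro tendsto_intros W M lim_1_over_n)
      then have "\<forall>\<^sub>F N in sequentially. C1 * ?W N + C2 * ?M N + C3 * (1 / real N) < \<epsilon>"
        using order_tendstoD(2)[of _ "C1 * 0 + C2 * 0 + C3 * 0" sequentially \<epsilon>] \<epsilon> by simp
      then obtain N0 where N0: "\<And>N. N \<ge> N0 \<Longrightarrow> C1 * ?W N + C2 * ?M N + C3 * (1 / real N) < \<epsilon>"
        unfolding eventually_sequentially by blast
      have "eps_nash D N (x N) \<epsilon> (induced_profile D \<chi>\<^sub>0 \<Theta> N (m N))" if N: "N > N0" for N
        unfolding eps_nash_def
      proof (intro ballI)
        fix j \<rho> assume j: "j \<in> {1..N}" and \<rho>: "\<rho> \<in> strategies D"
        have "1 \<le> N" "N0 \<le> N" using N by simp_all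
        then show "outcome D N (x N) j ((induced_profile D \<chi>\<^sub>0 \<Theta> N (m N))(j := \<rho>)) - \<epsilon>
            \<le> outcome D N (x N) j (induced_profile D \<chi>\<^sub>0 \<Theta> N (m N))"
          using main[of N "x N" "m N" j \<rho>] xm j \<rho> N0[of N] by fastforce
      qed
      then show "\<exists>N0. \<forall>N>N0. eps_nash D N (x N) \<epsilon> (induced_profile D \<chi>\<^sub>0 \<Theta> N (m N))" by blast
    qed
  qed
qed

end
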